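(* Assume that (G1)–(G5) (listed in the context) hold, and consider the family of neutral functional differential equations $$\frac{d}{dt}Dz_t=F(\omega\cdot t,z_t),\quad t\ge0,\ \omega\in\Omega,$$ where $\Omega$ is the hull of $\tilde g$, $D_ix=x_i(0)-\gamma_i\,x_i(-\alpha_i)$ and $$F_i(\omega,x)=-\sum_{j=1}^m g_{ji}(\omega,x_i(0))+\sum_{j=1}^m g_{ij}(\omega\cdot(-\rho_{ij}),x_j(-\rho_{ij})),\qquad i=1,\ldots,m.$$ Let $(\omega_0,x_0)\in\Omega\times BU$ with $x_0$ Lipschitz. Then the solution $z(t,\omega_0,x_0)$ of the equation for $\omega_0$ with initial value $x_0$ is bounded and its omega-limit set is a copy of the base, that is, $\mathcal{O}(\omega_0,x_0)=\{(\omega,c(\omega)):\omega\in\Omega\}$ for a continuous equilibrium $c\colon\Omega\to BU$, and $$\lim_{t\to\infty}\mathsf{d}(u(t,\omega_0,x_0),c(\omega_0\cdot t))=0.$$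
   Context: $X=C((-\infty,0],\mathbb{R}^m)$ with the compact-open topology, metrized by $\mathsf{d}(x,y)=\sum_{n\ge1}2^{-n}\frac{\|x-y\|_n}{1+\|x-y\|_n}$, $\|x\|_n=\sup_{s\in[-n,0]}\|x(s)\|$, where $\|\cdot\|$ is the maximum norm on $\mathbb{R}^m$. $BU\subset X$ is the Banach space of bounded, uniformly continuous functions with the supremum norm. For a continuous function $z$ on $(-\infty,a]$ and $t\le a$, $z_t(s)=z(t+s)$, $s\le0$. Data: $\tilde g=(\tilde g_{ij})\colon\mathbb{R}\times\mathbb{R}\to\mathbb{R}^{m\times m}$ and real constants $\gamma_i\ge0$, $\alpha_i$, $\rho_{ij}$ ($i,j=1,\ldots,m$). (G1) $\tilde g$ is $C^1$-admissible: $\tilde g$ is $C^1$ in its second variable $v$ and $\tilde g$, $\frac{\partial}{\partial v}\tilde g$ are uniformly continuous and bounded on $\mathbb{R}\times\{v_0\}$ for all $v_0\in\mathbb{R}$. (G2) $\tilde g_{ij}(t,0)=0$ and $\tilde g_{ij}(t,v)$ is increasing in $v$ for each $t\in\mathbb{R}$ and $i,j=1,\ldots,m$. (G3) $\tilde g$ is a recurrent function, i.e. the translation flow on its hull is minimal. (G4) $\sum_{i=1}^m\gamma_i<1$, $\alpha_i>0$ and $\rho_{ij}\ge0$ for $i,j=1,\ldots,m$. (G5) For each $i=1,\ldots,m$ one of the following holds: (G5.1) $L_i^+=\sum_{j=1}^m l_{ji}^+<+\infty$ and there is a $\beta_i>0$ such that $\beta_i(1-\gamma_ie^{\beta_i\alpha_i})>L_i^+$;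 (G5.2) $L_i^+=\sum_{j=1}^m l_{ji}^+<+\infty$, $\alpha_i\ge\rho_{ii}$ and there is a $\beta_i\ge L_i^+$ such that $\beta_i(1-\gamma_ie^{\beta_i\alpha_i})+e^{\beta_i\rho_{ii}}\,l_{ii}^->L_i^+$; where $l_{ij}^+=\sup_{(t,v)\in\mathbb{R}^2}\frac{\partial\tilde g_{ij}}{\partial v}(t,v)$ and $l_{ii}^-=\inf_{(t,v)\in\mathbb{R}^2}\frac{\partial\tilde g_{ii}}{\partial v}(t,v)$. The hull $\Omega$ of $\tilde g$ is the closure, for the topology of uniform convergence on compact sets, of $\{\tilde g_t:t\in\mathbb{R}\}$, $\tilde g_t(s,v)=\tilde g(t+s,v)$; it is a compact metric space. The flow on $\Omega$ is $(\omega\cdot t)(s,v)=\omega(t+s,v)$. The function $g=(g_{ij})\colon\Omega\times\mathbb{R}\to\mathbb{R}^{m\times m}$ is $g(\omega,v)=\omega(0,v)$. For $(\omega,x)\in\Omega\times BU$, $z(t,\omega,x)$ is the unique solution of the equation for $\omega$ with $z(s,\omega,x)=x(s)$ for $s\le0$, and $u(t,\omega,x)(s)=z(t+s,\omega,x)$ for $s\le0$. The omega-limit set is $\mathcal{O}(\omega_0,x_0)=\{(\omega,x)\in\Omega\times BU:\exists\,t_n\uparrow\infty$ with $\omega_0\cdot t_n\to\omega$ and $\mathsf{d}(u(t_n,\omega_0,x_0),x)\to0\}$. An equilibrium is a map $c\colon\Omega\to BU$ such that $u(t,\omega,c(\omega))$ is defined and equals $c(\omega\cdot t)$ for all $\omega\in\Omega$,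 $t\ge0$; continuity of $c$ is with respect to the metric $\mathsf{d}$ on $BU$. *)

theory Defs
  imports "HOL-Analysis.Analysis"
begin

section \<open>Uniform convergence on compact sets\<close>

definition ucc_topology :: "('a::topological_space \<Rightarrow> 'b::metric_space) topology" where
  "ucc_topology = topology (\<lambda>U. \<forall>f\<in>U. \<exists>K e. compact K \<and> 0 < e \<and>
     {h. \<forall>x\<in>K. dist (h x) (f x) < e} \<subseteq> U)"

lemma openin_ucc_topology:
  "openin (ucc_topology :: ('a::topological_space \<Rightarrow> 'b::metric_space) topology) U \<longleftrightarrow>
     (\<forall>f\<in>U. \<exists>K e. compact K \<and> 0 < e \<and> {h. \<forall>x\<in>K. dist (h x) (f x) < e} \<subseteq> U)"
proof -
  let ?P = "\<lambda>U :: ('a \<Rightarrow> 'b) set. \<forall>f\<in>U. \<exists>K e. compact K \<and> 0 < e \<and>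
     {h. \<forall>x\<in>K. dist (h x) (f x) < e} \<subseteq> U"
  have "istopology ?P"
    unfolding istopology_def
  proof (intro conjI allI impI)
    fix S T :: "('a \<Rightarrow> 'b) set" assume S: "?P S" and T: "?P T"
    show "?P (S \<inter> T)"
    proof
      fix f assume f: "f \<in> S \<inter> T"
      from f have fS: "f \<in> S" and fT: "f \<in> T" by simp_all
      from S[rule_format, OF fS] obtain K e
        where K: "compact K" "0 < e" "{h. \<forall>x\<in>K. dist (h x) (f x) < e} \<subseteq> S" by (elim exE conjE)
      from T[rule_format, OF fT] obtain K' e'
        where K': "compact K'" "0 < e'" "{h. \<forall>x\<in>K'. dist (h x) (f x) < e'} \<subseteq> T" by (elim exE conjE)
      have "{h. \<forall>x\<in>K \<union> K'. dist (h x) (f x) < min e e'} \<subseteq> S \<inter> T"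
      proof
        fix h assume "h \<in> {h. \<forall>x\<in>K \<union> K'. dist (h x) (f x) < min e e'}"
        then have "h \<in> {h. \<forall>x\<in>K. dist (h x) (f x) < e}" "h \<in> {h. \<forall>x\<in>K'. dist (h x) (f x) < e'}"
          by simp_all
        then show "h \<in> S \<inter> T" using K(3) K'(3) by (simp only: Int_iff subset_iff)
      qed
      moreover have "compact (K \<union> K')" "0 < min e e'" using K K' by (simp_all add: compact_Un)
      ultimately show "\<exists>K e. compact K \<and> 0 < e \<and> {h. \<forall>x\<in>K. dist (h x) (f x) < e} \<subseteq> S \<inter> T"
        by (intro exI conjI)
    qed
  next
    fix \<K> :: "('a \<Rightarrow> 'b) set set" assume *: "\<forall>S\<in>\<K>. ?P S"
    show "?P (\<Union>\<K>)"
    proof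
      fix f assume "f \<in> \<Union>\<K>"
      then obtain S where S: "S \<in> \<K>" "f \<in> S" by (rule UnionE)
      from *[rule_format, OF S] obtain K e
        where K: "compact K" "0 < e" "{h. \<forall>x\<in>K. dist (h x) (f x) < e} \<subseteq> S" by (elim exE conjE)
      then show "\<exists>K e. compact K \<and> 0 < e \<and> {h. \<forall>x\<in>K. dist (h x) (f x) < e} \<subseteq> \<Union>\<K>"
        using order_trans[OF K(3) Union_upper[OF S(1)]] by (intro exI conjI)
    qed
  qed
  then show ?thesis
    unfolding ucc_topology_def by (subst topology_inverse') (assumption, rule refl)
qed

lemma topspace_ucc_topology [simp]:
  "topspace (ucc_topology :: ('a::topological_space \<Rightarrow> 'b::metric_space) topology) = UNIV"
proof -
  have "openin ucc_topology (UNIV :: ('a \<Rightarrow> 'b) set)"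
    unfolding openin_ucc_topology by (auto intro!: exI[of _ "{}"] exI[of _ 1])
  then show ?thesis using openin_subset by blast
qed

lemma limitin_ucc_topology:
  "limitin ucc_topology f l F \<longleftrightarrow> (\<forall>K. compact K \<longrightarrow> uniform_limit K f l F)"
proof
  assume L: "limitin ucc_topology f l F"
  show "\<forall>K. compact K \<longrightarrow> uniform_limit K f l F"
  proof (intro allI impI uniform_limitI)
    fix K :: "'a set" and e :: real assume K: "compact K" and e: "0 < e"
    define U where "U = {h. \<exists>d<e. \<forall>x\<in>K. dist (h x) (l x) < d}"
    have "openin ucc_topology U"
      unfolding openin_ucc_topology
    proof
      fix h assume "h \<in> U"
      then obtain d where d: "d < e" "\<forall>x\<in>K. dist (h x) (l x) < d" by (auto simp: U_def)
      have "{k. \<forall>x\<in>K. dist (k x) (h x) < (e - d) / 2} \<subseteq> U"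
      proof
        fix k assume k: "k \<in> {k. \<forall>x\<in>K. dist (k x) (h x) < (e - d) / 2}"
        have "dist (k x) (l x) < (e + d) / 2" if "x \<in> K" for x
        proof -
          have "dist (k x) (h x) < (e - d) / 2" "dist (h x) (l x) < d" using k d that by auto
          then show ?thesis using dist_triangle[of "k x" "l x" "h x"] by (simp add: field_simps)
        qed
        moreover have "(e + d) / 2 < e" using d by simp
        ultimately show "k \<in> U" unfolding U_def by blast
      qed
      then show "\<exists>K e. compact K \<and> 0 < e \<and> {k. \<forall>x\<in>K. dist (k x) (h x) < e} \<subseteq> U"
        using K d(1) by (intro exI[of _ K] exI[of _ "(e - d) / 2"]) auto
    qed
    moreover have "l \<in> U" using e unfolding U_def by (auto intro!: exI[of _ "e / 2"])
    ultimately have "\<forall>\<^sub>F n in F. f n \<in> U" using L by (auto simp: limitin_def)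
    then show "\<forall>\<^sub>F n in F. \<forall>x\<in>K. dist (f n x) (l x) < e"
    proof (rule eventually_mono)
      fix n assume "f n \<in> U"
      then obtain d where "d < e" "\<forall>x\<in>K. dist (f n x) (l x) < d" by (auto simp: U_def)
      then show "\<forall>x\<in>K. dist (f n x) (l x) < e" by (meson less_trans)
    qed
  qed
next
  assume R: "\<forall>K. compact K \<longrightarrow> uniform_limit K f l F"
  show "limitin ucc_topology f l F"
    unfolding limitin_def
  proof (intro conjI allI impI)
    fix U :: "('a \<Rightarrow> 'b) set" assume U: "openin ucc_topology U \<and> l \<in> U"
    then obtain K e where K: "compact K" "0 < e" "{h. \<forall>x\<in>K. dist (h x) (l x) < e} \<subseteq> U"
      unfolding openin_ucc_topology by blast
    have "\<forall>\<^sub>F n in F. \<forall>x\<in>K. dist (f n x) (l x) < e"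
      using R K by (simp add: uniform_limit_iff)
    then show "\<forall>\<^sub>F n in F. f n \<in> U"
      by (rule eventually_mono) (use K in auto)
  qed simp
qed

section \<open>The hull and its translation flow\<close>

definition translate :: "(real \<times> real \<Rightarrow> 'b) \<Rightarrow> real \<Rightarrow> real \<times> real \<Rightarrow> 'b" where
  "translate \<omega> t = (\<lambda>(s, v). \<omega> (t + s, v))"

definition hull_of :: "(real \<times> real \<Rightarrow> 'b::metric_space) \<Rightarrow> (real \<times> real \<Rightarrow> 'b) set" where
  "hull_of f = ucc_topology closure_of (range (translate f))"

definition hull_topology :: "(real \<times> real \<Rightarrow> 'b::metric_space) \<Rightarrow> (real \<times> real \<Rightarrow> 'b) topology" where
  "hull_topology f = subtopology ucc_topology (hull_of f)"

text \<open>Minimality of the flow: the hull has no nonempty proper closed invariant subset.\<close>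

definition recurrent :: "(real \<times> real \<Rightarrow> 'b::metric_space) \<Rightarrow> bool" where
  "recurrent f \<longleftrightarrow>
     (\<forall>M. closedin (hull_topology f) M \<and> M \<noteq> {} \<and> (\<forall>t. (\<lambda>\<omega>. translate \<omega> t) ` M = M)
        \<longrightarrow> M = hull_of f)"

section \<open>Admissibility\<close>

definition deriv_v :: "(real \<times> real \<Rightarrow> 'b::real_normed_vector) \<Rightarrow> real \<times> real \<Rightarrow> 'b" where
  "deriv_v f = (\<lambda>(t, v). vector_derivative (\<lambda>w. f (t, w)) (at v))"

definition C1_admissible :: "(real \<times> real \<Rightarrow> 'b::real_normed_vector) \<Rightarrow> bool" where
  "C1_admissible f \<longleftrightarrow>
     (\<forall>t. (\<lambda>v. f (t, v)) C1_differentiable_on UNIV) \<and>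
     (\<forall>v\<^sub>0. uniformly_continuous_on (UNIV \<times> {v\<^sub>0}) f \<and> bounded (f ` (UNIV \<times> {v\<^sub>0})) \<and>
           uniformly_continuous_on (UNIV \<times> {v\<^sub>0}) (deriv_v f) \<and>
           bounded (deriv_v f ` (UNIV \<times> {v\<^sub>0})))"

text \<open>The supremum and infimum are taken in \<^typ>\<open>ereal\<close> so that an unbounded derivative
  has \<open>l\<^sup>+ = \<infinity>\<close>.  The matrix entry \<open>f\<^sub>i\<^sub>j (p)\<close> is \<open>f p $ i $ j\<close>.\<close>

definition l_plus :: "(real \<times> real \<Rightarrow> real ^ 'm ^ 'm) \<Rightarrow> 'm::finite \<Rightarrow> 'm \<Rightarrow> ereal" where
  "l_plus f i j = (SUP p. ereal (deriv_v f p $ i $ j))"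

definition l_minus :: "(real \<times> real \<Rightarrow> real ^ 'm ^ 'm) \<Rightarrow> 'm::finite \<Rightarrow> 'm \<Rightarrow> ereal" where
  "l_minus f i j = (INF p. ereal (deriv_v f p $ i $ j))"

definition L_plus :: "(real \<times> real \<Rightarrow> real ^ 'm ^ 'm) \<Rightarrow> 'm::finite \<Rightarrow> ereal" where
  "L_plus f i = (\<Sum>j\<in>UNIV. l_plus f j i)"

section \<open>The phase space\<close>

text \<open>A function on \<open>(-\<infinity>, 0]\<close> is represented by a total function that is \<^const>\<open>undefined\<close>
  on the positive reals, so that equality of such functions is equality on \<open>(-\<infinity>, 0]\<close>.\<close>

definition X_space :: "(real \<Rightarrow> real ^ 'm::finite) set" where
  "X_space = {x \<in> extensional {..0}. continuous_on {..0} x}"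

definition BU :: "(real \<Rightarrow> real ^ 'm::finite) set" where
  "BU = {x \<in> extensional {..0}. uniformly_continuous_on {..0} x \<and> bounded (x ` {..0})}"

text \<open>On \<^typ>\<open>real ^ 'm\<close>, \<^const>\<open>infnorm\<close> is the maximum norm.\<close>

definition seminorm_X :: "nat \<Rightarrow> (real \<Rightarrow> real ^ 'm::finite) \<Rightarrow> real" where
  "seminorm_X n x = (SUP s\<in>{- real n..0}. infnorm (x s))"

text \<open>The value outside \<open>X\<close> only serves to make \<open>dist_X\<close> symmetric and nonnegative everywhere,
  as \<^locale>\<open>Metric_space\<close> requires.\<close>

definition dist_X :: "(real \<Rightarrow> real ^ 'm::finite) \<Rightarrow> (real \<Rightarrow> real ^ 'm) \<Rightarrow> real" where
  "dist_X x y = (if x \<in> X_space \<and> y \<in> X_space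
     then \<Sum>k. let n = Suc k; r = seminorm_X n (\<lambda>s. x s - y s) in (1 / 2) ^ n * (r / (1 + r))
     else 0)"

lemma BU_subset_X_space: "BU \<subseteq> X_space"
  by (auto simp: BU_def X_space_def intro: uniformly_continuous_imp_continuous)

lemma bdd_above_infnorm:
  assumes "continuous_on {..0} x"
  shows "bdd_above ((\<lambda>s. infnorm (x s)) ` {- real n..0})"
proof -
  have "continuous_on {- real n..0} (\<lambda>s. infnorm (x s))"
    using assms by (auto intro!: continuous_intros elim: continuous_on_subset)
  then show ?thesis
    by (intro bounded_imp_bdd_above compact_imp_bounded compact_continuous_image) auto
qed

lemma infnorm_le_seminorm_X:
  assumes "continuous_on {..0} x" "s \<in> {- real n..0}"
  shows "infnorm (x s) \<le> seminorm_X n x"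
  unfolding seminorm_X_def using assms by (intro cSUP_upper bdd_above_infnorm)

lemma seminorm_X_nonneg: "continuous_on {..0} x \<Longrightarrow> 0 \<le> seminorm_X n x"
  using infnorm_le_seminorm_X[of x 0 n] infnorm_pos_le[of "x 0"] by simp

lemma seminorm_X_triangle:
  assumes "continuous_on {..0} x" "continuous_on {..0} y" "continuous_on {..0} z"
  shows "seminorm_X n (\<lambda>s. x s - z s)
    \<le> seminorm_X n (\<lambda>s. x s - y s) + seminorm_X n (\<lambda>s. y s - z s)"
proof -
  have "infnorm (x s - z s) \<le> seminorm_X n (\<lambda>s. x s - y s) + seminorm_X n (\<lambda>s. y s - z s)"
    if s: "s \<in> {- real n..0}" for s
  proof -
    have "infnorm (x s - z s) \<le> infnorm (x s - y s) + infnorm (y s - z s)"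
      using infnorm_triangle[of "x s - y s" "y s - z s"] by simp
    also have "infnorm (x s - y s) \<le> seminorm_X n (\<lambda>s. x s - y s)"
      using assms s by (intro infnorm_le_seminorm_X[of "\<lambda>s. x s - y s"] continuous_intros)
    also have "infnorm (y s - z s) \<le> seminorm_X n (\<lambda>s. y s - z s)"
      using assms s by (intro infnorm_le_seminorm_X[of "\<lambda>s. y s - z s"] continuous_intros)
    finally show ?thesis by simp
  qed
  then show ?thesis
    unfolding seminorm_X_def[of n "\<lambda>s. x s - z s"] by (intro cSUP_least) auto
qed

context
  fixes x y :: "real \<Rightarrow> real ^ 'm::finite"
  assumes x: "x \<in> X_space" and y: "y \<in> X_space"
begin

private abbreviation a where
  "a k \<equiv> let n = Suc k; r = seminorm_X n (\<lambda>s. x s - y s) in (1 / 2) ^ n * (r / (1 + r))"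

lemma dist_X_seminorm_nonneg: "0 \<le> seminorm_X n (\<lambda>s. x s - y s)"
  using x y by (intro seminorm_X_nonneg continuous_intros) (auto simp: X_space_def)

lemma dist_X_term_bounds: "0 \<le> a k" "a k \<le> (1 / 2) ^ Suc k"
proof -
  show "0 \<le> a k" using dist_X_seminorm_nonneg[of "Suc k"] by (simp add: Let_def)
  have "(1 / 2) ^ Suc k * (seminorm_X (Suc k) (\<lambda>s. x s - y s) / (1 + seminorm_X (Suc k) (\<lambda>s. x s - y s)))
    \<le> (1 / 2) ^ Suc k * 1"
    using dist_X_seminorm_nonneg[of "Suc k"] by (intro mult_left_mono) simp_all
  then show "a k \<le> (1 / 2) ^ Suc k" by (simp add: Let_def)
qed

lemma dist_X_summable: "summable a"
proof (rule summable_comparison_test')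
  show "summable (\<lambda>k. (1 / 2 :: real) ^ Suc k)"
    using summable_geometric[of "1 / 2 :: real"] summable_Suc_iff by fastforce
next
  fix k
  show "norm (a k) \<le> (1 / 2) ^ Suc k"
    using dist_X_term_bounds[of k] unfolding real_norm_def by linarith
qed

lemma dist_X_eq: "dist_X x y = suminf a"
  using x y by (simp add: dist_X_def)

lemma dist_X_nonneg: "0 \<le> dist_X x y"
  unfolding dist_X_eq by (intro suminf_nonneg dist_X_summable dist_X_term_bounds)

lemma dist_X_eq_0: "dist_X x y = 0 \<longleftrightarrow> x = y"
proof
  assume "dist_X x y = 0"
  then have *: "a k = 0" for k
    using suminf_eq_zero_iff[OF dist_X_summable dist_X_term_bounds(1)] by (simp add: dist_X_eq)
  have S: "seminorm_X (Suc k) (\<lambda>s. x s - y s) = 0" for k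
  proof -
    have "1 + seminorm_X (Suc k) (\<lambda>s. x s - y s) \<noteq> 0"
      using dist_X_seminorm_nonneg[of "Suc k"] by linarith
    then show ?thesis using *[of k] unfolding Let_def mult_eq_0_iff divide_eq_0_iff by simp
  qed
  have "x s = y s" if "s \<le> 0" for s
  proof -
    obtain k where "- s \<le> real k" using real_arch_simple by blast
    then have "s \<in> {- real (Suc k)..0}" using that by simp
    moreover have "continuous_on {..0} (\<lambda>s. x s - y s)"
      using x y by (intro continuous_intros) (auto simp: X_space_def)
    ultimately have "infnorm (x s - y s) \<le> 0"
      using infnorm_le_seminorm_X[of "\<lambda>s. x s - y s" s "Suc k"] S by simp
    then show ?thesis using infnorm_pos_le[of "x s - y s"] by (simp add: infnorm_eq_0)
  qed
  then show "x = y"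
    using x y by (intro extensionalityI[of _ "{..0}"]) (auto simp: X_space_def)
next
  assume "x = y"
  then have "a k = 0" for k by (simp add: seminorm_X_def Let_def infnorm_0)
  then show "dist_X x y = 0" by (simp only: dist_X_eq suminf_zero)
qed

end

lemma dist_X_triangle:
  assumes "x \<in> X_space" "y \<in> X_space" "z \<in> X_space"
  shows "dist_X x z \<le> dist_X x y + dist_X y z"
proof -
  have "(let n = Suc k; r = seminorm_X n (\<lambda>s. x s - z s) in (1 / 2) ^ n * (r / (1 + r)))
    \<le> (let n = Suc k; r = seminorm_X n (\<lambda>s. x s - y s) in (1 / 2) ^ n * (r / (1 + r))) +
      (let n = Suc k; r = seminorm_X n (\<lambda>s. y s - z s) in (1 / 2) ^ n * (r / (1 + r)))" for k
  proof -
    have *: "r / (1 + r) \<le> p / (1 + p) + q / (1 + q)"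
      if "r \<le> p + q" "0 \<le> p" "0 \<le> q" "0 \<le> r" for p q r :: real
    proof -
      have "r / (1 + r) \<le> (p + q) / (1 + (p + q))"
        using that by (simp add: divide_simps) (simp add: algebra_simps)
      also have "\<dots> = p / (1 + (p + q)) + q / (1 + (p + q))" by (simp add: add_divide_distrib)
      also have "\<dots> \<le> p / (1 + p) + q / (1 + q)"
        using that by (intro add_mono divide_left_mono) auto
      finally show ?thesis .
    qed
    show ?thesis
      using *[OF seminorm_X_triangle, of x y z "Suc k"] assms
        dist_X_seminorm_nonneg[of x y "Suc k"] dist_X_seminorm_nonneg[of x z "Suc k"]
        dist_X_seminorm_nonneg[of y z "Suc k"]
      unfolding Let_def distrib_left[symmetric]
      by (intro mult_left_mono) (auto simp: X_space_def)
  qed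
  then have "dist_X x z \<le> (\<Sum>k.
      (let n = Suc k; r = seminorm_X n (\<lambda>s. x s - y s) in (1 / 2) ^ n * (r / (1 + r))) +
      (let n = Suc k; r = seminorm_X n (\<lambda>s. y s - z s) in (1 / 2) ^ n * (r / (1 + r))))"
    unfolding dist_X_eq[OF assms(1,3)]
    by (intro suminf_le summable_add dist_X_summable assms)
  also have "\<dots> = dist_X x y + dist_X y z"
    unfolding dist_X_eq[OF assms(1,2)] dist_X_eq[OF assms(2,3)]
    by (intro suminf_add[symmetric] dist_X_summable assms)
  finally show ?thesis .
qed

lemma Metric_space_X: "Metric_space X_space dist_X"
proof
  fix x y :: "real \<Rightarrow> real ^ 'm"
  show "dist_X x y = dist_X y x"
    unfolding dist_X_def seminorm_X_def by (subst infnorm_sub) (simp add: conj_commute)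
  show "0 \<le> dist_X x y"
    by (cases "x \<in> X_space \<and> y \<in> X_space") (auto simp: dist_X_nonneg, auto simp: dist_X_def)
qed (simp_all add: dist_X_eq_0 dist_X_triangle)

lemma Metric_space_BU: "Metric_space BU dist_X"
  using Metric_space_X BU_subset_X_space by (rule Metric_space.subspace)

section \<open>The neutral equation and its solution semiflow\<close>

definition segment :: "(real \<Rightarrow> real ^ 'm::finite) \<Rightarrow> real \<Rightarrow> real \<Rightarrow> real ^ 'm" where
  "segment z t = restrict (\<lambda>s. z (t + s)) {..0}"

lemma segment_in_X_space:
  assumes "continuous_on UNIV z"
  shows "segment z t \<in> X_space"
proof -
  have "continuous_on {..0} (\<lambda>s. z (t + s))"
    by (intro continuous_on_compose2[OF assms] continuous_intros) simp
  then have "continuous_on {..0} (segment z t)"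
    by (rule continuous_on_eq) (simp add: segment_def)
  then show ?thesis by (simp add: X_space_def segment_def)
qed

definition D_op :: "('m \<Rightarrow> real) \<Rightarrow> ('m \<Rightarrow> real) \<Rightarrow> (real \<Rightarrow> real ^ 'm::finite) \<Rightarrow> real ^ 'm" where
  "D_op \<gamma> \<alpha> x = (\<chi> i. x 0 $ i - \<gamma> i * x (- \<alpha> i) $ i)"

definition g_hull :: "(real \<times> real \<Rightarrow> 'b) \<Rightarrow> real \<Rightarrow> 'b" where
  "g_hull \<omega> v = \<omega> (0, v)"

definition F_op :: "('m \<Rightarrow> 'm \<Rightarrow> real) \<Rightarrow> (real \<times> real \<Rightarrow> real ^ 'm ^ 'm) \<Rightarrow>
    (real \<Rightarrow> real ^ 'm::finite) \<Rightarrow> real ^ 'm" where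
  "F_op \<rho> \<omega> x = (\<chi> i. - (\<Sum>j\<in>UNIV. g_hull \<omega> (x 0 $ i) $ j $ i)
     + (\<Sum>j\<in>UNIV. g_hull (translate \<omega> (- \<rho> i j)) (x (- \<rho> i j) $ j) $ i $ j))"

definition nfde_solution :: "('m \<Rightarrow> real) \<Rightarrow> ('m \<Rightarrow> real) \<Rightarrow> ('m \<Rightarrow> 'm \<Rightarrow> real) \<Rightarrow>
    (real \<times> real \<Rightarrow> real ^ 'm ^ 'm) \<Rightarrow> (real \<Rightarrow> real ^ 'm::finite) \<Rightarrow> (real \<Rightarrow> real ^ 'm) \<Rightarrow> bool" where
  "nfde_solution \<gamma> \<alpha> \<rho> \<omega> x z \<longleftrightarrow>
     continuous_on UNIV z \<and> (\<forall>s\<le>0. z s = x s) \<and>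
     (\<forall>t\<ge>0. ((\<lambda>t. D_op \<gamma> \<alpha> (segment z t)) has_vector_derivative
        F_op \<rho> (translate \<omega> t) (segment z t)) (at t within {0..}))"

text \<open>Solutions are global, i.e. defined on all of \<open>\<real>\<close>.  The descriptions \<open>sol\<close> and \<open>u_flow\<close>
  are meaningful only where \<open>has_sol\<close> holds.\<close>

definition has_sol :: "('m \<Rightarrow> real) \<Rightarrow> ('m \<Rightarrow> real) \<Rightarrow> ('m \<Rightarrow> 'm \<Rightarrow> real) \<Rightarrow>
    (real \<times> real \<Rightarrow> real ^ 'm ^ 'm) \<Rightarrow> (real \<Rightarrow> real ^ 'm::finite) \<Rightarrow> bool" where
  "has_sol \<gamma> \<alpha> \<rho> \<omega> x \<longleftrightarrow> (\<exists>!z. nfde_solution \<gamma> \<alpha> \<rho> \<omega> x z)"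

definition sol :: "('m \<Rightarrow> real) \<Rightarrow> ('m \<Rightarrow> real) \<Rightarrow> ('m \<Rightarrow> 'm \<Rightarrow> real) \<Rightarrow>
    (real \<times> real \<Rightarrow> real ^ 'm ^ 'm) \<Rightarrow> (real \<Rightarrow> real ^ 'm::finite) \<Rightarrow> real \<Rightarrow> real ^ 'm" where
  "sol \<gamma> \<alpha> \<rho> \<omega> x = (THE z. nfde_solution \<gamma> \<alpha> \<rho> \<omega> x z)"

definition u_flow :: "('m \<Rightarrow> real) \<Rightarrow> ('m \<Rightarrow> real) \<Rightarrow> ('m \<Rightarrow> 'm \<Rightarrow> real) \<Rightarrow> real \<Rightarrow>
    (real \<times> real \<Rightarrow> real ^ 'm ^ 'm) \<Rightarrow> (real \<Rightarrow> real ^ 'm::finite) \<Rightarrow> real \<Rightarrow> real ^ 'm" where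
  "u_flow \<gamma> \<alpha> \<rho> t \<omega> x = segment (sol \<gamma> \<alpha> \<rho> \<omega> x) t"

definition omega_limit :: "('m \<Rightarrow> real) \<Rightarrow> ('m \<Rightarrow> real) \<Rightarrow> ('m \<Rightarrow> 'm \<Rightarrow> real) \<Rightarrow>
    (real \<times> real \<Rightarrow> real ^ 'm ^ 'm) set \<Rightarrow>
    (real \<times> real \<Rightarrow> real ^ 'm ^ 'm) \<Rightarrow> (real \<Rightarrow> real ^ 'm::finite) \<Rightarrow>
    ((real \<times> real \<Rightarrow> real ^ 'm ^ 'm) \<times> (real \<Rightarrow> real ^ 'm)) set" where
  "omega_limit \<gamma> \<alpha> \<rho> \<Omega> \<omega>\<^sub>0 x\<^sub>0 = {(\<omega>, x). \<omega> \<in> \<Omega> \<and> x \<in> BU \<and>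
     (\<exists>\<tau> :: nat \<Rightarrow> real. (\<forall>n. 0 \<le> \<tau> n) \<and> incseq \<tau> \<and> filterlim \<tau> at_top sequentially \<and>
        limitin ucc_topology (\<lambda>n. translate \<omega>\<^sub>0 (\<tau> n)) \<omega> sequentially \<and>
        (\<lambda>n. dist_X (u_flow \<gamma> \<alpha> \<rho> (\<tau> n) \<omega>\<^sub>0 x\<^sub>0) x) \<longlonglongrightarrow> 0)}"

definition equilibrium :: "('m \<Rightarrow> real) \<Rightarrow> ('m \<Rightarrow> real) \<Rightarrow> ('m \<Rightarrow> 'm \<Rightarrow> real) \<Rightarrow>
    (real \<times> real \<Rightarrow> real ^ 'm ^ 'm) set \<Rightarrow>
    ((real \<times> real \<Rightarrow> real ^ 'm ^ 'm) \<Rightarrow> real \<Rightarrow> real ^ 'm::finite) \<Rightarrow> bool" where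
  "equilibrium \<gamma> \<alpha> \<rho> \<Omega> c \<longleftrightarrow> c \<in> \<Omega> \<rightarrow> BU \<and>
     (\<forall>\<omega>\<in>\<Omega>. has_sol \<gamma> \<alpha> \<rho> \<omega> (c \<omega>) \<and>
        (\<forall>t\<ge>0. u_flow \<gamma> \<alpha> \<rho> t \<omega> (c \<omega>) = c (translate \<omega> t)))"

end

theory Submission
  imports Defs "HOL-Complex_Analysis.Great_Picard" "HOL-Library.Diagonal_Subsequence"
begin

text \<open>
  The total amount of material in compartments and pipes is conserved, and (G5) says exactly that the
  difference of two solutions stays in the cone of componentwise nonnegative functions \<open>y\<close> with
  \<open>exp (\<beta>\<^sub>i t) y\<^sub>i(t)\<close> increasing, even with a strict drift.  On this cone the mass controls the size, so the
  equation is uniformly stable; since the difference operator forgets the roughness of the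
  initial value, bounded entire solutions that are close on a long window stay close forever.

  Let \<open>K\<close> be the compact invariant set of entire solutions arising as limits of translates of the given
  solution.  Among the entire solutions \<open>p\<close> that dominate the whole fibre of \<open>K\<close> over
  their base point choose those of minimal mass.  If for some component \<open>i\<close> they stayed a positive distance above
  \<open>K\<close>, the strict drift would allow us to lower them, contradicting minimality.  Hence the set of
  points of \<open>K\<close> whose \<open>i\<close>-th component agrees with that of such a \<open>p\<close> is nonempty; it is again compact and
  invariant, and its \<open>i\<close>-th component is determined by the base point.  After treating all components
  we obtain a copy of the base, and stability forces the given solution to converge to it.

  Compactness of the set of dominating solutions needs lower semicontinuity of the fibres of \<open>K\<close>.  It
  follows from stability and minimality of the hull by counting separated points of the fibres.
\<close>

section \<open>Uniform convergence on compact sets\<close>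

text \<open>The componentwise order alone gives no control over D, which subtracts a delayed value.
  With the weight exp(\<beta> t) the neutral relation becomes Y(t) = \<gamma> exp(\<beta> \<alpha>)
  Y(t - \<alpha>) + W(t), where W is the weighted value of D. The coefficient is nonnegative, so
  once W increases, Y does too, and the derivative of W is what the rate condition bounds from
  below. The price: constants are order units of the cone only relative to a norm containing a
  Lipschitz constant, so uniform closeness on one delay window does not yet give stability. Longer
  windows repair this: going back n delays damps an old Lipschitz constant by the n-th power of the
  largest \<gamma>, and the rest is governed by the equation. The pointwise supremum of a fibre of
  \<open>K\<close> is in general no solution, hence the selection by mass among solutions above it.
  Several minimal ones may lie over one base point, but all have the same mass, so minimality
  survives translations and limits. Solutions on the whole line make translations invertible:
  contact at one time spreads backwards, and limits of translates towards -infinity turn it into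
  contact at all times.\<close>

abbreviation ucc_lim :: "(nat \<Rightarrow> 'a::topological_space \<Rightarrow> 'b::metric_space) \<Rightarrow> ('a \<Rightarrow> 'b) \<Rightarrow> bool" where
  "ucc_lim f l \<equiv> limitin ucc_topology f l sequentially"

lemma ucc_limD:
  assumes "ucc_lim f l" "compact K" "0 < e"
  shows "\<forall>\<^sub>F n in sequentially. \<forall>x\<in>K. dist (f n x) (l x) < e"
  using assms unfolding limitin_ucc_topology uniform_limit_iff by blast

lemma ucc_lim_pointwise:
  assumes "ucc_lim f l"
  shows "(\<lambda>n. f n x) \<longlonglongrightarrow> l x"
  using ucc_limD[OF assms, of "{x}"] by (auto simp: tendsto_iff)

lemma ucc_lim_subseq: "ucc_lim f l \<Longrightarrow> strict_mono \<sigma> \<Longrightarrow> ucc_lim (\<lambda>n. f (\<sigma> n)) l"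
  using limitin_subsequence[of \<sigma> ucc_topology f l] by (simp add: o_def)

lemma ucc_lim_const: "ucc_lim (\<lambda>_. f) f"
  by (simp add: limitin_ucc_topology uniform_limit_const)

lemma ucc_lim_unique:
  assumes "ucc_lim f l" "ucc_lim f l'"
  shows "l = l'"
  using LIMSEQ_unique ucc_lim_pointwise assms by blast

lemma ucc_limI:
  fixes f :: "nat \<Rightarrow> 'a::euclidean_space \<Rightarrow> 'b::metric_space"
  assumes "\<And>e m. 0 < e \<Longrightarrow> \<forall>\<^sub>F n in sequentially. \<forall>x\<in>cball 0 (real m). dist (f n x) (l x) < e"
  shows "ucc_lim f l"
  unfolding limitin_ucc_topology uniform_limit_iff
proof (intro allI impI)
  fix K :: "'a set" and e :: real assume K: "compact K" and e: "0 < e"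
  from K obtain B where B: "\<forall>x\<in>K. norm x \<le> B" using compact_imp_bounded bounded_iff by metis
  obtain m where "B \<le> real m" using real_arch_simple by blast
  then have "K \<subseteq> cball 0 (real m)" using B by (auto simp: order_trans)
  then show "\<forall>\<^sub>F n in sequentially. \<forall>x\<in>K. dist (f n x) (l x) < e"
    using assms[OF e, of m] by (auto elim!: eventually_mono)
qed

text \<open>Arzela-Ascoli on the balls of integer radius, glued by a diagonal subsequence. Only a
  tail of the diagonal sequence is a subsequence of the one chosen for the ball of radius
  \<open>k\<close>; hence the index shift by \<open>Suc k\<close>, which is undone when the limit is
  taken.\<close>

lemma ucc_Arzela_Ascoli:
  fixes f :: "nat \<Rightarrow> 'a::euclidean_space \<Rightarrow> 'b::{real_normed_vector,heine_borel}"
  assumes bd: "\<And>R. \<exists>M. \<forall>n. \<forall>x\<in>cball 0 R. norm (f n x) \<le> M"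
    and equi: "\<And>x e. 0 < e \<Longrightarrow> \<exists>d>0. \<forall>n y. dist y x < d \<longrightarrow> dist (f n y) (f n x) < e"
  obtains l \<sigma> where "strict_mono (\<sigma> :: nat \<Rightarrow> nat)" "ucc_lim (\<lambda>n. f (\<sigma> n)) l"
proof -
  define P where "P m s \<longleftrightarrow> uniformly_convergent_on (cball 0 (real m)) (\<lambda>n. f (s n))" for m and s :: "nat \<Rightarrow> nat"
  interpret subseqs P
  proof
    fix m and s :: "nat \<Rightarrow> nat" assume "strict_mono s"
    obtain M where M: "\<And>n x. x \<in> cball 0 (real m) \<Longrightarrow> norm (f n x) \<le> M" using bd by blast
    have equi': "\<exists>d>0. \<forall>n y. y \<in> cball 0 (real m) \<and> norm (x - y) < d \<longrightarrow> norm (f (s n) x - f (s n) y) < e"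
      if "0 < e" for x e
      using equi[OF that, of x] by (metis dist_commute dist_norm)
    obtain g r where gr: "continuous_on (cball 0 (real m)) g" "strict_mono (r :: nat \<Rightarrow> nat)"
      "\<And>e. 0 < e \<Longrightarrow> \<exists>N. \<forall>n x. n \<ge> N \<and> x \<in> cball 0 (real m) \<longrightarrow> norm (f (s (r n)) x - g x) < e"
      by (rule Arzela_Ascoli[of "cball 0 (real m)" "\<lambda>n. f (s n)" M]) (use M equi' in auto)
    have "uniform_limit (cball 0 (real m)) (\<lambda>n. f (s (r n))) g sequentially"
      unfolding uniform_limit_iff eventually_sequentially dist_norm using gr(3) by meson
    then show "\<exists>r'. strict_mono r' \<and> P m (s \<circ> r')"
      using gr(2) unfolding P_def uniformly_convergent_on_def by auto
  qed
  have stable: "P n (s \<circ> r)" if r: "strict_mono r" and Pn: "P n s" for n s r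
  proof -
    obtain h where "uniform_limit (cball 0 (real n)) (\<lambda>k. f (s k)) h sequentially"
      using Pn unfolding P_def uniformly_convergent_on_def by blast
    then have "uniform_limit (cball 0 (real n)) (\<lambda>k. f (s (r k))) h sequentially"
      using filterlim_compose[OF _ filterlim_subseq[OF r]] by blast
    then show ?thesis unfolding P_def uniformly_convergent_on_def by auto
  qed
  have P: "P k (diagseq \<circ> (+) (Suc k))" for k
    by (rule diagseq_holds) (rule stable)
  define l where "l x = lim (\<lambda>n. f (diagseq n) x)" for x
  have lim: "uniform_limit (cball 0 (real k)) (\<lambda>n. f (diagseq n)) l sequentially" for k
  proof -
    obtain h where h: "uniform_limit (cball 0 (real k)) (\<lambda>n. f (diagseq (Suc k + n))) h sequentially"
      using P[of k] unfolding P_def uniformly_convergent_on_def by auto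
    have h': "uniform_limit (cball 0 (real k)) (\<lambda>n. f (diagseq n)) h sequentially"
      unfolding uniform_limit_iff
    proof (intro allI impI)
      fix e :: real assume "0 < e"
      then have "\<forall>\<^sub>F n in sequentially. \<forall>x\<in>cball 0 (real k). dist (f (diagseq (n + Suc k)) x) (h x) < e"
        using h unfolding uniform_limit_iff by (simp add: add.commute)
      then show "\<forall>\<^sub>F n in sequentially. \<forall>x\<in>cball 0 (real k). dist (f (diagseq n) x) (h x) < e"
        by (rule eventually_sequentially_seg[THEN iffD1])
    qed
    have "h x = l x" if "x \<in> cball 0 (real k)" for x
      using tendsto_uniform_limitI[OF h' that] by (simp add: l_def limI)
    then show ?thesis using h' unfolding uniform_limit_iff by (auto elim!: eventually_mono)
  qed
  have "ucc_lim (\<lambda>n. f (diagseq n)) l"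
    by (rule ucc_limI) (use lim in \<open>auto simp: uniform_limit_iff\<close>)
  then show ?thesis using subseq_diagseq that by blast
qed

text \<open>The bound must be uniform, with some \<open>d < e\<close>: the functions are arbitrary,
  and if the supremum of the distances over \<open>K\<close> equals \<open>e\<close> without being
  attained, arbitrarily small perturbations leave the set defined by \<open>< e\<close>
  alone.\<close>

lemma ucc_topology_ball_open:
  "openin ucc_topology {h. \<exists>d<e. \<forall>x\<in>K. dist (h x) (l x) < d}" if "compact K"
  unfolding openin_ucc_topology
proof safe
  fix f d assume d: "d < e" "\<forall>x\<in>K. dist (f x) (l x) < d"
  have "{k. \<forall>x\<in>K. dist (k x) (f x) < (e - d) / 2} \<subseteq> {h. \<exists>d<e. \<forall>x\<in>K. dist (h x) (l x) < d}"
  proof safe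
    fix k assume k: "\<forall>x\<in>K. dist (k x) (f x) < (e - d) / 2"
    have "dist (k x) (l x) < (e + d) / 2" if "x \<in> K" for x
    proof -
      have "dist (k x) (f x) < (e - d) / 2" "dist (f x) (l x) < d" using k d that by auto
      then show ?thesis using dist_triangle[of "k x" "l x" "f x"] by (simp add: field_simps)
    qed
    moreover have "(e + d) / 2 < e" using d by simp
    ultimately show "\<exists>d<e. \<forall>x\<in>K. dist (k x) (l x) < d" by blast
  qed
  then show "\<exists>Ka ea. compact Ka \<and> 0 < ea \<and> {h. \<forall>x\<in>Ka. dist (h x) (f x) < ea}
      \<subseteq> {h. \<exists>d<e. \<forall>x\<in>K. dist (h x) (l x) < d}"
    using that d(1) by (intro exI[of _ K] exI[of _ "(e - d) / 2"]) auto
qed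

lemma inverse_Suc_less: "0 < e \<Longrightarrow> \<forall>\<^sub>F n in sequentially. inverse (real (Suc n)) < e"
  using order_tendstoD(2)[OF LIMSEQ_inverse_real_of_nat] by simp

lemma ucc_limI_balls:
  fixes f :: "nat \<Rightarrow> 'a::euclidean_space \<Rightarrow> 'b::metric_space"
  assumes "\<And>n x. x \<in> cball 0 (real n) \<Longrightarrow> dist (f n x) (l x) < inverse (real (Suc n))"
  shows "ucc_lim f l"
proof (rule ucc_limI)
  fix e :: real and m assume "0 < e"
  show "\<forall>\<^sub>F n in sequentially. \<forall>x\<in>cball 0 (real m). dist (f n x) (l x) < e"
    using inverse_Suc_less[OF \<open>0 < e\<close>] eventually_ge_at_top[of m]
  proof eventually_elim
    case (elim n)
    then have "cball (0::'a) (real m) \<subseteq> cball 0 (real n)" by auto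
    then show ?case using assms[of _ n] elim(1) by force
  qed
qed

text \<open>Compact subsets of a Euclidean space are absorbed by the balls \<open>cball 0 n\<close>,
  so the neighbourhoods with radius \<open>n\<close> and tolerance 1/(n+1) suffice, and sequences
  describe closures.\<close>

lemma ucc_closure_seq:
  fixes S :: "('a::euclidean_space \<Rightarrow> 'b::metric_space) set"
  shows "l \<in> ucc_topology closure_of S \<longleftrightarrow> (\<exists>f. (\<forall>n. f n \<in> S) \<and> ucc_lim f l)"
proof
  assume l: "l \<in> ucc_topology closure_of S"
  have "\<exists>f\<in>S. \<forall>x\<in>cball 0 (real n). dist (f x) (l x) < inverse (real (Suc n))" for n
  proof -
    let ?U = "{h. \<exists>d<inverse (real (Suc n)). \<forall>x\<in>cball 0 (real n). dist (h x) (l x) < d}"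
    have "openin ucc_topology ?U" by (rule ucc_topology_ball_open) simp
    moreover have "l \<in> ?U" by (auto intro!: exI[of _ "inverse (real (Suc n)) / 2"])
    ultimately have "\<exists>y. y \<in> S \<and> y \<in> ?U"
      using l[unfolded in_closure_of, THEN conjunct2, rule_format, of ?U] by simp
    then obtain f d where "f \<in> S" "d < inverse (real (Suc n))" "\<forall>x\<in>cball 0 (real n). dist (f x) (l x) < d"
      by auto
    then show ?thesis by (meson less_trans)
  qed
  then obtain f where f: "\<And>n. f n \<in> S"
    "\<And>n x. x \<in> cball 0 (real n) \<Longrightarrow> dist (f n x) (l x) < inverse (real (Suc n))"
    by metis
  then have "ucc_lim f l" by (intro ucc_limI_balls)
  then show "\<exists>f. (\<forall>n. f n \<in> S) \<and> ucc_lim f l" using f(1) by blast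
next
  assume "\<exists>f. (\<forall>n. f n \<in> S) \<and> ucc_lim f l"
  then obtain f where f: "\<And>n. f n \<in> S" "ucc_lim f l" by blast
  show "l \<in> ucc_topology closure_of S"
    unfolding in_closure_of
  proof (intro conjI allI impI)
    fix T assume "l \<in> T \<and> openin ucc_topology T"
    then have "\<forall>\<^sub>F n in sequentially. f n \<in> T" using f(2) by (auto simp: limitin_def)
    then obtain n where "f n \<in> T" by (meson eventually_sequentially order_refl)
    then show "\<exists>y. y \<in> S \<and> y \<in> T" using f(1) by blast
  qed simp
qed

section \<open>Exponentially monotone functions\<close>

text \<open>For differentiable \<open>y\<close> the second clause says y' >= - b y. It is stated
  without derivatives because solutions of neutral equations may fail to have them, and because this
  form passes to pointwise limits. Nonnegativity at the left end propagates through the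
  window.\<close>

definition exp_mono :: "real \<Rightarrow> real \<Rightarrow> real \<Rightarrow> (real \<Rightarrow> real) \<Rightarrow> bool" where
  "exp_mono b p q y \<longleftrightarrow> 0 \<le> y p \<and>
     (\<forall>s s'. p \<le> s \<longrightarrow> s \<le> s' \<longrightarrow> s' \<le> q \<longrightarrow> exp (b * s) * y s \<le> exp (b * s') * y s')"

lemma exp_monoD:
  assumes "exp_mono b p q y" "p \<le> s" "s \<le> s'" "s' \<le> q"
  shows "y s \<le> exp (b * (s' - s)) * y s'"
proof -
  have "exp (b * s) * y s \<le> exp (b * s') * y s'"
    using assms by (auto simp: exp_mono_def)
  also have "\<dots> = exp (b * s) * (exp (b * (s' - s)) * y s')"
    by (simp add: right_diff_distrib left_diff_distrib exp_diff exp_minus field_simps)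
  finally show ?thesis by simp
qed

lemma exp_mono_nonneg:
  assumes "exp_mono b p q y" "p \<le> s" "s \<le> q"
  shows "0 \<le> y s"
proof -
  have "0 \<le> y p" using assms by (simp add: exp_mono_def)
  also have "\<dots> \<le> exp (b * (s - p)) * y s" using assms by (intro exp_monoD[of b p q]) auto
  finally show ?thesis by (simp add: zero_le_mult_iff)
qed

lemma exp_mono_le:
  assumes "exp_mono b p q y" "p \<le> s" "s \<le> s'" "s' \<le> q"
  shows "exp (- b * (s' - s)) * y s \<le> y s'"
proof -
  have "exp (- b * (s' - s)) * y s \<le> exp (- b * (s' - s)) * (exp (b * (s' - s)) * y s')"
    using exp_monoD[OF assms] by (intro mult_left_mono) auto
  also have "\<dots> = y s'" by (simp add: mult.assoc[symmetric] exp_add[symmetric])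
  finally show ?thesis .
qed

text \<open>The two cases are (G5.1) and (G5.2): this is the only place where they enter.\<close>

definition rate_cond :: "real \<Rightarrow> real \<Rightarrow> real \<Rightarrow> real \<Rightarrow> real \<Rightarrow> real \<Rightarrow> bool" where
  "rate_cond b c a \<rho> L l \<longleftrightarrow> b * (1 - c * exp (b * a)) > L \<or>
     (\<rho> \<le> a \<and> L \<le> b \<and> b * (1 - c * exp (b * a)) + exp (b * \<rho>) * l > L)"

text \<open>The right-hand side is the lower estimate that the increment bounds give for the
  weighted drift of D. Exponential monotonicity expresses the delayed values through a single one,
  and the strict inequality leaves a positive coefficient \<open>g\<close>. The result is measured
  by the oldest value \<open>y (t - r)\<close>, since positivity of that value is what propagates in
  time.\<close>

lemma rate_cond_drift:
  assumes rc: "rate_cond b c a \<rho> L l" and "0 < b" "0 \<le> c" "0 < a" "a \<le> r" "0 \<le> \<rho>" "\<rho> \<le> r" "0 \<le> l" "l \<le> L"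
  shows "\<exists>\<kappa>>0. \<forall>y t. exp_mono b (t - r) t y \<longrightarrow>
    \<kappa> * y (t - r) \<le> b * (y t - c * y (t - a)) - L * y t + l * y (t - \<rho>)"
proof -
  have *: "exp (- b * r) * g * y (t - r) \<le> g * (exp (- b * u) * y (t - u))"
    if "exp_mono b (t - r) t y" "0 \<le> u" "u \<le> r" "0 < g" for g y t u
  proof -
    have "exp (- b * (r - u)) * y (t - r) \<le> y (t - u)"
      using exp_mono_le[OF that(1), of "t - r" "t - u"] that by simp
    then have "g * (exp (- b * u) * (exp (- b * (r - u)) * y (t - r))) \<le> g * (exp (- b * u) * y (t - u))"
      using that by (intro mult_left_mono) auto
    also have "g * (exp (- b * u) * (exp (- b * (r - u)) * y (t - r))) = exp (- b * r) * g * y (t - r)"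
      by (simp add: right_diff_distrib left_diff_distrib exp_diff exp_minus field_simps)
    finally show ?thesis .
  qed
  from rc consider (1) "b * (1 - c * exp (b * a)) > L" |
    (2) "\<rho> \<le> a" "L \<le> b" "b * (1 - c * exp (b * a)) + exp (b * \<rho>) * l > L"
    by (auto simp: rate_cond_def)
  then show ?thesis
  proof cases
    case 1
    define g where "g = b * (1 - c * exp (b * a)) - L"
    have "exp (- b * r) * g * y (t - r) \<le> b * (y t - c * y (t - a)) - L * y t + l * y (t - \<rho>)"
      if y: "exp_mono b (t - r) t y" for y t
    proof -
      have "y (t - a) \<le> exp (b * a) * y t" using exp_monoD[OF y, of "t - a" t] assms by simp
      then have "b * c * y (t - a) \<le> b * c * (exp (b * a) * y t)" using assms by (intro mult_left_mono) auto
      moreover have "0 \<le> l * y (t - \<rho>)" using exp_mono_nonneg[OF y] assms by simp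
      ultimately have "g * y t \<le> b * (y t - c * y (t - a)) - L * y t + l * y (t - \<rho>)"
        by (simp add: g_def algebra_simps)
      moreover have "exp (- b * r) * g * y (t - r) \<le> g * y t"
        using *[OF y, of 0 g] assms 1 by (simp add: g_def)
      ultimately show ?thesis by simp
    qed
    then show ?thesis using 1 by (intro exI[of _ "exp (- b * r) * g"]) (auto simp: g_def)
  next
    case 2
    define g where "g = b * (1 - c * exp (b * a)) + exp (b * \<rho>) * l - L"
    have "exp (- b * r) * g * y (t - r) \<le> b * (y t - c * y (t - a)) - L * y t + l * y (t - \<rho>)"
      if y: "exp_mono b (t - r) t y" for y t
    proof -
      \<comment> \<open>\<open>q\<close> is the least value that exponential monotonicity allows for
        \<open>y t\<close>, given \<open>y (t - \<rho>)\<close>. As \<open>b - L\<close> is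
        nonnegative, \<open>y t\<close> may be replaced by \<open>q\<close>, and
        \<open>\<rho> \<le> a\<close> bounds the neutral term by \<open>q\<close> as well.\<close>
      define q where "q = exp (- b * \<rho>) * y (t - \<rho>)"
      have q: "y (t - \<rho>) = exp (b * \<rho>) * q"
        by (simp add: q_def exp_minus field_simps)
      have "y (t - a) \<le> exp (b * (a - \<rho>)) * y (t - \<rho>)"
        using exp_monoD[OF y, of "t - a" "t - \<rho>"] assms 2 by simp
      also have "\<dots> = exp (b * a) * q"
        by (simp add: q_def right_diff_distrib exp_diff exp_minus field_simps)
      finally have "b * c * y (t - a) \<le> b * c * (exp (b * a) * q)"
        using assms by (intro mult_left_mono) auto
      moreover have "q \<le> y t" using exp_mono_le[OF y, of "t - \<rho>" t] assms by (simp add: q_def)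
      then have "(b - L) * q \<le> (b - L) * y t" using 2 by (intro mult_left_mono) auto
      ultimately have "g * q \<le> b * (y t - c * y (t - a)) - L * y t + l * y (t - \<rho>)"
        by (simp add: g_def q algebra_simps)
      moreover have "exp (- b * r) * g * y (t - r) \<le> g * q"
        using *[OF y, of \<rho> g] assms 2 by (simp add: g_def q_def)
      ultimately show ?thesis by simp
    qed
    then show ?thesis using 2 by (intro exI[of _ "exp (- b * r) * g"]) (auto simp: g_def)
  qed
qed

text \<open>This is the mass of one compartment together with the pipe from it to itself. In the
  first case D alone is coercive. In the second, 1 - c exp(b a) may be negative, and the pipe
  compensates: on its window \<open>y\<close> stays above a decaying exponential that ends in the
  value \<open>q\<close>.\<close>

lemma rate_cond_mass:
  assumes rc: "rate_cond b c a \<rho> L l" and "0 < b" "0 \<le> c" "0 < a" "a \<le> r" "0 \<le> \<rho>" "\<rho> \<le> r" "0 \<le> l" "l \<le> L"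
  shows "\<exists>\<theta>>0. \<forall>y t. exp_mono b (t - r) t y \<longrightarrow> continuous_on UNIV y \<longrightarrow>
    \<theta> * y t \<le> y t - c * y (t - a) + l * integral {t - \<rho>..t} y"
proof -
  have int: "y integrable_on {t - \<rho>..t}" if "continuous_on UNIV y" for y :: "real \<Rightarrow> real" and t
    by (intro integrable_continuous_real continuous_on_subset[OF that]) simp
  from rc consider (1) "b * (1 - c * exp (b * a)) > L" |
    (2) "\<rho> \<le> a" "L \<le> b" "b * (1 - c * exp (b * a)) + exp (b * \<rho>) * l > L"
    by (auto simp: rate_cond_def)
  then show ?thesis
  proof cases
    case 1
    then have "0 < b * (1 - c * exp (b * a))" using assms by linarith
    then have pos: "0 < 1 - c * exp (b * a)" using assms by (simp add: zero_less_mult_iff)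
    have "(1 - c * exp (b * a)) * y t \<le> y t - c * y (t - a) + l * integral {t - \<rho>..t} y"
      if y: "exp_mono b (t - r) t y" "continuous_on UNIV y" for y t
    proof -
      have "y (t - a) \<le> exp (b * a) * y t" using exp_monoD[OF y(1), of "t - a" t] assms by simp
      then have "c * y (t - a) \<le> c * (exp (b * a) * y t)" using assms by (intro mult_left_mono) auto
      moreover have "0 \<le> integral {t - \<rho>..t} y"
        using exp_mono_nonneg[OF y(1)] assms by (intro integral_nonneg int y) auto
      then have "0 \<le> l * integral {t - \<rho>..t} y" using assms by simp
      ultimately show ?thesis by (simp add: algebra_simps)
    qed
    then show ?thesis using pos by blast
  next
    case 2
    \<comment> \<open>\<open>k\<close> collects the coefficients of \<open>q\<close> from the pipe
      and from the neutral term; \<open>0 < 1 + k\<close> is the rate condition combined with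
      \<open>l \<le> L\<close>.\<close>
    define k where "k = l * (exp (b * \<rho>) - 1) / b - c * exp (b * a)"
    have "b * (1 + k) = b * (1 - c * exp (b * a)) + exp (b * \<rho>) * l - l"
      using assms by (simp add: k_def field_simps)
    also have "\<dots> > 0" using 2 assms by linarith
    finally have pos: "0 < 1 + k" using assms by (simp add: zero_less_mult_iff)
    have "min 1 (1 + k) * y t \<le> y t - c * y (t - a) + l * integral {t - \<rho>..t} y"
      if y: "exp_mono b (t - r) t y" "continuous_on UNIV y" for y t
    proof -
      define q where "q = exp (- b * \<rho>) * y (t - \<rho>)"
      have q: "y (t - \<rho>) = exp (b * \<rho>) * q"
        by (simp add: q_def exp_minus field_simps)
      have "y (t - a) \<le> exp (b * (a - \<rho>)) * y (t - \<rho>)"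
        using exp_monoD[OF y(1), of "t - a" "t - \<rho>"] assms 2 by simp
      also have "\<dots> = exp (b * a) * q"
        by (simp add: q_def right_diff_distrib exp_diff exp_minus field_simps)
      finally have A: "c * y (t - a) \<le> c * (exp (b * a) * q)"
        using assms by (intro mult_left_mono) auto
      have qt: "q \<le> y t" using exp_mono_le[OF y(1), of "t - \<rho>" t] assms by (simp add: q_def)
      have q0: "0 \<le> q" using exp_mono_nonneg[OF y(1)] assms by (simp add: q_def)
      have "((\<lambda>s. exp (- b * (s - t)) * q) has_integral
          (- exp (- b * (t - t)) * q / b) - (- exp (- b * (t - \<rho> - t)) * q / b)) {t - \<rho>..t}"
        using assms
        by (intro fundamental_theorem_of_calculus)
          (auto intro!: derivative_eq_intros simp: has_real_derivative_iff_has_vector_derivative[symmetric])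
      then have I: "((\<lambda>s. exp (- b * (s - t)) * q) has_integral (exp (b * \<rho>) - 1) / b * q) {t - \<rho>..t}"
        by (simp add: algebra_simps diff_divide_distrib)
      have "(exp (b * \<rho>) - 1) / b * q \<le> integral {t - \<rho>..t} y"
      proof (rule has_integral_le[OF I integrable_integral[OF int[OF y(2)]]])
        fix s assume s: "s \<in> {t - \<rho>..t}"
        have "exp (- b * (s - (t - \<rho>))) * y (t - \<rho>) \<le> y s"
          using exp_mono_le[OF y(1), of "t - \<rho>" s] s assms by simp
        moreover have "exp (- b * (s - (t - \<rho>))) * y (t - \<rho>) = exp (- b * (s - t)) * q"
          by (simp add: q_def right_diff_distrib exp_diff exp_add exp_minus field_simps)
        ultimately show "exp (- b * (s - t)) * q \<le> y s" by simp
      qed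
      then have "l * ((exp (b * \<rho>) - 1) / b * q) \<le> l * integral {t - \<rho>..t} y"
        using assms by (intro mult_left_mono) auto
      then have "y t + k * q \<le> y t - c * y (t - a) + l * integral {t - \<rho>..t} y"
        using A by (simp add: k_def algebra_simps)
      \<comment> \<open>The sign of \<open>k\<close> is open: if it is nonnegative,
        \<open>k * q\<close> is dropped, otherwise \<open>q \<le> y t\<close> is used.\<close>
      moreover have "min 1 (1 + k) * y t \<le> y t + k * q"
      proof (cases "0 \<le> k")
        case True
        then show ?thesis using q0 by simp
      next
        case False
        then have "k * y t \<le> k * q" using qt by (intro mult_left_mono_neg) auto
        then show ?thesis using False by (simp add: algebra_simps)
      qed
      ultimately show ?thesis by simp
    qed
    then show ?thesis using pos by (intro exI[of _ "min 1 (1 + k)"]) auto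
  qed
qed

text \<open>For smooth \<open>y\<close> the claim amounts to y' <= b (k - y): the room
  \<open>k - y\<close> has to pay for the growth rate \<Lambda>. The factor
  \<open>exp (b * r)\<close> comes from 1 - exp(- b d) >= b d exp(- b r) for steps
  \<open>d \<le> r\<close>.\<close>

lemma exp_mono_const_minus:
  assumes "0 < b" "\<And>s s'. p \<le> s \<Longrightarrow> s \<le> s' \<Longrightarrow> s' \<le> q \<Longrightarrow> y s' - y s \<le> \<Lambda> * (s' - s)"
    and "\<And>s. p \<le> s \<Longrightarrow> s \<le> q \<Longrightarrow> y s \<le> e" "0 \<le> \<Lambda>" "p \<le> q" "q - p \<le> r" "k \<ge> e + \<Lambda> * exp (b * r) / b"
  shows "exp_mono b p q (\<lambda>s. k - y s)"
  unfolding exp_mono_def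
proof (intro conjI allI impI)
  have ke: "\<Lambda> \<le> b * exp (- b * r) * (k - e)"
  proof -
    have "\<Lambda> * exp (b * r) / b \<le> k - e" using assms by linarith
    then have "b * exp (- b * r) * (\<Lambda> * exp (b * r) / b) \<le> b * exp (- b * r) * (k - e)"
      using assms by (intro mult_left_mono) auto
    then show ?thesis using assms by (simp add: field_simps exp_minus)
  qed
  have ke0: "e \<le> k" using assms by (smt (verit) divide_nonneg_pos exp_gt_zero mult_nonneg_nonneg)
  then show "0 \<le> k - y p" using assms(3)[of p] assms(5) by simp
  fix s s' assume s: "p \<le> s" "s \<le> s'" "s' \<le> q"
  define d where "d = s' - s"
  have d: "0 \<le> d" "d \<le> r" using s assms by (auto simp: d_def)
  have "1 + (b * d) \<le> exp (b * d)" by (rule exp_ge_add_one_self)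
  then have "exp (- b * d) * (1 + b * d) \<le> exp (- b * d) * exp (b * d)" by (intro mult_left_mono) auto
  then have 1: "b * d * exp (- b * d) \<le> 1 - exp (- b * d)" by (simp add: exp_minus field_simps)
  have "\<Lambda> * d \<le> b * exp (- b * r) * (k - e) * d" using ke d by (intro mult_right_mono) auto
  also have "\<dots> = b * d * (k - e) * exp (- b * r)" by (simp add: algebra_simps)
  also have "\<dots> \<le> b * d * (k - e) * exp (- b * d)"
    using d assms ke0 by (intro mult_left_mono) auto
  also have "\<dots> \<le> (1 - exp (- b * d)) * (k - e)"
    using mult_right_mono[OF 1, of "k - e"] ke0 by (simp add: algebra_simps)
  also have "\<dots> \<le> (1 - exp (- b * d)) * (k - y s)"
    using assms(3)[of s] s d assms by (intro mult_left_mono) auto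
  finally have "y s' - y s \<le> (1 - exp (- b * d)) * (k - y s)"
    using assms(2)[OF s] by (simp add: d_def)
  then have "exp (- b * d) * (k - y s) \<le> k - y s'" by (simp add: algebra_simps)
  then have "exp (b * s') * (exp (- b * d) * (k - y s)) \<le> exp (b * s') * (k - y s')"
    by (intro mult_left_mono) auto
  moreover have "exp (b * s') * exp (- b * d) = exp (b * s)"
    by (simp add: d_def exp_add[symmetric] algebra_simps)
  ultimately show "exp (b * s) * (k - y s) \<le> exp (b * s') * (k - y s')"
    by (metis mult.assoc)
qed

lemma exp_mono_limit:
  assumes "\<forall>\<^sub>F n in sequentially. exp_mono b p q (f n)" "\<And>s. p \<le> s \<Longrightarrow> s \<le> q \<Longrightarrow> (\<lambda>n. f n s) \<longlonglongrightarrow> y s" "p \<le> q"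
  shows "exp_mono b p q y"
  unfolding exp_mono_def
proof (intro conjI allI impI)
  show "0 \<le> y p"
    by (rule tendsto_lowerbound[OF assms(2)]) (use assms in \<open>auto simp: exp_mono_def elim!: eventually_mono\<close>)
  fix s s' assume s: "p \<le> s" "s \<le> s'" "s' \<le> q"
  show "exp (b * s) * y s \<le> exp (b * s') * y s'"
    by (rule tendsto_le[OF _ tendsto_mult[OF tendsto_const assms(2)] tendsto_mult[OF tendsto_const assms(2)]])
      (use assms s in \<open>auto simp: exp_mono_def elim!: eventually_mono\<close>)
qed

lemma exp_mono_add:
  assumes "exp_mono b p q y" "exp_mono b p q z"
  shows "exp_mono b p q (\<lambda>s. y s + z s)"
  using assms unfolding exp_mono_def by (fastforce simp: distrib_left intro: add_mono)

lemma exp_mono_const: "0 \<le> b \<Longrightarrow> 0 \<le> k \<Longrightarrow> exp_mono b p q (\<lambda>s. k)"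
  by (auto simp: exp_mono_def intro!: mult_right_mono mult_left_mono)

section \<open>Solutions\<close>

lemma translate_apply [simp]: "translate \<omega> s (t, v) = \<omega> (s + t, v)"
  by (simp add: translate_def)

lemma translate_translate [simp]: "translate (translate \<omega> s) t = translate \<omega> (s + t)"
  by (auto simp: translate_def add.assoc)

lemma translate_0 [simp]: "translate \<omega> 0 = \<omega>"
  by (auto simp: translate_def)

text \<open>Supplies the rate of an exponential weight under which both a delay \<alpha> i, damped
  by exp(- \<Lambda> \<alpha> i), and an integration, damped by 1/\<Lambda>, become small. The sum
  of the \<open>1 / (\<epsilon> * \<alpha> i)\<close> stands in for their maximum.\<close>

lemma exp_decay_finite:
  fixes \<alpha> :: "'m::finite \<Rightarrow> real"
  assumes "\<And>i. 0 < \<alpha> i" "0 < \<epsilon>"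
  shows "\<exists>\<Lambda>>0. (\<forall>i. exp (- \<Lambda> * \<alpha> i) \<le> \<epsilon>) \<and> K / \<Lambda> \<le> \<epsilon>"
proof -
  define \<Lambda> where "\<Lambda> = (\<Sum>i\<in>UNIV. 1 / (\<epsilon> * \<alpha> i)) + \<bar>K\<bar> / \<epsilon> + 1"
  have sum0: "0 \<le> (\<Sum>i\<in>UNIV. 1 / (\<epsilon> * \<alpha> i))"
    using assms by (intro sum_nonneg) (simp add: less_imp_le)
  have "0 \<le> \<bar>K\<bar> / \<epsilon>" using assms by simp
  then have pos: "0 < \<Lambda>" using sum0 unfolding \<Lambda>_def by linarith
  have "exp (- \<Lambda> * \<alpha> i) \<le> \<epsilon>" for i
  proof -
    have "1 / (\<epsilon> * \<alpha> i) \<le> (\<Sum>i\<in>UNIV. 1 / (\<epsilon> * \<alpha> i))"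
      using assms by (intro member_le_sum) (auto simp: less_imp_le)
    then have "1 / (\<epsilon> * \<alpha> i) \<le> \<Lambda>" using \<open>0 \<le> \<bar>K\<bar> / \<epsilon>\<close> unfolding \<Lambda>_def by linarith
    then have "1 / \<epsilon> \<le> \<Lambda> * \<alpha> i" using assms by (simp add: field_simps)
    also have "\<dots> \<le> exp (\<Lambda> * \<alpha> i)" using exp_ge_add_one_self[of "\<Lambda> * \<alpha> i"] by linarith
    finally show ?thesis using assms by (simp add: exp_minus field_simps)
  qed
  moreover have "K / \<epsilon> \<le> \<bar>K\<bar> / \<epsilon>" using assms by (intro divide_right_mono) auto
  then have "K / \<epsilon> \<le> \<Lambda>" using sum0 unfolding \<Lambda>_def by linarith
  then have "K / \<Lambda> \<le> \<epsilon>" using pos assms by (simp add: field_simps)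
  ultimately show ?thesis using pos by blast
qed

lemma norm_vec_le_card:
  fixes x :: "real ^ 'm::finite"
  assumes "\<And>i. \<bar>x $ i\<bar> \<le> e"
  shows "norm x \<le> real CARD('m) * e"
proof -
  have "norm x \<le> (\<Sum>i\<in>UNIV. \<bar>x $ i\<bar>)" by (rule norm_le_l1_cart)
  also have "\<dots> \<le> (\<Sum>i\<in>(UNIV :: 'm set). e)" by (intro sum_mono assms)
  finally show ?thesis by simp
qed

lemma has_real_derivative_integral_from:
  fixes f :: "real \<Rightarrow> real"
  assumes "continuous_on UNIV f" and t: "a \<le> t"
  shows "((\<lambda>u. integral {a..u} f) has_real_derivative f t) (at t within {a..})"
proof -
  have "((\<lambda>u. integral {a..u} f) has_real_derivative f t) (at t within {a..t + 1})"
    unfolding has_real_derivative_iff_has_vector_derivative using t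
    by (intro integral_has_vector_derivative continuous_on_subset[OF assms(1)]) auto
  moreover have "at t within {a..t + 1} = at t within {a..}"
    using t by (intro at_within_nhd[of t "{..<t + 1}"]) auto
  ultimately show ?thesis by simp
qed

lemma continuous_on_integral_from:
  fixes f :: "real \<Rightarrow> real"
  assumes "continuous_on UNIV f"
  shows "continuous_on {a..} (\<lambda>t. integral {a..t} f)"
  by (rule DERIV_continuous_on) (use has_real_derivative_integral_from[OF assms] in auto)

text \<open>The dynamical arguments see the hull only through these properties. \<open>lp\<close>
  and \<open>lm\<close> bound increments rather than derivatives, so that the bounds pass to locally
  uniform limits; \<open>r\<close> is a common bound for all delays.\<close>

locale compartmental =
  fixes \<gamma> \<alpha> \<beta> lm :: "'m::finite \<Rightarrow> real" and \<rho> lp :: "'m \<Rightarrow> 'm \<Rightarrow> real" and r :: real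
    and H :: "(real \<times> real \<Rightarrow> real ^ 'm ^ 'm) set"
  assumes gam: "0 \<le> \<gamma> i" "\<gamma> i < 1"
    and alp: "0 < \<alpha> i" "\<alpha> i \<le> r"
    and rho: "0 \<le> \<rho> i j" "\<rho> i j \<le> r"
    and bet: "0 < \<beta> i"
    and lp: "0 \<le> lp i j"
    and lm: "0 \<le> lm i" "lm i \<le> lp i i"
    and rate: "rate_cond (\<beta> i) (\<gamma> i) (\<alpha> i) (\<rho> i i) (\<Sum>j\<in>UNIV. lp j i) (lm i)"
    and H_cont: "\<omega> \<in> H \<Longrightarrow> continuous_on UNIV \<omega>"
    and H_zero: "\<omega> \<in> H \<Longrightarrow> \<omega> (t, 0) $ i $ j = 0"
    and H_mono: "\<omega> \<in> H \<Longrightarrow> v \<le> w \<Longrightarrow> \<omega> (t, v) $ i $ j \<le> \<omega> (t, w) $ i $ j"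
    and H_upper: "\<omega> \<in> H \<Longrightarrow> v \<le> w \<Longrightarrow> \<omega> (t, w) $ i $ j - \<omega> (t, v) $ i $ j \<le> lp i j * (w - v)"
    and H_lower: "\<omega> \<in> H \<Longrightarrow> v \<le> w \<Longrightarrow> lm i * (w - v) \<le> \<omega> (t, w) $ i $ i - \<omega> (t, v) $ i $ i"
    and H_translate: "\<omega> \<in> H \<Longrightarrow> translate \<omega> t \<in> H"
    and H_compact: "(\<And>n. f n \<in> H) \<Longrightarrow> \<exists>\<omega>\<in>H. \<exists>\<sigma>::nat \<Rightarrow> nat. strict_mono \<sigma> \<and> ucc_lim (\<lambda>n. f (\<sigma> n)) \<omega>"
    and H_minimal: "S \<subseteq> H \<Longrightarrow> S \<noteq> {} \<Longrightarrow> (\<And>\<omega> t. \<omega> \<in> S \<Longrightarrow> translate \<omega> t \<in> S) \<Longrightarrow>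
      (\<And>f \<omega>. (\<And>n. f n \<in> S) \<Longrightarrow> ucc_lim f \<omega> \<Longrightarrow> \<omega> \<in> S) \<Longrightarrow> S = H"
begin

lemma r_pos: "0 < r"
  using alp less_le_trans by blast

lemma H_closed:
  assumes "\<And>n. f n \<in> H" "ucc_lim f \<omega>"
  shows "\<omega> \<in> H"
proof -
  obtain \<omega>' \<sigma> where *: "\<omega>' \<in> H" "strict_mono \<sigma>" "ucc_lim (\<lambda>n. f (\<sigma> n)) \<omega>'"
    using H_compact[of f] assms(1) by blast
  then show ?thesis using ucc_lim_unique[OF ucc_lim_subseq[OF assms(2)]] by blast
qed

lemma H_lipschitz:
  assumes "\<omega> \<in> H"
  shows "\<bar>\<omega> (t, v) $ i $ j - \<omega> (t, w) $ i $ j\<bar> \<le> lp i j * \<bar>v - w\<bar>"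
proof (cases "v \<le> w")
  case True
  then show ?thesis using H_upper[OF assms True, of t i j] H_mono[OF assms True, of t i j] by simp
next
  case False
  then have "w \<le> v" by simp
  then show ?thesis using H_upper[OF assms \<open>w \<le> v\<close>, of t i j] H_mono[OF assms \<open>w \<le> v\<close>, of t i j] by simp
qed

definition D_at :: "(real \<Rightarrow> real ^ 'm) \<Rightarrow> real \<Rightarrow> 'm \<Rightarrow> real" where
  "D_at z t i = z t $ i - \<gamma> i * z (t - \<alpha> i) $ i"

definition rhs :: "(real \<times> real \<Rightarrow> real ^ 'm ^ 'm) \<Rightarrow> (real \<Rightarrow> real ^ 'm) \<Rightarrow> real \<Rightarrow> 'm \<Rightarrow> real" where
  "rhs \<omega> z t i = - (\<Sum>j\<in>UNIV. \<omega> (t, z t $ i) $ j $ i)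
     + (\<Sum>j\<in>UNIV. \<omega> (t - \<rho> i j, z (t - \<rho> i j) $ j) $ i $ j)"

definition solves :: "(real \<times> real \<Rightarrow> real ^ 'm ^ 'm) \<Rightarrow> real \<Rightarrow> (real \<Rightarrow> real ^ 'm) \<Rightarrow> bool" where
  "solves \<omega> t0 z \<longleftrightarrow> continuous_on UNIV z \<and>
     (\<forall>t\<ge>t0. \<forall>i. ((\<lambda>t. D_at z t i) has_real_derivative rhs \<omega> z t i) (at t within {t0..}))"

definition entire :: "(real \<times> real \<Rightarrow> real ^ 'm ^ 'm) \<Rightarrow> (real \<Rightarrow> real ^ 'm) \<Rightarrow> bool" where
  "entire \<omega> z \<longleftrightarrow> (\<forall>t0. solves \<omega> t0 z)"

text \<open>The factor 2 makes room, for each component, for a column sum of \<open>lp\<close>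
  (outflow) plus a row sum (inflow).\<close>

definition rhs_lip :: real where
  "rhs_lip = 2 * (\<Sum>i\<in>UNIV. \<Sum>j\<in>UNIV. lp i j)"

lemma rhs_lip_nonneg: "0 \<le> rhs_lip"
  unfolding rhs_lip_def by (intro mult_nonneg_nonneg sum_nonneg lp) simp

lemma column_sum_le_LL: "(\<Sum>j\<in>UNIV. lp j i) + (\<Sum>j\<in>UNIV. lp i j) \<le> rhs_lip"
proof -
  have "(\<Sum>j\<in>UNIV. lp i j) \<le> (\<Sum>i\<in>UNIV. \<Sum>j\<in>UNIV. lp i j)"
    by (rule member_le_sum[of i UNIV "\<lambda>i. \<Sum>j\<in>UNIV. lp i j"]) (auto intro!: sum_nonneg lp)
  moreover have "(\<Sum>j\<in>UNIV. lp j i) \<le> (\<Sum>i\<in>UNIV. \<Sum>j\<in>UNIV. lp j i)"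
    by (rule member_le_sum[of i UNIV "\<lambda>i. \<Sum>j\<in>UNIV. lp j i"]) (auto intro!: sum_nonneg lp)
  moreover have "(\<Sum>i\<in>UNIV. \<Sum>j\<in>UNIV. lp j i) = (\<Sum>i\<in>UNIV. \<Sum>j\<in>UNIV. lp i j)" by (rule sum.swap)
  ultimately show ?thesis by (simp add: rhs_lip_def)
qed

lemma entry_cont:
  assumes "\<omega> \<in> H" "continuous_on UNIV z"
  shows "continuous_on S (\<lambda>t. \<omega> (t + a, z (t + a) $ k) $ i $ j)"
proof -
  have "continuous_on UNIV (\<lambda>t. z (t + a))"
    by (rule continuous_on_compose2[OF assms(2)]) (auto intro!: continuous_intros)
  then have "continuous_on UNIV (\<lambda>t. \<omega> (t + a, z (t + a) $ k))"
    by (intro continuous_on_compose2[OF H_cont[OF assms(1)]]) (auto intro!: continuous_intros)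
  then show ?thesis by (intro continuous_on_component) (auto elim: continuous_on_subset)
qed

lemma rhs_cont:
  assumes "\<omega> \<in> H" "continuous_on UNIV z"
  shows "continuous_on S (\<lambda>t. rhs \<omega> z t i)"
  unfolding rhs_def using entry_cont[OF assms, of S 0] entry_cont[OF assms, of S "- \<rho> i j" for j]
  by (intro continuous_on_add continuous_on_minus continuous_on_sum) auto

lemma rhs_integrable:
  assumes "\<omega> \<in> H" "continuous_on UNIV z"
  shows "(\<lambda>t. rhs \<omega> z t i) integrable_on {a..b}"
  by (intro integrable_continuous_real rhs_cont assms)

lemma rhs_lipschitz:
  assumes "\<omega> \<in> H" "\<And>s j. t - r \<le> s \<Longrightarrow> s \<le> t \<Longrightarrow> \<bar>z s $ j - w s $ j\<bar> \<le> e"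
  shows "\<bar>rhs \<omega> z t i - rhs \<omega> w t i\<bar> \<le> rhs_lip * e"
proof -
  have *: "\<bar>\<omega> (s, z s $ k) $ i $ j - \<omega> (s, w s $ k) $ i $ j\<bar> \<le> lp i j * e"
    if "t - r \<le> s" "s \<le> t" for s i j k
    using H_lipschitz[OF assms(1), of s "z s $ k" i j "w s $ k"] mult_left_mono[OF assms(2)[OF that, of k] lp[of i j]]
    by linarith
  have e: "0 \<le> e" using assms(2)[of t i] r_pos abs_ge_zero[of "z t $ i - w t $ i"] by linarith
  have "\<bar>\<Sum>j\<in>UNIV. \<omega> (t, w t $ i) $ j $ i - \<omega> (t, z t $ i) $ j $ i\<bar> \<le> (\<Sum>j\<in>UNIV. lp j i * e)"
    using *[of t i _ i] r_pos by (intro order_trans[OF sum_abs sum_mono]) (simp add: abs_minus_commute)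
  moreover have "\<bar>\<Sum>j\<in>UNIV. \<omega> (t - \<rho> i j, z (t - \<rho> i j) $ j) $ i $ j - \<omega> (t - \<rho> i j, w (t - \<rho> i j) $ j) $ i $ j\<bar>
      \<le> (\<Sum>j\<in>UNIV. lp i j * e)"
  proof (rule order_trans[OF sum_abs sum_mono])
    show "\<bar>\<omega> (t - \<rho> i j, z (t - \<rho> i j) $ j) $ i $ j - \<omega> (t - \<rho> i j, w (t - \<rho> i j) $ j) $ i $ j\<bar>
        \<le> lp i j * e" for j
      using *[of "t - \<rho> i j" j i j] rho[of i j] by simp
  qed
  moreover have "rhs \<omega> z t i - rhs \<omega> w t i = (\<Sum>j\<in>UNIV. \<omega> (t, w t $ i) $ j $ i - \<omega> (t, z t $ i) $ j $ i)
      + (\<Sum>j\<in>UNIV. \<omega> (t - \<rho> i j, z (t - \<rho> i j) $ j) $ i $ j - \<omega> (t - \<rho> i j, w (t - \<rho> i j) $ j) $ i $ j)"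
    by (simp add: rhs_def sum_subtractf)
  ultimately have "\<bar>rhs \<omega> z t i - rhs \<omega> w t i\<bar> \<le> (\<Sum>j\<in>UNIV. lp j i * e) + (\<Sum>j\<in>UNIV. lp i j * e)"
    by linarith
  also have "\<dots> = ((\<Sum>j\<in>UNIV. lp j i) + (\<Sum>j\<in>UNIV. lp i j)) * e"
    by (simp only: sum_distrib_right distrib_right)
  also have "\<dots> \<le> rhs_lip * e" by (rule mult_right_mono[OF column_sum_le_LL e])
  finally show ?thesis .
qed

lemma rhs_zero: "\<omega> \<in> H \<Longrightarrow> rhs \<omega> (\<lambda>_. 0) t i = 0"
  by (simp add: rhs_def H_zero)

lemma rhs_bound:
  assumes "\<omega> \<in> H" "\<And>s j. t - r \<le> s \<Longrightarrow> s \<le> t \<Longrightarrow> \<bar>z s $ j\<bar> \<le> e"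
  shows "\<bar>rhs \<omega> z t i\<bar> \<le> rhs_lip * e"
  using rhs_lipschitz[OF assms(1), of t z "\<lambda>_. 0" e i] assms(2) by (simp add: rhs_zero[OF assms(1)])

lemma D_at_cont: "continuous_on UNIV z \<Longrightarrow> continuous_on S (\<lambda>t. D_at z t i)"
proof -
  assume "continuous_on UNIV z"
  then have "continuous_on UNIV (\<lambda>t. z (t - \<alpha> i))"
    by (rule continuous_on_compose2) (auto intro!: continuous_intros)
  then show ?thesis using \<open>continuous_on UNIV z\<close> unfolding D_at_def
    by (intro continuous_intros continuous_on_component) (auto elim: continuous_on_subset)
qed

lemma solves_cont: "solves \<omega> t0 z \<Longrightarrow> continuous_on S z"
  by (auto simp: solves_def elim: continuous_on_subset)

lemma solves_zero: "\<omega> \<in> H \<Longrightarrow> solves \<omega> t0 (\<lambda>_. 0)"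
  by (simp add: solves_def rhs_zero D_at_def)

lemma solves_integral:
  assumes "solves \<omega> t0 z" "t0 \<le> s" "s \<le> t"
  shows "D_at z t i - D_at z s i = integral {s..t} (\<lambda>\<tau>. rhs \<omega> z \<tau> i)"
proof -
  have "((\<lambda>\<tau>. rhs \<omega> z \<tau> i) has_integral D_at z t i - D_at z s i) {s..t}"
  proof (rule fundamental_theorem_of_calculus[OF assms(3)])
    fix x assume "x \<in> {s..t}"
    then have "((\<lambda>t. D_at z t i) has_real_derivative rhs \<omega> z x i) (at x within {t0..})"
      using assms by (auto simp: solves_def)
    then show "((\<lambda>t. D_at z t i) has_vector_derivative rhs \<omega> z x i) (at x within {s..t})"
      unfolding has_real_derivative_iff_has_vector_derivative
      by (rule has_vector_derivative_within_subset) (use assms in auto)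
  qed
  then show ?thesis by (simp add: integral_unique)
qed

text \<open>Fixed points and limits are recognised through the integral equation, in which no
  derivative has to converge.\<close>

lemma solvesI_integral:
  assumes "\<omega> \<in> H" "continuous_on UNIV z"
    and *: "\<And>t i. t0 \<le> t \<Longrightarrow> D_at z t i = D_at z t0 i + integral {t0..t} (\<lambda>\<tau>. rhs \<omega> z \<tau> i)"
  shows "solves \<omega> t0 z"
  unfolding solves_def
proof (intro conjI allI impI assms)
  fix t i assume t: "t0 \<le> t"
  have "((\<lambda>u. D_init + integral {t0..u} (\<lambda>\<tau>. rhs \<omega> z \<tau> i)) has_real_derivative rhs \<omega> z t i) (at t within {t0..})" for D_init
    using has_real_derivative_integral_from[OF rhs_cont[OF assms(1,2)] t] by (auto intro!: derivative_eq_intros)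
  then show "((\<lambda>t. D_at z t i) has_real_derivative rhs \<omega> z t i) (at t within {t0..})"
    by (rule has_field_derivative_transform_within[where d = 1]) (use t *[symmetric] in auto)
qed

lemma solves_later: "solves \<omega> t0 z \<Longrightarrow> t0 \<le> t1 \<Longrightarrow> solves \<omega> t1 z"
  unfolding solves_def
proof (intro conjI allI impI)
  fix t i
  assume z: "continuous_on UNIV z \<and>
      (\<forall>t\<ge>t0. \<forall>i. ((\<lambda>t. D_at z t i) has_real_derivative rhs \<omega> z t i) (at t within {t0..}))"
    and t: "t0 \<le> t1" "t1 \<le> t"
  then have "((\<lambda>t. D_at z t i) has_real_derivative rhs \<omega> z t i) (at t within {t0..})" by simp
  then show "((\<lambda>t. D_at z t i) has_real_derivative rhs \<omega> z t i) (at t within {t1..})"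
    by (rule DERIV_subset) (use t in auto)
qed simp

lemma solves_shift:
  assumes "solves \<omega> t0 z"
  shows "solves (translate \<omega> s) (t0 - s) (\<lambda>t. z (s + t))"
  unfolding solves_def
proof (intro conjI allI impI)
  show "continuous_on UNIV (\<lambda>t. z (s + t))"
    by (rule continuous_on_compose2[OF solves_cont[OF assms, of UNIV]]) (auto intro!: continuous_intros)
  fix t i assume t: "t0 - s \<le> t"
  have "((\<lambda>t. D_at z t i) has_real_derivative rhs \<omega> z (s + t) i) (at (s + t) within (\<lambda>u. s + u) ` {t0 - s..})"
    using assms t by (simp add: solves_def)
  then have "((\<lambda>u. D_at z (s + u) i) has_real_derivative rhs \<omega> z (s + t) i * 1) (at t within {t0 - s..})"
    using DERIV_image_chain[of "\<lambda>t. D_at z t i" "rhs \<omega> z (s + t) i" "\<lambda>u. s + u" t "{t0 - s..}" 1]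
      DERIV_add[OF DERIV_const[of s] DERIV_ident[where F = "at t within {t0 - s..}"]]
    by (simp add: o_def)
  moreover have "D_at z (s + u) i = D_at (\<lambda>t. z (s + t)) u i" for u
    by (simp add: D_at_def algebra_simps)
  moreover have "rhs \<omega> z (s + t) i = rhs (translate \<omega> s) (\<lambda>t. z (s + t)) t i"
    by (simp add: rhs_def algebra_simps)
  ultimately show "((\<lambda>t. D_at (\<lambda>t. z (s + t)) t i) has_real_derivative rhs (translate \<omega> s) (\<lambda>t. z (s + t)) t i)
     (at t within {t0 - s..})" by simp
qed

lemma entire_shift: "entire \<omega> z \<Longrightarrow> entire (translate \<omega> s) (\<lambda>t. z (s + t))"
  unfolding entire_def using solves_shift[of \<omega> "t0 + s" z s for t0] by simp

text \<open>Exponential weights make both the Picard operator and the difference of two solutions contract.\<close>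

lemma rhs_integral_weighted:
  assumes "\<omega> \<in> H" "continuous_on UNIV z" "continuous_on UNIV w" "0 < \<Lambda>" "0 \<le> K" "t0 \<le> t"
    and "\<And>s j. t0 - r \<le> s \<Longrightarrow> s \<le> t \<Longrightarrow> \<bar>z s $ j - w s $ j\<bar> \<le> K * exp (\<Lambda> * (max s t0 - t0))"
  shows "\<bar>integral {t0..t} (\<lambda>\<tau>. rhs \<omega> z \<tau> i) - integral {t0..t} (\<lambda>\<tau>. rhs \<omega> w \<tau> i)\<bar>
    \<le> K * (rhs_lip / \<Lambda>) * exp (\<Lambda> * (t - t0))"
proof -
  have "((\<lambda>\<tau>. rhs_lip * (K * exp (\<Lambda> * (\<tau> - t0)))) has_integral
      rhs_lip * (K * exp (\<Lambda> * (t - t0))) / \<Lambda> - rhs_lip * (K * exp (\<Lambda> * (t0 - t0))) / \<Lambda>) {t0..t}"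
    using assms
    by (intro fundamental_theorem_of_calculus)
      (auto intro!: derivative_eq_intros simp: has_real_derivative_iff_has_vector_derivative[symmetric])
  note I = this
  have "norm (integral {t0..t} (\<lambda>\<tau>. rhs \<omega> z \<tau> i - rhs \<omega> w \<tau> i))
      \<le> integral {t0..t} (\<lambda>\<tau>. rhs_lip * (K * exp (\<Lambda> * (\<tau> - t0))))"
  proof (rule integral_norm_bound_integral)
    show "(\<lambda>\<tau>. rhs \<omega> z \<tau> i - rhs \<omega> w \<tau> i) integrable_on {t0..t}"
      by (intro integrable_diff rhs_integrable assms)
    show "(\<lambda>\<tau>. rhs_lip * (K * exp (\<Lambda> * (\<tau> - t0)))) integrable_on {t0..t}" using I by blast
    fix \<tau> assume \<tau>: "\<tau> \<in> {t0..t}"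
    have "\<bar>rhs \<omega> z \<tau> i - rhs \<omega> w \<tau> i\<bar> \<le> rhs_lip * (K * exp (\<Lambda> * (\<tau> - t0)))"
    proof (rule rhs_lipschitz[OF assms(1)])
      fix s j assume s: "\<tau> - r \<le> s" "s \<le> \<tau>"
      have "\<bar>z s $ j - w s $ j\<bar> \<le> K * exp (\<Lambda> * (max s t0 - t0))" using assms(7)[of s j] s \<tau> by auto
      also have "\<dots> \<le> K * exp (\<Lambda> * (\<tau> - t0))" using assms s \<tau> by (intro mult_left_mono) auto
      finally show "\<bar>z s $ j - w s $ j\<bar> \<le> K * exp (\<Lambda> * (\<tau> - t0))" .
    qed
    then show "norm (rhs \<omega> z \<tau> i - rhs \<omega> w \<tau> i) \<le> rhs_lip * (K * exp (\<Lambda> * (\<tau> - t0)))" by simp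
  qed
  also have "\<dots> = rhs_lip * (K * exp (\<Lambda> * (t - t0))) / \<Lambda> - rhs_lip * K / \<Lambda>"
    using integral_unique[OF I] by simp
  also have "\<dots> \<le> K * (rhs_lip / \<Lambda>) * exp (\<Lambda> * (t - t0))"
    using assms rhs_lip_nonneg by (simp add: divide_nonneg_pos algebra_simps)
  finally show ?thesis
    by (simp add: integral_diff rhs_integrable assms)
qed
end

section \<open>Global existence, continuous dependence and uniqueness\<close>

context compartmental
begin

text \<open>Banach's fixed point theorem for bounded continuous functions. The unknown \<zeta> is
  the increment of the solution divided by the weight \<open>E\<close>; for a large rate \<Lambda>
  the neutral term and the integral contract on the whole half-line at once, so the solution is
  global without stepping from delay to delay.\<close>

lemma solves_exists:
  assumes \<omega>: "\<omega> \<in> H" and x: "continuous_on UNIV x"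
  shows "\<exists>z. solves \<omega> t0 z \<and> (\<forall>t\<le>t0. z t = x t)"
proof -
  define m where "m = real CARD('m)"
  have m: "1 \<le> m" by (simp add: m_def)
  \<comment> \<open>The neutral term and the integral contribute \<epsilon> twice each, and the
    passage from components to the norm costs a factor \<open>m\<close>; the product
    \<open>4 * \<epsilon> * m\<close> is the contraction constant 1/2.\<close>
  define \<epsilon> where "\<epsilon> = 1 / (8 * m)"
  have \<epsilon>: "0 < \<epsilon>" using m by (simp add: \<epsilon>_def)
  obtain \<Lambda> where \<Lambda>: "0 < \<Lambda>" "\<And>i. exp (- \<Lambda> * \<alpha> i) \<le> \<epsilon>" "rhs_lip / \<Lambda> \<le> \<epsilon>"
    using exp_decay_finite[of \<alpha> \<epsilon> rhs_lip] alp(1) \<epsilon> by auto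
  have "compact (x ` {t0 - r..t0})"
    by (intro compact_continuous_image continuous_on_subset[OF x]) auto
  then obtain B where "\<forall>y\<in>x ` {t0 - r..t0}. norm y \<le> B"
    using compact_imp_bounded bounded_iff by metis
  then have B: "norm (x s) \<le> B" if "s \<in> {t0 - r..t0}" for s using that by blast
  have B0: "0 \<le> B" using B[of t0] r_pos order_trans[OF norm_ge_zero, of "x t0" B] by simp
  define E where "E s = exp (\<Lambda> * (max s t0 - t0))" for s
  \<comment> \<open>Subtracting \<open>\<zeta> t0\<close> glues history and unknown continuously for
    every \<zeta>, so the operator acts on the full space of bounded continuous functions. At the
    fixed point \<open>\<zeta> t0 = 0\<close>.\<close>
  define Z where "Z \<zeta> s = x (min s t0) + E s *\<^sub>R (\<zeta> (max s t0) - \<zeta> t0)" for \<zeta> :: "real \<Rightarrow> real ^ 'm" and s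
  define P where "P \<zeta> t i = \<gamma> i * Z \<zeta> (t - \<alpha> i) $ i + D_at x t0 i + integral {t0..t} (\<lambda>\<tau>. rhs \<omega> (Z \<zeta>) \<tau> i) - x t0 $ i"
    for \<zeta> t i
  define T where "T \<zeta> t = (\<chi> i. P \<zeta> (max t t0) i / E t)" for \<zeta> t
  have Econt: "continuous_on S E" for S unfolding E_def by (intro continuous_intros)
  have Epos: "0 < E s" for s by (simp add: E_def)
  have E1: "1 \<le> E s" for s using \<Lambda> by (simp add: E_def)
  have Emono: "E s \<le> E t" if "s \<le> t" for s t using \<Lambda> that by (auto simp: E_def)
  have Zcont: "continuous_on S (Z \<zeta>)" if "continuous_on UNIV \<zeta>" for S \<zeta>
    unfolding Z_def
    by (intro continuous_intros Econt continuous_on_compose2[OF x] continuous_on_compose2[OF that]) auto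
  have Tcont: "continuous_on UNIV (T \<zeta>)" if \<zeta>: "continuous_on UNIV \<zeta>" for \<zeta>
  proof -
    have "continuous_on UNIV (\<lambda>t. integral {t0..max t t0} (\<lambda>\<tau>. rhs \<omega> (Z \<zeta>) \<tau> i))" for i
      by (rule continuous_on_compose2[OF continuous_on_integral_from])
        (auto intro!: rhs_cont \<omega> Zcont \<zeta> continuous_intros)
    moreover have "continuous_on UNIV (\<lambda>t. Z \<zeta> (max t t0 - \<alpha> i))" for i
      by (rule continuous_on_compose2[OF Zcont[OF \<zeta>, of UNIV]]) (auto intro!: continuous_intros)
    ultimately show ?thesis
      unfolding T_def P_def using Epos by (intro continuous_intros Econt continuous_on_component) (auto simp: less_imp_neq[symmetric])
  qed
  have Zdiff: "\<bar>Z \<zeta> s $ j - Z \<zeta>' s $ j\<bar> \<le> 2 * d * E s"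
    if d: "\<And>t. dist (\<zeta> t) (\<zeta>' t) \<le> d" for \<zeta> \<zeta>' d s j
  proof -
    have "norm ((\<zeta> (max s t0) - \<zeta>' (max s t0)) - (\<zeta> t0 - \<zeta>' t0)) \<le> d + d"
      using norm_triangle_ineq4[of "\<zeta> (max s t0) - \<zeta>' (max s t0)" "\<zeta> t0 - \<zeta>' t0"] d[of "max s t0"] d[of t0]
      unfolding dist_norm by linarith
    then have "\<bar>((\<zeta> (max s t0) - \<zeta> t0) - (\<zeta>' (max s t0) - \<zeta>' t0)) $ j\<bar> \<le> 2 * d"
      using component_le_norm_cart[of "(\<zeta> (max s t0) - \<zeta> t0) - (\<zeta>' (max s t0) - \<zeta>' t0)" j]
      by (simp add: algebra_simps)
    then have "E s * \<bar>((\<zeta> (max s t0) - \<zeta> t0) - (\<zeta>' (max s t0) - \<zeta>' t0)) $ j\<bar> \<le> E s * (2 * d)"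
      using Epos by (intro mult_left_mono) (auto simp: less_imp_le)
    moreover have eq: "Z \<zeta> s $ j - Z \<zeta>' s $ j = E s * ((\<zeta> (max s t0) - \<zeta> t0) - (\<zeta>' (max s t0) - \<zeta>' t0)) $ j"
      by (simp add: Z_def algebra_simps)
    ultimately have "\<bar>Z \<zeta> s $ j - Z \<zeta>' s $ j\<bar> \<le> E s * (2 * d)"
      unfolding eq abs_mult abs_of_pos[OF Epos] by blast
    then show ?thesis by (simp add: mult.commute)
  qed
  have Tdiff: "dist (T \<zeta> t) (T \<zeta>' t) \<le> 1 / 2 * d"
    if c: "continuous_on UNIV \<zeta>" "continuous_on UNIV \<zeta>'" and d: "\<And>t. dist (\<zeta> t) (\<zeta>' t) \<le> d" for \<zeta> \<zeta>' d t
  proof -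
    have d0: "0 \<le> d" using d[of 0] zero_le_dist order_trans by blast
    have "\<bar>(T \<zeta> t - T \<zeta>' t) $ i\<bar> \<le> d / (2 * m)" for i
    proof -
      let ?t = "max t t0"
      have "\<bar>Z \<zeta> (?t - \<alpha> i) $ i - Z \<zeta>' (?t - \<alpha> i) $ i\<bar> \<le> 2 * d * (\<epsilon> * E t)"
      proof (cases "?t - \<alpha> i \<le> t0")
        case True
        then have "Z \<zeta> (?t - \<alpha> i) = Z \<zeta>' (?t - \<alpha> i)" by (simp add: Z_def max_def)
        then show ?thesis using d0 \<epsilon> Epos[of t] by (simp add: less_imp_le)
      next
        case False
        then have "max (?t - \<alpha> i) t0 = ?t - \<alpha> i" by simp
        then have "E (?t - \<alpha> i) = exp (- \<Lambda> * \<alpha> i) * E t"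
          by (simp add: E_def exp_add[symmetric] algebra_simps)
        also have "\<dots> \<le> \<epsilon> * E t" using \<Lambda>(2) Epos[of t] by (intro mult_right_mono) (auto simp: less_imp_le)
        finally have "2 * d * E (?t - \<alpha> i) \<le> 2 * d * (\<epsilon> * E t)" using d0 by (intro mult_left_mono) auto
        then show ?thesis using Zdiff[of \<zeta> \<zeta>' d "?t - \<alpha> i" i, OF d] by linarith
      qed
      then have "\<gamma> i * \<bar>Z \<zeta> (?t - \<alpha> i) $ i - Z \<zeta>' (?t - \<alpha> i) $ i\<bar> \<le> 1 * (2 * d * (\<epsilon> * E t))"
        using gam[of i] by (intro mult_mono) auto
      then have 1: "\<bar>\<gamma> i * Z \<zeta> (?t - \<alpha> i) $ i - \<gamma> i * Z \<zeta>' (?t - \<alpha> i) $ i\<bar> \<le> 2 * d * \<epsilon> * E t"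
        using gam[of i] by (simp add: right_diff_distrib[symmetric] abs_mult)
      have "\<bar>integral {t0..?t} (\<lambda>\<tau>. rhs \<omega> (Z \<zeta>) \<tau> i) - integral {t0..?t} (\<lambda>\<tau>. rhs \<omega> (Z \<zeta>') \<tau> i)\<bar>
        \<le> (2 * d) * (rhs_lip / \<Lambda>) * exp (\<Lambda> * (?t - t0))"
        by (rule rhs_integral_weighted[OF \<omega> Zcont[OF c(1)] Zcont[OF c(2)] \<Lambda>(1)])
          (use d0 Zdiff[of \<zeta> \<zeta>' d, OF d] in \<open>auto simp: E_def\<close>)
      also have "\<dots> = (2 * d * E t) * (rhs_lip / \<Lambda>)" by (simp add: E_def)
      also have "\<dots> \<le> (2 * d * E t) * \<epsilon>"
        using d0 Epos[of t] \<Lambda>(3) by (intro mult_left_mono) (auto simp: less_imp_le)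
      finally have 2: "\<bar>integral {t0..?t} (\<lambda>\<tau>. rhs \<omega> (Z \<zeta>) \<tau> i) - integral {t0..?t} (\<lambda>\<tau>. rhs \<omega> (Z \<zeta>') \<tau> i)\<bar>
        \<le> 2 * d * \<epsilon> * E t" by (simp add: algebra_simps)
      have "\<bar>P \<zeta> ?t i - P \<zeta>' ?t i\<bar> \<le> 4 * d * \<epsilon> * E t"
        using 1 2 unfolding P_def by linarith
      then have "\<bar>P \<zeta> ?t i - P \<zeta>' ?t i\<bar> / E t \<le> 4 * d * \<epsilon>"
        using Epos[of t] by (simp add: pos_divide_le_eq)
      also have "4 * d * \<epsilon> = d / (2 * m)" using m by (simp add: \<epsilon>_def)
      finally show ?thesis using Epos[of t] by (simp add: T_def diff_divide_distrib[symmetric])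
    qed
    then have "norm (T \<zeta> t - T \<zeta>' t) \<le> real CARD('m) * (d / (2 * m))" by (rule norm_vec_le_card)
    then show ?thesis using m by (simp add: dist_norm m_def)
  qed
  have T0: "bounded (range (T (\<lambda>_. 0)))"
  proof -
    let ?z = "Z (\<lambda>_. 0)"
    have zB: "\<bar>?z s $ j\<bar> \<le> B" if "t0 - r \<le> s" for s j
      using component_le_norm_cart[of "?z s" j] B[of "min s t0"] that r_pos by (force simp: Z_def)
    have "\<bar>T (\<lambda>_. 0) t $ i\<bar> \<le> 4 * B + B * (rhs_lip / \<Lambda>)" for t i
    proof -
      let ?t = "max t t0"
      have "\<bar>integral {t0..?t} (\<lambda>\<tau>. rhs \<omega> ?z \<tau> i) - integral {t0..?t} (\<lambda>\<tau>. rhs \<omega> (\<lambda>_. 0) \<tau> i)\<bar>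
        \<le> B * (rhs_lip / \<Lambda>) * exp (\<Lambda> * (?t - t0))"
      proof (rule rhs_integral_weighted[OF \<omega> Zcont _ \<Lambda>(1) B0])
        fix s j assume "t0 - r \<le> s"
        then have "\<bar>?z s $ j - (0::real ^ 'm) $ j\<bar> \<le> B * 1" using zB by simp
        also have "\<dots> \<le> B * exp (\<Lambda> * (max s t0 - t0))" using E1[of s] B0 by (intro mult_left_mono) (auto simp: E_def)
        finally show "\<bar>?z s $ j - (0::real ^ 'm) $ j\<bar> \<le> B * exp (\<Lambda> * (max s t0 - t0))" .
      qed auto
      then have I: "\<bar>integral {t0..?t} (\<lambda>\<tau>. rhs \<omega> ?z \<tau> i)\<bar> \<le> B * (rhs_lip / \<Lambda>) * E t"
        by (simp add: rhs_zero[OF \<omega>] E_def)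
      have xB: "\<bar>x s $ i\<bar> \<le> B" if "s \<in> {t0 - r..t0}" for s
        using B[OF that] component_le_norm_cart[of "x s" i] by linarith
      have g: "\<bar>\<gamma> i * u\<bar> \<le> B" if "\<bar>u\<bar> \<le> B" for u
        using mult_mono[of "\<gamma> i" 1 "\<bar>u\<bar>" B] gam[of i] that B0 by (simp add: abs_mult)
      have x0: "\<bar>x t0 $ i\<bar> \<le> B" using r_pos by (intro xB) simp
      have "\<bar>\<gamma> i * ?z (?t - \<alpha> i) $ i\<bar> \<le> B" using alp[of i] by (intro g zB) auto
      moreover have "\<bar>\<gamma> i * x (t0 - \<alpha> i) $ i\<bar> \<le> B" using alp[of i] by (intro g xB) auto
      ultimately have "\<bar>P (\<lambda>_. 0) ?t i\<bar> \<le> 4 * B + B * (rhs_lip / \<Lambda>) * E t"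
        using I x0 unfolding P_def D_at_def by linarith
      also have "\<dots> \<le> (4 * B) * E t + B * (rhs_lip / \<Lambda>) * E t"
        using E1[of t] B0 mult_left_mono[of 1 "E t" "4 * B"] by simp
      finally show ?thesis using Epos[of t] by (simp add: T_def pos_divide_le_eq distrib_right)
    qed
    then have "norm (T (\<lambda>_. 0) t) \<le> real CARD('m) * (4 * B + B * (rhs_lip / \<Lambda>))" for t
      by (rule norm_vec_le_card)
    then show ?thesis unfolding bounded_iff by blast
  qed
  have Tbcont: "T \<zeta> \<in> bcontfun" for \<zeta> :: "real \<Rightarrow>\<^sub>C (real ^ 'm)"
  proof -
    obtain b where b: "\<And>t. norm (T (\<lambda>_. 0) t) \<le> b" using T0 unfolding bounded_iff by blast
    have "bounded (range (apply_bcontfun \<zeta>))" by simp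
    then obtain N where N: "\<And>t. norm (\<zeta> t) \<le> N" unfolding bounded_iff by blast
    have "norm (T \<zeta> t) \<le> b + 1 / 2 * N" for t
      using Tdiff[of \<zeta> "\<lambda>_. 0" N t] b[of t] N norm_triangle_sub[of "T \<zeta> t" "T (\<lambda>_. 0) t"]
      by (simp add: dist_norm)
    then have "bounded (range (T \<zeta>))" unfolding bounded_iff by blast
    then show ?thesis using Tcont[of \<zeta>] by (simp add: bcontfun_def)
  qed
  have "\<exists>!\<zeta>. Bcontfun (T (apply_bcontfun \<zeta>)) = \<zeta>"
  proof (rule banach_fix_type[of "1 / 2"], simp, simp, intro allI)
    fix \<zeta> \<zeta>' :: "real \<Rightarrow>\<^sub>C (real ^ 'm)"
    show "dist (Bcontfun (T \<zeta>)) (Bcontfun (T \<zeta>')) \<le> 1 / 2 * dist \<zeta> \<zeta>'"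
    proof (rule dist_bound)
      fix t
      have "dist (T \<zeta> t) (T \<zeta>' t) \<le> 1 / 2 * dist \<zeta> \<zeta>'"
        by (rule Tdiff) (auto intro: dist_bounded)
      then show "dist (Bcontfun (T \<zeta>) t) (Bcontfun (T \<zeta>') t) \<le> 1 / 2 * dist \<zeta> \<zeta>'"
        by (simp add: Bcontfun_inverse[OF Tbcont])
    qed
  qed
  then obtain \<zeta> :: "real \<Rightarrow>\<^sub>C (real ^ 'm)" where "Bcontfun (T \<zeta>) = \<zeta>" by blast
  then have fp: "\<zeta> t = T \<zeta> t" for t by (metis Bcontfun_inverse[OF Tbcont])
  define z where "z = Z \<zeta>"
  have zc: "continuous_on UNIV z" unfolding z_def by (rule Zcont) simp
  have zx: "z t = x t" if "t \<le> t0" for t using that by (simp add: z_def Z_def max_absorb2 min_absorb1)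
  have P0: "P \<zeta> t0 i = 0" for i
    using zx[of "t0 - \<alpha> i"] alp[of i] by (simp add: P_def D_at_def z_def)
  have \<zeta>0: "\<zeta> t0 = 0" using fp[of t0] P0 by (simp add: T_def vec_eq_iff)
  have "solves \<omega> t0 z"
  proof (rule solvesI_integral[OF \<omega> zc])
    fix t i assume t: "t0 \<le> t"
    have "z t $ i = x t0 $ i + E t * \<zeta> t $ i"
      using t \<zeta>0 by (simp add: z_def Z_def max_absorb1 min_absorb2)
    also have "E t * \<zeta> t $ i = P \<zeta> t i"
      using t Epos[of t] by (subst fp) (simp add: T_def max_absorb1)
    finally have "z t $ i = \<gamma> i * z (t - \<alpha> i) $ i + D_at x t0 i + integral {t0..t} (\<lambda>\<tau>. rhs \<omega> z \<tau> i)"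
      by (simp add: P_def z_def)
    moreover have "D_at x t0 i = D_at z t0 i" using zx[of t0] zx[of "t0 - \<alpha> i"] alp[of i] by (simp add: D_at_def)
    ultimately show "D_at z t i = D_at z t0 i + integral {t0..t} (\<lambda>\<tau>. rhs \<omega> z \<tau> i)"
      by (simp add: D_at_def)
  qed
  then show ?thesis using zx by blast
qed

text \<open>A Gronwall estimate at the point \<open>\<sigma> k\<close> where the weighted difference
  attains its maximum \<open>S\<close>: there the neutral term and the integral each return at most
  a quarter of the unweighted difference, apart from multiples of the initial error
  \<open>e\<close>. Beyond \<open>t0\<close> this gives \<open>S \<le> 6 * e\<close>; the constant 8
  leaves slack.\<close>

lemma solves_dependence:
  obtains \<Lambda> where "\<And>\<omega> t0 z w e t j. \<omega> \<in> H \<Longrightarrow> solves \<omega> t0 z \<Longrightarrow> solves \<omega> t0 w \<Longrightarrow>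
      (\<And>s j. t0 - r \<le> s \<Longrightarrow> s \<le> t0 \<Longrightarrow> \<bar>z s $ j - w s $ j\<bar> \<le> e) \<Longrightarrow> t0 \<le> t \<Longrightarrow>
      \<bar>z t $ j - w t $ j\<bar> \<le> 8 * exp (\<Lambda> * (t - t0)) * e"
proof -
  obtain \<Lambda> where \<Lambda>: "0 < \<Lambda>" "\<And>i. exp (- \<Lambda> * \<alpha> i) \<le> 1 / 4" "rhs_lip / \<Lambda> \<le> 1 / 4"
    using exp_decay_finite[of \<alpha> "1 / 4" rhs_lip] alp(1) by auto
  have main: "\<bar>z t $ j - w t $ j\<bar> \<le> 8 * exp (\<Lambda> * (t - t0)) * e"
    if \<omega>: "\<omega> \<in> H" and z: "solves \<omega> t0 z" and w: "solves \<omega> t0 w"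
      and e: "\<And>s j. t0 - r \<le> s \<Longrightarrow> s \<le> t0 \<Longrightarrow> \<bar>z s $ j - w s $ j\<bar> \<le> e"
      and t: "t0 \<le> t" for \<omega> t0 z w e t j
  proof -
    define E where "E s = exp (\<Lambda> * (max s t0 - t0))" for s
    have E1: "1 \<le> E s" for s using \<Lambda> by (simp add: E_def)
    have Epos: "0 < E s" for s by (simp add: E_def)
    define f where "f i s = \<bar>z s $ i - w s $ i\<bar> / E s" for i s
    have e0: "0 \<le> e" using e[of t0 j] r_pos abs_ge_zero[of "z t0 $ j - w t0 $ j"] by linarith
    have "continuous_on {t0 - r..t} (f i)" for i
      unfolding f_def E_def
      by (intro continuous_intros continuous_on_component solves_cont[OF z] solves_cont[OF w]) auto
    then have "\<exists>s\<in>{t0 - r..t}. \<forall>s'\<in>{t0 - r..t}. f i s' \<le> f i s" for i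
      using t r_pos by (intro continuous_attains_sup) auto
    then obtain \<sigma> where \<sigma>: "\<And>i. \<sigma> i \<in> {t0 - r..t}" "\<And>i s. s \<in> {t0 - r..t} \<Longrightarrow> f i s \<le> f i (\<sigma> i)"
      by metis
    define S where "S = Max (range (\<lambda>i. f i (\<sigma> i)))"
    have fS: "f i s \<le> S" if "s \<in> {t0 - r..t}" for i s
    proof -
      have "f i (\<sigma> i) \<le> S" unfolding S_def by (rule Max_ge) auto
      then show ?thesis using \<sigma>(2)[OF that, of i] by linarith
    qed
    have "S \<in> range (\<lambda>i. f i (\<sigma> i))" unfolding S_def by (intro Max_in) auto
    then obtain k where k: "S = f k (\<sigma> k)" by blast
    have S0: "0 \<le> S" using k Epos[of "\<sigma> k"] by (simp add: f_def less_imp_le)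
    have zw: "\<bar>z s $ i - w s $ i\<bar> \<le> S * E s" if "s \<in> {t0 - r..t}" for i s
      using fS[OF that, of i] Epos[of s] by (simp add: f_def pos_divide_le_eq)
    have "S \<le> 8 * e"
    proof (cases "\<sigma> k \<le> t0")
      case True
      then have "S \<le> \<bar>z (\<sigma> k) $ k - w (\<sigma> k) $ k\<bar>" using k by (simp add: f_def E_def max_absorb2)
      also have "\<dots> \<le> e" using \<sigma>(1)[of k] True by (intro e) auto
      finally show ?thesis using e0 by linarith
    next
      case False
      let ?s = "\<sigma> k"
      have s: "t0 \<le> ?s" "?s \<le> t" using False \<sigma>(1)[of k] by auto
      have "\<bar>z (?s - \<alpha> k) $ k - w (?s - \<alpha> k) $ k\<bar> \<le> e + S * E ?s / 4"
      proof (cases "?s - \<alpha> k \<le> t0")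
        case True
        then have "\<bar>z (?s - \<alpha> k) $ k - w (?s - \<alpha> k) $ k\<bar> \<le> e" using s alp[of k] by (intro e) auto
        then show ?thesis using S0 Epos[of ?s] by (smt (verit) divide_nonneg_pos mult_nonneg_nonneg)
      next
        case False
        then have "max (?s - \<alpha> k) t0 = ?s - \<alpha> k" by simp
        then have "E (?s - \<alpha> k) = exp (- \<Lambda> * \<alpha> k) * E ?s"
          using s by (simp add: E_def max_absorb1 exp_add[symmetric] algebra_simps)
        also have "\<dots> \<le> 1 / 4 * E ?s" using \<Lambda>(2) Epos[of ?s] by (intro mult_right_mono) (auto simp: less_imp_le)
        finally have "S * E (?s - \<alpha> k) \<le> S * (1 / 4 * E ?s)" using S0 by (intro mult_left_mono) auto
        then show ?thesis using zw[of "?s - \<alpha> k" k] s alp[of k] False e0 r_pos by simp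
      qed
      then have "\<gamma> k * \<bar>z (?s - \<alpha> k) $ k - w (?s - \<alpha> k) $ k\<bar> \<le> 1 * (e + S * E ?s / 4)"
        using gam[of k] by (intro mult_mono) auto
      then have 1: "\<bar>\<gamma> k * z (?s - \<alpha> k) $ k - \<gamma> k * w (?s - \<alpha> k) $ k\<bar> \<le> e + S * E ?s / 4"
        using gam[of k] by (simp add: right_diff_distrib[symmetric] abs_mult)
      have "\<bar>integral {t0..?s} (\<lambda>\<tau>. rhs \<omega> z \<tau> k) - integral {t0..?s} (\<lambda>\<tau>. rhs \<omega> w \<tau> k)\<bar>
        \<le> S * (rhs_lip / \<Lambda>) * exp (\<Lambda> * (?s - t0))"
        by (rule rhs_integral_weighted[OF \<omega> solves_cont[OF z] solves_cont[OF w] \<Lambda>(1) S0 s(1)])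
          (use zw s in \<open>auto simp: E_def\<close>)
      also have "\<dots> = (S * E ?s) * (rhs_lip / \<Lambda>)" using s by (simp add: E_def max_absorb1)
      also have "\<dots> \<le> (S * E ?s) * (1 / 4)"
        using S0 Epos[of ?s] \<Lambda>(3) by (intro mult_left_mono) (auto simp: less_imp_le)
      finally have 2: "\<bar>integral {t0..?s} (\<lambda>\<tau>. rhs \<omega> z \<tau> k) - integral {t0..?s} (\<lambda>\<tau>. rhs \<omega> w \<tau> k)\<bar> \<le> S * E ?s / 4"
        by simp
      have "\<gamma> k * \<bar>z (t0 - \<alpha> k) $ k - w (t0 - \<alpha> k) $ k\<bar> \<le> 1 * e"
        using gam[of k] alp[of k] by (intro mult_mono e) auto
      then have "\<bar>\<gamma> k * z (t0 - \<alpha> k) $ k - \<gamma> k * w (t0 - \<alpha> k) $ k\<bar> \<le> e"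
        using gam[of k] by (simp add: right_diff_distrib[symmetric] abs_mult)
      then have 3: "\<bar>D_at z t0 k - D_at w t0 k\<bar> \<le> 2 * e"
        using e[of t0 k] r_pos unfolding D_at_def by linarith
      have "D_at z ?s k - D_at z t0 k = integral {t0..?s} (\<lambda>\<tau>. rhs \<omega> z \<tau> k)"
        "D_at w ?s k - D_at w t0 k = integral {t0..?s} (\<lambda>\<tau>. rhs \<omega> w \<tau> k)"
        by (rule solves_integral[OF z order_refl s(1)], rule solves_integral[OF w order_refl s(1)])
      then have "\<bar>z ?s $ k - w ?s $ k\<bar> \<le> 3 * e + S * E ?s / 2"
        using 1 2 3 unfolding D_at_def by linarith
      moreover have "\<bar>z ?s $ k - w ?s $ k\<bar> = S * E ?s" using k Epos[of ?s] by (simp add: f_def)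
      ultimately have "S * E ?s \<le> 6 * e" by linarith
      moreover have "S * 1 \<le> S * E ?s" using S0 E1 by (intro mult_left_mono)
      ultimately show ?thesis using e0 by linarith
    qed
    then have "S * E t \<le> 8 * e * E t" using Epos[of t] by (intro mult_right_mono) auto
    also have "\<dots> = 8 * exp (\<Lambda> * (t - t0)) * e" using t by (simp add: E_def max_absorb1)
    finally show ?thesis using zw[of t j] t r_pos by simp
  qed
  show ?thesis by (rule that[of \<Lambda>]) (rule main)
qed

lemma solves_unique:
  assumes "\<omega> \<in> H" "solves \<omega> t0 z" "solves \<omega> t0 w" "\<And>s. t0 - r \<le> s \<Longrightarrow> s \<le> t0 \<Longrightarrow> z s = w s" "t0 - r \<le> t"
  shows "z t = w t"
proof (cases "t \<le> t0")
  case True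
  then show ?thesis using assms by simp
next
  case False
  obtain \<Lambda> where \<Lambda>: "\<And>\<omega> t0 z w e t j. \<omega> \<in> H \<Longrightarrow> solves \<omega> t0 z \<Longrightarrow> solves \<omega> t0 w \<Longrightarrow>
      (\<And>s j. t0 - r \<le> s \<Longrightarrow> s \<le> t0 \<Longrightarrow> \<bar>z s $ j - w s $ j\<bar> \<le> e) \<Longrightarrow> t0 \<le> t \<Longrightarrow>
      \<bar>z t $ j - w t $ j\<bar> \<le> 8 * exp (\<Lambda> * (t - t0)) * e"
    using solves_dependence by blast
  have "\<bar>z t $ j - w t $ j\<bar> \<le> 8 * exp (\<Lambda> * (t - t0)) * 0" for j
    by (rule \<Lambda>[OF assms(1-3)]) (use assms False in auto)
  then show ?thesis by (simp add: vec_eq_iff)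
qed

end

section \<open>The exponential ordering\<close>

text \<open>Induction in steps of the delay \<open>a\<close>: on each new step the delayed values
  lie in the range already treated, and \<open>g \<ge> 0\<close> preserves their order. It transfers
  monotonicity from the weighted D to the weighted function itself.\<close>

lemma mono_on_neutral_extend:
  fixes Y E :: "real \<Rightarrow> real"
  assumes g: "0 \<le> g" and a: "0 < a" "a \<le> r"
    and Y: "\<And>t. t0 \<le> t \<Longrightarrow> Y t = g * Y (t - a) + E t"
    and E: "mono_on {t0..T} E" and Y0: "mono_on {t0 - r..t0} Y"
  shows "mono_on {t0 - r..T} Y"
proof -
  have ind: "mono_on {t0 - r..min T (t0 + real n * a)} Y" for n
  proof (induction n)
    case 0
    then show ?case using Y0 by (rule mono_on_subset) simp
  next
    case (Suc n)
    have late: "Y s \<le> Y s'" if s: "t0 \<le> s" "s \<le> s'" "s' \<le> T" "s' \<le> t0 + real (Suc n) * a" for s s'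
    proof -
      have "Y (s - a) \<le> Y (s' - a)"
        using Suc s a by (intro mono_onD[OF Suc]) (auto simp: algebra_simps)
      then have "g * Y (s - a) \<le> g * Y (s' - a)" using g by (rule mult_left_mono)
      moreover have "E s \<le> E s'" using s by (intro mono_onD[OF E]) auto
      ultimately show ?thesis using Y[of s] Y[of s'] s by simp
    qed
    show ?case
    proof (rule mono_onI)
      fix s s' assume s: "s \<in> {t0 - r..min T (t0 + real (Suc n) * a)}" "s' \<in> {t0 - r..min T (t0 + real (Suc n) * a)}" "s \<le> s'"
      consider "s' \<le> t0" | "t0 \<le> s" | "s \<le> t0" "t0 \<le> s'" by linarith
      then show "Y s \<le> Y s'"
      proof cases
        case 1 then show ?thesis using s by (intro mono_onD[OF Y0]) auto
      next
        case 2 then show ?thesis using s by (intro late) auto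
      next
        case 3
        then have "Y s \<le> Y t0" using s by (intro mono_onD[OF Y0]) auto
        also have "Y t0 \<le> Y s'" using s 3 by (intro late) auto
        finally show ?thesis .
      qed
    qed
  qed
  obtain n where "(T - t0) / a \<le> real n" using real_arch_simple by blast
  then have "min T (t0 + real n * a) = T" using a by (simp add: field_simps)
  then show ?thesis using ind[of n] by simp
qed

context compartmental
begin

text \<open>A window of length \<open>r\<close> is enough since no delay exceeds \<open>r\<close>;
  the ordering on the whole line is recovered by chaining windows.\<close>

definition cone :: "real \<Rightarrow> (real \<Rightarrow> real ^ 'm) \<Rightarrow> bool" where
  "cone t y \<longleftrightarrow> (\<forall>i. exp_mono (\<beta> i) (t - r) t (\<lambda>s. y s $ i))"

lemma cone_cong: "cone t y \<Longrightarrow> (\<And>s. t - r \<le> s \<Longrightarrow> s \<le> t \<Longrightarrow> y s = y' s) \<Longrightarrow> cone t y'"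
  using r_pos unfolding cone_def exp_mono_def by (smt (verit))

lemma cone_nonneg: "cone t y \<Longrightarrow> t - r \<le> s \<Longrightarrow> s \<le> t \<Longrightarrow> 0 \<le> y s $ i"
  using exp_mono_nonneg[of "\<beta> i" "t - r" t "\<lambda>s. y s $ i"] by (simp add: cone_def)

lemma cone_add: "cone t y \<Longrightarrow> cone t y' \<Longrightarrow> cone t (\<lambda>s. y s + y' s)"
  unfolding cone_def using exp_mono_add by fastforce

lemma cone_const: "(\<And>i. 0 \<le> k $ i) \<Longrightarrow> cone t (\<lambda>_. k)"
  unfolding cone_def by (auto intro!: exp_mono_const less_imp_le[OF bet])

text \<open>A shift in time multiplies all weighted values by the same positive factor.\<close>

lemma cone_shift: "cone t (\<lambda>u. y (s + u)) \<longleftrightarrow> cone (s + t) y"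
proof -
  have *: "exp_mono b (t - r) t (\<lambda>u. f (s + u)) \<longleftrightarrow> exp_mono b (s + t - r) (s + t) f" for b f
  proof -
    have "(\<forall>u u'. t - r \<le> u \<longrightarrow> u \<le> u' \<longrightarrow> u' \<le> t \<longrightarrow> exp (b * u) * f (s + u) \<le> exp (b * u') * f (s + u')) \<longleftrightarrow>
      (\<forall>u u'. s + t - r \<le> u \<longrightarrow> u \<le> u' \<longrightarrow> u' \<le> s + t \<longrightarrow> exp (b * u) * f u \<le> exp (b * u') * f u')"
    proof (intro iffI allI impI)
      fix u u' assume A: "\<forall>u u'. t - r \<le> u \<longrightarrow> u \<le> u' \<longrightarrow> u' \<le> t \<longrightarrow> exp (b * u) * f (s + u) \<le> exp (b * u') * f (s + u')"
        and u: "s + t - r \<le> u" "u \<le> u'" "u' \<le> s + t"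
      have "exp (b * (u - s)) * f (s + (u - s)) \<le> exp (b * (u' - s)) * f (s + (u' - s))"
        using u by (intro A[rule_format]) auto
      then have "exp (b * s) * (exp (b * (u - s)) * f u) \<le> exp (b * s) * (exp (b * (u' - s)) * f u')"
        by (intro mult_left_mono) auto
      then show "exp (b * u) * f u \<le> exp (b * u') * f u'"
        by (simp add: mult.assoc[symmetric] exp_add[symmetric] right_diff_distrib)
    next
      fix u u' assume A: "\<forall>u u'. s + t - r \<le> u \<longrightarrow> u \<le> u' \<longrightarrow> u' \<le> s + t \<longrightarrow> exp (b * u) * f u \<le> exp (b * u') * f u'"
        and u: "t - r \<le> u" "u \<le> u'" "u' \<le> t"
      have "exp (b * (s + u)) * f (s + u) \<le> exp (b * (s + u')) * f (s + u')"
        using u by (intro A[rule_format]) auto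
      then have "exp (- b * s) * (exp (b * (s + u)) * f (s + u)) \<le> exp (- b * s) * (exp (b * (s + u')) * f (s + u'))"
        by (intro mult_left_mono) auto
      then show "exp (b * u) * f (s + u) \<le> exp (b * u') * f (s + u')"
        by (simp add: mult.assoc[symmetric] exp_add[symmetric] distrib_left)
    qed
    then show ?thesis by (simp add: exp_mono_def algebra_simps)
  qed
  show ?thesis unfolding cone_def using *[where f = "\<lambda>s. y s $ i" for i] by simp
qed

lemma cone_limit:
  assumes "\<forall>\<^sub>F n in sequentially. cone t (f n)" "\<And>s. t - r \<le> s \<Longrightarrow> s \<le> t \<Longrightarrow> (\<lambda>n. f n s) \<longlonglongrightarrow> y s"
  shows "cone t y"
  unfolding cone_def
proof
  fix i
  show "exp_mono (\<beta> i) (t - r) t (\<lambda>s. y s $ i)"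
  proof (rule exp_mono_limit)
    show "\<forall>\<^sub>F n in sequentially. exp_mono (\<beta> i) (t - r) t (\<lambda>s. f n s $ i)"
      using assms(1) by (auto simp: cone_def elim!: eventually_mono)
  qed (use assms(2) r_pos in \<open>auto intro: tendsto_vec_nth\<close>)
qed

lemma lm_le_sum: "lm i \<le> (\<Sum>j\<in>UNIV. lp j i)"
  using lm(2)[of i] member_le_sum[of i UNIV "\<lambda>j. lp j i"] lp by force

lemma drift_ex: "\<exists>\<kappa>>0. \<forall>i y t. exp_mono (\<beta> i) (t - r) t y \<longrightarrow>
    \<kappa> * y (t - r) \<le> \<beta> i * (y t - \<gamma> i * y (t - \<alpha> i)) - (\<Sum>j\<in>UNIV. lp j i) * y t + lm i * y (t - \<rho> i i)"
proof -
  have "\<forall>i. \<exists>\<kappa>>0. \<forall>y t. exp_mono (\<beta> i) (t - r) t y \<longrightarrow>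
    \<kappa> * y (t - r) \<le> \<beta> i * (y t - \<gamma> i * y (t - \<alpha> i)) - (\<Sum>j\<in>UNIV. lp j i) * y t + lm i * y (t - \<rho> i i)"
    by (intro allI rate_cond_drift[OF rate] bet gam alp rho lm lm_le_sum)
  then obtain \<kappa> where \<kappa>: "\<And>i. 0 < \<kappa> i" "\<And>i y t. exp_mono (\<beta> i) (t - r) t y \<Longrightarrow>
    \<kappa> i * y (t - r) \<le> \<beta> i * (y t - \<gamma> i * y (t - \<alpha> i)) - (\<Sum>j\<in>UNIV. lp j i) * y t + lm i * y (t - \<rho> i i)"
    by metis
  have "Min (range \<kappa>) * y (t - r) \<le> \<beta> i * (y t - \<gamma> i * y (t - \<alpha> i)) - (\<Sum>j\<in>UNIV. lp j i) * y t + lm i * y (t - \<rho> i i)"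
    if "exp_mono (\<beta> i) (t - r) t y" for i y t
  proof -
    have "Min (range \<kappa>) * y (t - r) \<le> \<kappa> i * y (t - r)"
      using that by (intro mult_right_mono Min_le) (auto simp: exp_mono_def)
    then show ?thesis using \<kappa>(2)[OF that] by linarith
  qed
  moreover have "0 < Min (range \<kappa>)" using \<kappa>(1) by (simp add: Min_gr_iff)
  ultimately show ?thesis by blast
qed

lemma theta_ex: "\<exists>\<theta>>0. \<forall>i y t. exp_mono (\<beta> i) (t - r) t y \<longrightarrow> continuous_on UNIV y \<longrightarrow>
    \<theta> * y t \<le> y t - \<gamma> i * y (t - \<alpha> i) + lm i * integral {t - \<rho> i i..t} y"
proof -
  have "\<forall>i. \<exists>\<theta>>0. \<forall>y t. exp_mono (\<beta> i) (t - r) t y \<longrightarrow> continuous_on UNIV y \<longrightarrow>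
    \<theta> * y t \<le> y t - \<gamma> i * y (t - \<alpha> i) + lm i * integral {t - \<rho> i i..t} y"
    by (intro allI rate_cond_mass[OF rate] bet gam alp rho lm lm_le_sum)
  then obtain \<theta> where \<theta>: "\<And>i. 0 < \<theta> i" "\<And>i y t. exp_mono (\<beta> i) (t - r) t y \<Longrightarrow> continuous_on UNIV y \<Longrightarrow>
    \<theta> i * y t \<le> y t - \<gamma> i * y (t - \<alpha> i) + lm i * integral {t - \<rho> i i..t} y"
    by metis
  have "Min (range \<theta>) * y t \<le> y t - \<gamma> i * y (t - \<alpha> i) + lm i * integral {t - \<rho> i i..t} y"
    if "exp_mono (\<beta> i) (t - r) t y" "continuous_on UNIV y" for i y t
  proof -
    have "Min (range \<theta>) * y t \<le> \<theta> i * y t"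
      using exp_mono_nonneg[OF that(1), of t] r_pos by (intro mult_right_mono Min_le) auto
    then show ?thesis using \<theta>(2)[OF that] by linarith
  qed
  moreover have "0 < Min (range \<theta>)" using \<theta>(1) by (simp add: Min_gr_iff)
  ultimately show ?thesis by blast
qed

definition \<kappa> :: real where
  "\<kappa> = (SOME \<kappa>. 0 < \<kappa> \<and> (\<forall>i y t. exp_mono (\<beta> i) (t - r) t y \<longrightarrow>
    \<kappa> * y (t - r) \<le> \<beta> i * (y t - \<gamma> i * y (t - \<alpha> i)) - (\<Sum>j\<in>UNIV. lp j i) * y t + lm i * y (t - \<rho> i i)))"

definition \<theta> :: real where
  "\<theta> = (SOME \<theta>. 0 < \<theta> \<and> (\<forall>i y t. exp_mono (\<beta> i) (t - r) t y \<longrightarrow> continuous_on UNIV y \<longrightarrow>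
    \<theta> * y t \<le> y t - \<gamma> i * y (t - \<alpha> i) + lm i * integral {t - \<rho> i i..t} y))"

lemma kappa_pos: "0 < \<kappa>"
  and kappa_drift: "exp_mono (\<beta> i) (t - r) t y \<Longrightarrow>
    \<kappa> * y (t - r) \<le> \<beta> i * (y t - \<gamma> i * y (t - \<alpha> i)) - (\<Sum>j\<in>UNIV. lp j i) * y t + lm i * y (t - \<rho> i i)"
  using someI_ex[OF drift_ex, folded \<kappa>_def] by auto

lemma theta_pos: "0 < \<theta>"
  and theta_mass: "exp_mono (\<beta> i) (t - r) t y \<Longrightarrow> continuous_on UNIV y \<Longrightarrow>
    \<theta> * y t \<le> y t - \<gamma> i * y (t - \<alpha> i) + lm i * integral {t - \<rho> i i..t} y"
  using someI_ex[OF theta_ex, folded \<theta>_def] by auto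

text \<open>The larger state loses at most the column sum of \<open>lp\<close> times the difference.
  Of the additional inflow only that from the own pipe is kept, bounded below by \<open>lm\<close>;
  the other pipes contribute nonnegatively by monotonicity.\<close>

lemma rhs_diff_lower:
  assumes \<omega>: "\<omega> \<in> H" and le: "\<And>s j. t - r \<le> s \<Longrightarrow> s \<le> t \<Longrightarrow> w s $ j \<le> z s $ j"
  shows "lm i * (z (t - \<rho> i i) $ i - w (t - \<rho> i i) $ i) - (\<Sum>j\<in>UNIV. lp j i) * (z t $ i - w t $ i)
    \<le> rhs \<omega> z t i - rhs \<omega> w t i"
proof -
  let ?in = "\<lambda>j. \<omega> (t - \<rho> i j, z (t - \<rho> i j) $ j) $ i $ j - \<omega> (t - \<rho> i j, w (t - \<rho> i j) $ j) $ i $ j"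
  let ?out = "\<lambda>j. \<omega> (t, z t $ i) $ j $ i - \<omega> (t, w t $ i) $ j $ i"
  have "(\<Sum>j\<in>UNIV. ?out j) \<le> (\<Sum>j\<in>UNIV. lp j i * (z t $ i - w t $ i))"
    using r_pos by (intro sum_mono H_upper \<omega> le) auto
  moreover have "lm i * (z (t - \<rho> i i) $ i - w (t - \<rho> i i) $ i) \<le> ?in i"
    using rho[of i i] r_pos by (intro H_lower \<omega> le) auto
  moreover have "?in i \<le> (\<Sum>j\<in>UNIV. ?in j)"
  proof (rule member_le_sum)
    fix j
    have "w (t - \<rho> i j) $ j \<le> z (t - \<rho> i j) $ j" using rho[of i j] by (intro le) auto
    then show "0 \<le> ?in j" using H_mono[OF \<omega>] by simp
  qed auto
  moreover have "rhs \<omega> z t i - rhs \<omega> w t i = (\<Sum>j\<in>UNIV. ?in j) - (\<Sum>j\<in>UNIV. ?out j)"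
    by (simp add: rhs_def sum_subtractf)
  ultimately show ?thesis by (simp add: sum_distrib_right)
qed

text \<open>This is exp(- \<beta> t) times the derivative of exp(\<beta> t) (D z - D w) in the i-th
  component.\<close>

definition drift :: "(real \<times> real \<Rightarrow> real ^ 'm ^ 'm) \<Rightarrow> (real \<Rightarrow> real ^ 'm) \<Rightarrow> (real \<Rightarrow> real ^ 'm) \<Rightarrow> real \<Rightarrow> 'm \<Rightarrow> real" where
  "drift \<omega> z w t i = \<beta> i * (D_at z t i - D_at w t i) + (rhs \<omega> z t i - rhs \<omega> w t i)"

lemma drift_lower:
  assumes \<omega>: "\<omega> \<in> H" and c: "cone t (\<lambda>s. z s - w s)"
  shows "\<kappa> * (z (t - r) $ i - w (t - r) $ i) \<le> drift \<omega> z w t i"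
proof -
  have "w s $ j \<le> z s $ j" if "t - r \<le> s" "s \<le> t" for s j
    using cone_nonneg[OF c that, of j] by simp
  then have "lm i * (z (t - \<rho> i i) $ i - w (t - \<rho> i i) $ i) - (\<Sum>j\<in>UNIV. lp j i) * (z t $ i - w t $ i)
    \<le> rhs \<omega> z t i - rhs \<omega> w t i" by (intro rhs_diff_lower \<omega>)
  moreover have "exp_mono (\<beta> i) (t - r) t (\<lambda>s. z s $ i - w s $ i)"
    using c by (simp add: cone_def)
  note kappa_drift[OF this]
  ultimately show ?thesis by (simp add: drift_def D_at_def algebra_simps)
qed

text \<open>Integration of \<open>c * exp (\<beta> i * t)\<close>. With \<open>c = 0\<close> it
  yields invariance of the cone; with positive \<open>c\<close> it yields the margin by which a
  minimal upper bound can be lowered.\<close>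

lemma D_at_weighted_increase:
  assumes z: "solves \<omega> t0 z" and w: "solves \<omega> t0 w" and ab: "t0 \<le> a" "a \<le> b"
    and Q: "\<And>t. a < t \<Longrightarrow> t < b \<Longrightarrow> c \<le> drift \<omega> z w t i"
  shows "c / \<beta> i * (exp (\<beta> i * b) - exp (\<beta> i * a)) \<le>
    exp (\<beta> i * b) * (D_at z b i - D_at w b i) - exp (\<beta> i * a) * (D_at z a i - D_at w a i)"
proof -
  define f where "f t = exp (\<beta> i * t) * (D_at z t i - D_at w t i) - c / \<beta> i * exp (\<beta> i * t)" for t
  have "f a \<le> f b"
  proof (rule DERIV_nonneg_imp_increasing_open[OF ab(2)])
    fix t assume t: "a < t" "t < b"
    have "at t within {t0..} = at t" using t ab by (intro at_within_interior) simp
    then have "((\<lambda>t. D_at z t i) has_real_derivative rhs \<omega> z t i) (at t)"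
      "((\<lambda>t. D_at w t i) has_real_derivative rhs \<omega> w t i) (at t)"
      using z w t ab unfolding solves_def by (metis less_imp_le order_trans)+
    then have "(f has_real_derivative exp (\<beta> i * t) * (drift \<omega> z w t i - c)) (at t)"
      unfolding f_def drift_def using bet[of i]
      by (auto intro!: derivative_eq_intros simp: algebra_simps)
    then show "\<exists>y. (f has_real_derivative y) (at t) \<and> 0 \<le> y" using Q[OF t] by force
  next
    show "continuous_on {a..b} f"
      unfolding f_def by (intro continuous_intros D_at_cont solves_cont[OF z] solves_cont[OF w])
  qed
  then show ?thesis by (simp add: f_def algebra_simps)
qed

text \<open>Solves the definition of D for the present value, in the form that
  \<open>mono_on_neutral_extend\<close> expects.\<close>

lemma weighted_neutral:
  "exp (\<beta> i * t) * (z t $ i - w t $ i) = \<gamma> i * exp (\<beta> i * \<alpha> i) * (exp (\<beta> i * (t - \<alpha> i)) * (z (t - \<alpha> i) $ i - w (t - \<alpha> i) $ i))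
    + exp (\<beta> i * t) * (D_at z t i - D_at w t i)"
proof -
  have "exp (\<beta> i * t) = exp (\<beta> i * \<alpha> i) * exp (\<beta> i * (t - \<alpha> i))"
    by (simp add: exp_add[symmetric] algebra_simps)
  then show ?thesis by (simp add: D_at_def algebra_simps)
qed

text \<open>Nonnegative drift makes the weighted D increasing, and the neutral recursion passes this
  on to the weighted difference. The second conclusion follows the oldest value of the window, on
  which the strict lower bound of the drift depends.\<close>

lemma cone_extend:
  assumes z: "solves \<omega> t0 z" and w: "solves \<omega> t0 w" and c: "cone t0 (\<lambda>s. z s - w s)"
    and Q: "\<And>t i. t0 \<le> t \<Longrightarrow> t < T \<Longrightarrow> 0 \<le> drift \<omega> z w t i" and t: "t0 \<le> t" "t \<le> T"
  shows "cone t (\<lambda>s. z s - w s)" "exp (\<beta> i * (t0 - r)) * (z (t0 - r) $ i - w (t0 - r) $ i)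
    \<le> exp (\<beta> i * (t - r)) * (z (t - r) $ i - w (t - r) $ i)"
proof -
  let ?Y = "\<lambda>i t. exp (\<beta> i * t) * (z t $ i - w t $ i)"
  have m: "mono_on {t0 - r..T} (?Y i)" for i
  proof (rule mono_on_neutral_extend[OF _ alp, where E = "\<lambda>t. exp (\<beta> i * t) * (D_at z t i - D_at w t i)"])
    show "?Y i t = \<gamma> i * exp (\<beta> i * \<alpha> i) * ?Y i (t - \<alpha> i) + exp (\<beta> i * t) * (D_at z t i - D_at w t i)" for t
      by (rule weighted_neutral)
    show "0 \<le> \<gamma> i * exp (\<beta> i * \<alpha> i)" using gam by simp
    show "mono_on {t0..T} (\<lambda>t. exp (\<beta> i * t) * (D_at z t i - D_at w t i))"
    proof (rule mono_onI)
      fix a b assume ab: "a \<in> {t0..T}" "b \<in> {t0..T}" "a \<le> b"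
      have "0 / \<beta> i * (exp (\<beta> i * b) - exp (\<beta> i * a)) \<le>
        exp (\<beta> i * b) * (D_at z b i - D_at w b i) - exp (\<beta> i * a) * (D_at z a i - D_at w a i)"
        using ab Q by (intro D_at_weighted_increase[OF z w]) auto
      then show "exp (\<beta> i * a) * (D_at z a i - D_at w a i) \<le> exp (\<beta> i * b) * (D_at z b i - D_at w b i)" by simp
    qed
    show "mono_on {t0 - r..t0} (?Y i)"
      using c by (auto simp: cone_def exp_mono_def intro!: mono_onI)
  qed
  have Ymono: "?Y i s \<le> ?Y i s'" if "t0 - r \<le> s" "s \<le> s'" "s' \<le> t" for i s s'
    using that t by (intro mono_onD[OF m]) auto
  show *: "?Y i (t0 - r) \<le> ?Y i (t - r)" for i using t r_pos by (intro Ymono) auto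
  show "cone t (\<lambda>s. z s - w s)"
    unfolding cone_def exp_mono_def
  proof (intro allI conjI impI)
    fix i
    have "0 \<le> z (t0 - r) $ i - w (t0 - r) $ i" using c by (simp add: cone_def exp_mono_def)
    then have "0 \<le> ?Y i (t0 - r)" by simp
    also note *[of i]
    finally show "0 \<le> (z (t - r) - w (t - r)) $ i" by (simp add: zero_le_mult_iff)
    fix s s' assume "t - r \<le> s" "s \<le> s'" "s' \<le> t"
    then show "exp (\<beta> i * s) * (z s - w s) $ i \<le> exp (\<beta> i * s') * (z s' - w s') $ i"
      using Ymono[of s s' i] t by simp
  qed
qed

text \<open>At a first time where the drift fails to be positive, all of the past lies in the cone, so
  \<open>drift_lower\<close> makes the drift positive there after all.\<close>

lemma cone_invariant_strict:
  assumes \<omega>: "\<omega> \<in> H" and z: "solves \<omega> t0 z" and w: "solves \<omega> t0 w" and c: "cone t0 (\<lambda>s. z s - w s)"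
    and pos: "\<And>i. w (t0 - r) $ i < z (t0 - r) $ i" and t: "t0 \<le> t"
  shows "cone t (\<lambda>s. z s - w s)"
proof -
  define S where "S = (\<Union>i. {t\<in>{t0..}. drift \<omega> z w t i \<le> 0})"
  have S_iff: "s \<in> S \<longleftrightarrow> t0 \<le> s \<and> (\<exists>i. drift \<omega> z w s i \<le> 0)" for s
    by (auto simp: S_def)
  have Qc: "continuous_on A (\<lambda>t. drift \<omega> z w t i)" for A i
    unfolding drift_def by (intro continuous_intros D_at_cont rhs_cont \<omega> solves_cont[OF z] solves_cont[OF w])
  have "closed {t\<in>{t0..}. drift \<omega> z w t i \<le> 0}" for i
    using continuous_closed_preimage[OF Qc[of "{t0..}" i], of "{..0}"] by (simp add: vimage_def Int_def conj_commute)
  then have closed: "closed S" unfolding S_def by (intro closed_UN) auto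
  have "S = {}"
  proof (rule ccontr)
    assume "S \<noteq> {}"
    moreover have bdd: "bdd_below S" unfolding S_def by (intro bdd_belowI[of _ t0]) auto
    ultimately have T: "Inf S \<in> S" using closed by (intro closed_contains_Inf)
    then have T0: "t0 \<le> Inf S" by (auto simp: S_def)
    have Q: "0 \<le> drift \<omega> z w s i" if "t0 \<le> s" "s < Inf S" for s i
    proof (rule ccontr)
      assume "\<not> 0 \<le> drift \<omega> z w s i"
      then have "drift \<omega> z w s i \<le> 0" by simp
      then have "s \<in> S" using that unfolding S_iff by blast
      then show False using cInf_lower[OF _ bdd, of s] that by simp
    qed
    obtain i where i: "drift \<omega> z w (Inf S) i \<le> 0" using T by (auto simp: S_def)
    note ext = cone_extend[OF z w c Q T0 order_refl]
    have "0 < exp (\<beta> i * (t0 - r)) * (z (t0 - r) $ i - w (t0 - r) $ i)" using pos[of i] by simp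
    also note ext(2)[of i]
    finally have "0 < z (Inf S - r) $ i - w (Inf S - r) $ i" by (simp add: zero_less_mult_iff)
    then have "0 < \<kappa> * (z (Inf S - r) $ i - w (Inf S - r) $ i)" using kappa_pos by (rule mult_pos_pos[rotated])
    also have "\<dots> \<le> drift \<omega> z w (Inf S) i" by (rule drift_lower[OF \<omega> ext(1)])
    finally show False using i by simp
  qed
  then have "0 \<le> drift \<omega> z w s i" if "t0 \<le> s" for s i
  proof -
    have "\<not> drift \<omega> z w s i \<le> 0" using that \<open>S = {}\<close> S_iff[of s] by blast
    then show ?thesis by simp
  qed
  then show ?thesis by (intro cone_extend(1)[OF z w c, of t]) (use t in auto)
qed

text \<open>Strictness is forced by adding the constants 1/(n+1) to the history of \<open>z\<close>;
  continuous dependence and closedness of the cone remove them again.\<close>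

lemma cone_invariant:
  assumes \<omega>: "\<omega> \<in> H" and z: "solves \<omega> t0 z" and w: "solves \<omega> t0 w" and c: "cone t0 (\<lambda>s. z s - w s)"
    and t: "t0 \<le> t"
  shows "cone t (\<lambda>s. z s - w s)"
proof -
  have "\<exists>p. solves \<omega> t0 p \<and> (\<forall>s\<le>t0. p s = z s + vec (inverse (real (Suc n))))" for n
    by (intro solves_exists \<omega> continuous_intros solves_cont[OF z])
  then obtain p where p: "\<And>n. solves \<omega> t0 (p n)" "\<And>n s. s \<le> t0 \<Longrightarrow> p n s = z s + vec (inverse (real (Suc n)))"
    by metis
  have "cone t (\<lambda>s. p n s - w s)" for n
  proof (rule cone_invariant_strict[OF \<omega> p(1) w _ _ t])
    have "cone t0 (\<lambda>s. (z s - w s) + vec (inverse (real (Suc n))))"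
      by (intro cone_add c cone_const) simp
    then show "cone t0 (\<lambda>s. p n s - w s)" by (rule cone_cong) (simp add: p(2))
    show "w (t0 - r) $ i < p n (t0 - r) $ i" for i
    proof -
      have "p n (t0 - r) $ i = z (t0 - r) $ i + inverse (real (Suc n))" using r_pos by (simp add: p(2))
      moreover have "0 < inverse (real (Suc n))" by simp
      moreover have "w (t0 - r) $ i \<le> z (t0 - r) $ i" using cone_nonneg[OF c, of "t0 - r" i] r_pos by simp
      ultimately show ?thesis by linarith
    qed
  qed
  moreover have "(\<lambda>n. p n s) \<longlonglongrightarrow> z s" if "t - r \<le> s" "s \<le> t" for s
  proof -
    obtain \<Lambda> where \<Lambda>: "\<And>\<omega> t0 z w e t j. \<omega> \<in> H \<Longrightarrow> solves \<omega> t0 z \<Longrightarrow> solves \<omega> t0 w \<Longrightarrow>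
        (\<And>s j. t0 - r \<le> s \<Longrightarrow> s \<le> t0 \<Longrightarrow> \<bar>z s $ j - w s $ j\<bar> \<le> e) \<Longrightarrow> t0 \<le> t \<Longrightarrow>
        \<bar>z t $ j - w t $ j\<bar> \<le> 8 * exp (\<Lambda> * (t - t0)) * e"
      using solves_dependence by blast
    define C where "C = 8 * exp (\<Lambda> * (s - t0))"
    have "\<bar>p n s $ j - z s $ j\<bar> \<le> (C + 1) * inverse (real (Suc n))" for n j
    proof (cases "s \<le> t0")
      case True
      then show ?thesis by (simp add: p(2) distrib_right C_def)
    next
      case False
      have "\<bar>p n s $ j - z s $ j\<bar> \<le> C * inverse (real (Suc n))"
        unfolding C_def by (rule \<Lambda>[OF \<omega> p(1) z]) (use p(2) False in auto)
      also have "\<dots> \<le> (C + 1) * inverse (real (Suc n))" by (intro mult_right_mono) auto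
      finally show ?thesis .
    qed
    moreover have "(\<lambda>n. (C + 1) * inverse (real (Suc n))) \<longlonglongrightarrow> (C + 1) * 0"
      by (intro tendsto_intros LIMSEQ_inverse_real_of_nat)
    ultimately have "(\<lambda>n. p n s $ j - z s $ j) \<longlonglongrightarrow> 0" for j
      using Lim_null_comparison[where f = "\<lambda>n. p n s $ j - z s $ j" and g = "\<lambda>n. (C + 1) * inverse (real (Suc n))"]
      by simp
    then show ?thesis by (intro vec_tendstoI) (simp add: LIM_zero_iff)
  qed
  ultimately show ?thesis by (intro cone_limit[where f = "\<lambda>n s. p n s - w s"]) (auto intro!: tendsto_intros)
qed

end

section \<open>Conservation of mass and stability\<close>

lemma integral_window_shift:
  fixes f :: "real \<Rightarrow> real"
  assumes f: "continuous_on UNIV f" and "a \<le> t" "0 \<le> \<rho>"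
  shows "integral {t - \<rho>..t} f - integral {a - \<rho>..a} f = integral {a..t} f - integral {a..t} (\<lambda>s. f (s - \<rho>))"
proof -
  have int: "f integrable_on {p..q}" for p q
    by (intro integrable_continuous_real continuous_on_subset[OF f]) simp
  have "integral {a..t} (\<lambda>s. f (s - \<rho>)) = integral {a - \<rho>..t - \<rho>} f"
    using integral_shift[of a "- \<rho>" t f] continuous_on_subset[OF f] by (simp add: o_def)
  moreover have "integral {a - \<rho>..a} f + integral {a..t} f = integral {a - \<rho>..t} f"
    using assms int by (intro Henstock_Kurzweil_Integration.integral_combine) auto
  moreover have "integral {a - \<rho>..t - \<rho>} f + integral {t - \<rho>..t} f = integral {a - \<rho>..t} f"
    using assms int by (intro Henstock_Kurzweil_Integration.integral_combine) auto
  ultimately show ?thesis by linarith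
qed

context compartmental
begin

text \<open>The integral with indices \<open>i\<close>, \<open>j\<close> is the content of the pipe
  from \<open>j\<close> to \<open>i\<close>: what left \<open>j\<close> during the last
  \<open>\<rho> i j\<close> units of time.\<close>

definition mass :: "(real \<times> real \<Rightarrow> real ^ 'm ^ 'm) \<Rightarrow> (real \<Rightarrow> real ^ 'm) \<Rightarrow> real \<Rightarrow> real" where
  "mass \<omega> z t = (\<Sum>i\<in>UNIV. D_at z t i) +
     (\<Sum>i\<in>UNIV. \<Sum>j\<in>UNIV. integral {t - \<rho> i j..t} (\<lambda>s. \<omega> (s, z s $ j) $ i $ j))"

lemma entry_cont_at:
  assumes "\<omega> \<in> H" "continuous_on UNIV z"
  shows "continuous_on S (\<lambda>s. \<omega> (s, z s $ k) $ i $ j)"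
  using entry_cont[OF assms, of S 0] by simp

lemma entry_integrable:
  assumes "\<omega> \<in> H" "continuous_on UNIV z"
  shows "(\<lambda>s. \<omega> (s, z s $ k) $ i $ j) integrable_on {a..b}"
  by (intro integrable_continuous_real entry_cont_at assms)

text \<open>What leaves one compartment enters a pipe of another, so the total mass in compartments and
  pipes is constant.\<close>

lemma mass_constant:
  assumes \<omega>: "\<omega> \<in> H" and z: "solves \<omega> t0 z" and t: "t0 \<le> t"
  shows "mass \<omega> z t = mass \<omega> z t0"
proof -
  let ?G = "\<lambda>i j s. \<omega> (s, z s $ j) $ i $ j"
  note zc = solves_cont[OF z, of UNIV]
  have int: "?G i j integrable_on {t0..t}" for i j by (rule entry_integrable[OF \<omega> zc])
  have int': "(\<lambda>s. ?G i j (s - \<rho> i j)) integrable_on {t0..t}" for i j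
    using entry_cont[OF \<omega> zc, of "{t0..t}" "- \<rho> i j" j i j] by (intro integrable_continuous_real) simp
  have "D_at z t i - D_at z t0 i = (\<Sum>j\<in>UNIV. integral {t0..t} (\<lambda>s. ?G i j (s - \<rho> i j))) - (\<Sum>j\<in>UNIV. integral {t0..t} (?G j i))" for i
  proof -
    have "D_at z t i - D_at z t0 i = integral {t0..t} (\<lambda>s. (\<Sum>j\<in>UNIV. ?G i j (s - \<rho> i j)) - (\<Sum>j\<in>UNIV. ?G j i s))"
      using solves_integral[OF z order_refl t, of i] by (simp add: rhs_def)
    also have "\<dots> = (\<Sum>j\<in>UNIV. integral {t0..t} (\<lambda>s. ?G i j (s - \<rho> i j))) - (\<Sum>j\<in>UNIV. integral {t0..t} (?G j i))"
      using int int' by (simp add: integral_diff integral_sum integrable_sum)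
    finally show ?thesis .
  qed
  then have "(\<Sum>i\<in>UNIV. D_at z t i - D_at z t0 i) =
      (\<Sum>i\<in>UNIV. \<Sum>j\<in>UNIV. integral {t0..t} (\<lambda>s. ?G i j (s - \<rho> i j))) - (\<Sum>i\<in>UNIV. \<Sum>j\<in>UNIV. integral {t0..t} (?G j i))"
    by (simp add: sum_subtractf)
  also have "(\<Sum>i\<in>UNIV. \<Sum>j\<in>UNIV. integral {t0..t} (?G j i)) = (\<Sum>i\<in>UNIV. \<Sum>j\<in>UNIV. integral {t0..t} (?G i j))"
    by (rule sum.swap)
  finally have D: "(\<Sum>i\<in>UNIV. D_at z t i) - (\<Sum>i\<in>UNIV. D_at z t0 i) =
      (\<Sum>i\<in>UNIV. \<Sum>j\<in>UNIV. integral {t0..t} (\<lambda>s. ?G i j (s - \<rho> i j)) - integral {t0..t} (?G i j))"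
    by (simp add: sum_subtractf)
  have "integral {t - \<rho> i j..t} (?G i j) - integral {t0 - \<rho> i j..t0} (?G i j)
      = integral {t0..t} (?G i j) - integral {t0..t} (\<lambda>s. ?G i j (s - \<rho> i j))" for i j
    by (rule integral_window_shift[OF entry_cont_at[OF \<omega> zc] t rho(1)])
  then have "(\<Sum>i\<in>UNIV. \<Sum>j\<in>UNIV. integral {t - \<rho> i j..t} (?G i j)) - (\<Sum>i\<in>UNIV. \<Sum>j\<in>UNIV. integral {t0 - \<rho> i j..t0} (?G i j))
      = (\<Sum>i\<in>UNIV. \<Sum>j\<in>UNIV. integral {t0..t} (?G i j) - integral {t0..t} (\<lambda>s. ?G i j (s - \<rho> i j)))"
    by (simp add: sum_subtractf[symmetric])
  also have "\<dots> = - (\<Sum>i\<in>UNIV. \<Sum>j\<in>UNIV. integral {t0..t} (\<lambda>s. ?G i j (s - \<rho> i j)) - integral {t0..t} (?G i j))"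
    by (simp add: sum_negf[symmetric])
  finally show ?thesis using D unfolding mass_def by linarith
qed

text \<open>Each compartment with its own pipe contributes at least \<theta> times its present
  difference, by \<open>theta_mass\<close>; the pipes between different compartments contribute
  nonnegatively because the functions are ordered on the window.\<close>

lemma mass_lower:
  assumes \<omega>: "\<omega> \<in> H" and z: "continuous_on UNIV z" and w: "continuous_on UNIV w" and c: "cone t (\<lambda>s. z s - w s)"
  shows "\<theta> * (\<Sum>i\<in>UNIV. z t $ i - w t $ i) \<le> mass \<omega> z t - mass \<omega> w t"
proof -
  let ?G = "\<lambda>z i j s. \<omega> (s, z s $ j) $ i $ j"
  have le: "w s $ j \<le> z s $ j" if "t - r \<le> s" "s \<le> t" for s j
    using cone_nonneg[OF c that, of j] by simp
  have I: "integral {t - \<rho> i j..t} (?G z i j) - integral {t - \<rho> i j..t} (?G w i j)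
      = integral {t - \<rho> i j..t} (\<lambda>s. ?G z i j s - ?G w i j s)" for i j
    by (intro integral_diff[symmetric] entry_integrable \<omega> z w)
  have "\<theta> * (z t $ i - w t $ i) \<le> (D_at z t i - D_at w t i) +
      (\<Sum>j\<in>UNIV. integral {t - \<rho> i j..t} (?G z i j) - integral {t - \<rho> i j..t} (?G w i j))" for i
  proof -
    have ci: "continuous_on UNIV (\<lambda>s. z s $ i - w s $ i)"
      by (intro continuous_intros continuous_on_component z w)
    have "\<theta> * (z t $ i - w t $ i) \<le> (z t $ i - w t $ i) - \<gamma> i * (z (t - \<alpha> i) $ i - w (t - \<alpha> i) $ i) +
        lm i * integral {t - \<rho> i i..t} (\<lambda>s. z s $ i - w s $ i)"
      by (rule theta_mass[OF _ ci]) (use c in \<open>simp add: cone_def\<close>)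
    also have "lm i * integral {t - \<rho> i i..t} (\<lambda>s. z s $ i - w s $ i) =
        integral {t - \<rho> i i..t} (\<lambda>s. lm i * (z s $ i - w s $ i))" by simp
    also have "\<dots> \<le> integral {t - \<rho> i i..t} (\<lambda>s. ?G z i i s - ?G w i i s)"
    proof (rule integral_le)
      show "(\<lambda>s. lm i * (z s $ i - w s $ i)) integrable_on {t - \<rho> i i..t}"
        by (intro integrable_continuous_real continuous_intros continuous_on_subset[OF ci]) simp
      show "(\<lambda>s. ?G z i i s - ?G w i i s) integrable_on {t - \<rho> i i..t}"
        by (intro integrable_diff entry_integrable \<omega> z w)
      fix s assume "s \<in> {t - \<rho> i i..t}"
      then show "lm i * (z s $ i - w s $ i) \<le> ?G z i i s - ?G w i i s"
        using rho[of i i] by (intro H_lower \<omega> le) auto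
    qed
    also have "\<dots> \<le> (\<Sum>j\<in>UNIV. integral {t - \<rho> i j..t} (\<lambda>s. ?G z i j s - ?G w i j s))"
    proof (rule member_le_sum)
      fix j
      show "0 \<le> integral {t - \<rho> i j..t} (\<lambda>s. ?G z i j s - ?G w i j s)"
      proof (rule integral_nonneg)
        show "(\<lambda>s. ?G z i j s - ?G w i j s) integrable_on {t - \<rho> i j..t}"
          by (intro integrable_diff entry_integrable \<omega> z w)
        fix s assume "s \<in> {t - \<rho> i j..t}"
        then have "w s $ j \<le> z s $ j" using rho[of i j] by (intro le) auto
        then show "0 \<le> ?G z i j s - ?G w i j s" using H_mono[OF \<omega>] by simp
      qed
    qed auto
    finally show ?thesis by (simp add: I D_at_def algebra_simps)
  qed
  then have "(\<Sum>i\<in>UNIV. \<theta> * (z t $ i - w t $ i)) \<le> (\<Sum>i\<in>UNIV. (D_at z t i - D_at w t i) +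
      (\<Sum>j\<in>UNIV. integral {t - \<rho> i j..t} (?G z i j) - integral {t - \<rho> i j..t} (?G w i j)))"
    by (intro sum_mono)
  also have "\<dots> = mass \<omega> z t - mass \<omega> w t" by (simp add: mass_def sum.distrib sum_subtractf)
  finally show ?thesis unfolding sum_distrib_left .
qed

text \<open>A uniform error \<open>e\<close> changes each value of D by at most
  \<open>2 * e\<close>, as \<gamma> i < 1, and each pipe by at most \<open>r * lp i j * e\<close>,
  as no pipe is longer than \<open>r\<close>.\<close>

definition mass_const :: real where
  "mass_const = 2 * real CARD('m) + (\<Sum>i\<in>UNIV. \<Sum>j\<in>UNIV. r * lp i j)"

lemma mass_const_pos: "0 < mass_const"
proof -
  have "0 \<le> (\<Sum>i\<in>UNIV. \<Sum>j\<in>UNIV. r * lp i j)"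
    using r_pos lp by (intro sum_nonneg) simp
  then show ?thesis by (simp add: mass_const_def add_pos_nonneg)
qed

lemma mass_upper:
  assumes \<omega>: "\<omega> \<in> H" and z: "continuous_on UNIV z" and w: "continuous_on UNIV w"
    and e: "\<And>s j. t - r \<le> s \<Longrightarrow> s \<le> t \<Longrightarrow> \<bar>z s $ j - w s $ j\<bar> \<le> e"
  shows "\<bar>mass \<omega> z t - mass \<omega> w t\<bar> \<le> mass_const * e"
proof -
  let ?G = "\<lambda>z i j s. \<omega> (s, z s $ j) $ i $ j"
  have e0: "0 \<le> e" using e[of t undefined] r_pos abs_ge_zero order_trans by (metis diff_le_eq le_add_same_cancel1 less_imp_le order_refl)
  have D: "\<bar>D_at z t i - D_at w t i\<bar> \<le> 2 * e" for i
  proof -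
    have "\<gamma> i * \<bar>z (t - \<alpha> i) $ i - w (t - \<alpha> i) $ i\<bar> \<le> 1 * e"
      using gam[of i] alp[of i] by (intro mult_mono e) auto
    then have "\<bar>\<gamma> i * z (t - \<alpha> i) $ i - \<gamma> i * w (t - \<alpha> i) $ i\<bar> \<le> e"
      using gam[of i] by (simp add: right_diff_distrib[symmetric] abs_mult)
    then show ?thesis using e[of t i] r_pos unfolding D_at_def by linarith
  qed
  have I: "\<bar>integral {t - \<rho> i j..t} (?G z i j) - integral {t - \<rho> i j..t} (?G w i j)\<bar> \<le> r * lp i j * e" for i j
  proof -
    have "norm (integral {t - \<rho> i j..t} (\<lambda>s. ?G z i j s - ?G w i j s)) \<le> integral {t - \<rho> i j..t} (\<lambda>s. lp i j * e)"
    proof (rule integral_norm_bound_integral)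
      show "(\<lambda>s. ?G z i j s - ?G w i j s) integrable_on {t - \<rho> i j..t}"
        by (intro integrable_diff entry_integrable \<omega> z w)
      fix s assume "s \<in> {t - \<rho> i j..t}"
      then have "\<bar>z s $ j - w s $ j\<bar> \<le> e" using rho[of i j] by (intro e) auto
      then have "lp i j * \<bar>z s $ j - w s $ j\<bar> \<le> lp i j * e" using lp by (intro mult_left_mono)
      then show "norm (?G z i j s - ?G w i j s) \<le> lp i j * e"
        using H_lipschitz[OF \<omega>, of s "z s $ j" i j "w s $ j"] by simp
    qed auto
    also have "\<dots> = \<rho> i j * (lp i j * e)" using rho by simp
    also have "\<dots> \<le> r * (lp i j * e)" using rho lp e0 by (intro mult_right_mono) auto
    finally show ?thesis
      by (simp add: integral_diff entry_integrable[OF \<omega> z] entry_integrable[OF \<omega> w] mult.assoc)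
  qed
  have "mass \<omega> z t - mass \<omega> w t = (\<Sum>i\<in>UNIV. D_at z t i - D_at w t i) +
      (\<Sum>i\<in>UNIV. \<Sum>j\<in>UNIV. integral {t - \<rho> i j..t} (?G z i j) - integral {t - \<rho> i j..t} (?G w i j))"
    by (simp add: mass_def sum_subtractf)
  moreover have "\<bar>\<Sum>i\<in>UNIV. D_at z t i - D_at w t i\<bar> \<le> (\<Sum>i\<in>(UNIV :: 'm set). 2 * e)"
    by (rule order_trans[OF sum_abs sum_mono]) (rule D)
  moreover have "\<bar>\<Sum>i\<in>UNIV. \<Sum>j\<in>UNIV. integral {t - \<rho> i j..t} (?G z i j) - integral {t - \<rho> i j..t} (?G w i j)\<bar>
      \<le> (\<Sum>i\<in>UNIV. \<Sum>j\<in>UNIV. r * lp i j * e)"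
    by (rule order_trans[OF sum_abs sum_mono], rule order_trans[OF sum_abs sum_mono]) (rule I)
  ultimately show ?thesis
    by (simp add: mass_const_def distrib_right sum_distrib_right)
qed

text \<open>The solution \<open>p\<close> with history \<open>w + k\<close> dominates both
  \<open>w\<close> and \<open>z\<close> for all later times. The cone bounds \<open>p - w\<close> by
  its mass, which is conserved and was at most \<open>mass_const * k\<close> at the start.\<close>

lemma upper_bound_stable:
  assumes \<omega>: "\<omega> \<in> H" and z: "solves \<omega> t0 z" and w: "solves \<omega> t0 w" and k: "0 \<le> k"
    and c: "cone t0 (\<lambda>s. w s + vec k - z s)" and t: "t0 \<le> t"
  shows "z t $ i - w t $ i \<le> mass_const / \<theta> * k"
proof -
  have "continuous_on UNIV (\<lambda>s. w s + vec k)" by (intro continuous_intros solves_cont[OF w])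
  then obtain p where p: "solves \<omega> t0 p" "\<And>s. s \<le> t0 \<Longrightarrow> p s = w s + vec k"
    using solves_exists[OF \<omega>] by meson
  have pw0: "cone t0 (\<lambda>s. p s - w s)"
    by (rule cone_cong[OF cone_const[of "vec k"]]) (use k p in auto)
  have pz0: "cone t0 (\<lambda>s. p s - z s)"
    by (rule cone_cong[OF c]) (use p in auto)
  have pw: "cone t (\<lambda>s. p s - w s)" by (rule cone_invariant[OF \<omega> p(1) w pw0 t])
  have pz: "cone t (\<lambda>s. p s - z s)" by (rule cone_invariant[OF \<omega> p(1) z pz0 t])
  have "\<theta> * (p t $ i - w t $ i) \<le> \<theta> * (\<Sum>i\<in>UNIV. p t $ i - w t $ i)"
    using theta_pos cone_nonneg[OF pw, of t] r_pos by (intro mult_left_mono member_le_sum) auto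
  also have "\<dots> \<le> mass \<omega> p t - mass \<omega> w t" by (rule mass_lower[OF \<omega> solves_cont[OF p(1)] solves_cont[OF w] pw])
  also have "\<dots> = mass \<omega> p t0 - mass \<omega> w t0" using mass_constant[OF \<omega> p(1) t] mass_constant[OF \<omega> w t] by simp
  also have "\<dots> \<le> \<bar>mass \<omega> p t0 - mass \<omega> w t0\<bar>" by simp
  also have "\<dots> \<le> mass_const * k"
    by (rule mass_upper[OF \<omega> solves_cont[OF p(1)] solves_cont[OF w]]) (use k p in auto)
  finally have "p t $ i - w t $ i \<le> mass_const / \<theta> * k" using theta_pos by (simp add: field_simps)
  moreover have "z t $ i \<le> p t $ i" using cone_nonneg[OF pz, of t i] r_pos by simp
  ultimately show ?thesis by simp
qed

text \<open>Serves all components at once in \<open>exp_mono_const_minus\<close>: a constant of at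
  least \<open>cone_unit * (e + \<Lambda>)\<close> dominates, in the cone, every function bounded
  above by \<open>e\<close> with growth rate at most \<Lambda>.\<close>

definition cone_unit :: real where
  "cone_unit = 1 + (\<Sum>i\<in>UNIV. exp (\<beta> i * r) / \<beta> i)"

definition stab_const :: real where
  "stab_const = mass_const / \<theta> * cone_unit"

lemma cone_unit_ge: "1 \<le> cone_unit" "exp (\<beta> i * r) / \<beta> i \<le> cone_unit"
proof -
  have *: "0 \<le> exp (\<beta> i * r) / \<beta> i" for i using bet[of i] by simp
  then have "0 \<le> (\<Sum>i\<in>UNIV. exp (\<beta> i * r) / \<beta> i)" by (rule sum_nonneg)
  then show "1 \<le> cone_unit" by (simp add: cone_unit_def)
  have "exp (\<beta> i * r) / \<beta> i \<le> (\<Sum>i\<in>UNIV. exp (\<beta> i * r) / \<beta> i)" using * by (intro member_le_sum) auto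
  then show "exp (\<beta> i * r) / \<beta> i \<le> cone_unit" by (simp add: cone_unit_def)
qed

lemma stab_const_pos: "0 < stab_const"
  using mass_const_pos theta_pos cone_unit_ge(1) by (simp add: stab_const_def)

lemma cone_const_minus:
  assumes "\<And>s i. t - r \<le> s \<Longrightarrow> s \<le> t \<Longrightarrow> y s $ i \<le> e" "0 \<le> e" "0 \<le> \<Lambda>"
    "\<And>s s' i. t - r \<le> s \<Longrightarrow> s \<le> s' \<Longrightarrow> s' \<le> t \<Longrightarrow> y s' $ i - y s $ i \<le> \<Lambda> * (s' - s)"
    and k: "cone_unit * (e + \<Lambda>) \<le> k"
  shows "cone t (\<lambda>s. vec k - y s)"
  unfolding cone_def
proof
  fix i
  have "exp_mono (\<beta> i) (t - r) t (\<lambda>s. k - y s $ i)"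
  proof (rule exp_mono_const_minus[where e = e and \<Lambda> = \<Lambda> and r = r])
    have "e \<le> cone_unit * e" using cone_unit_ge(1) assms by (simp add: mult_le_cancel_right1)
    moreover have "\<Lambda> * (exp (\<beta> i * r) / \<beta> i) \<le> \<Lambda> * cone_unit"
      using cone_unit_ge(2) assms by (intro mult_left_mono)
    ultimately show "e + \<Lambda> * exp (\<beta> i * r) / \<beta> i \<le> k" using k by (simp add: algebra_simps)
  qed (use assms bet r_pos in auto)
  then show "exp_mono (\<beta> i) (t - r) t (\<lambda>s. (vec k - y s) $ i)" by simp
qed

text \<open>The order-unit norm of the cone controls derivatives, hence the Lipschitz hypothesis on the
  initial difference; in return there is no loss as \<open>t \<longrightarrow> \<infinity>\<close>.\<close>

lemma stability:
  assumes \<omega>: "\<omega> \<in> H" and z: "solves \<omega> t0 z" and w: "solves \<omega> t0 w" and e: "0 \<le> e" and L: "0 \<le> \<Lambda>"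
    and small: "\<And>s i. t0 - r \<le> s \<Longrightarrow> s \<le> t0 \<Longrightarrow> \<bar>z s $ i - w s $ i\<bar> \<le> e"
    and lip: "\<And>s s' i. t0 - r \<le> s \<Longrightarrow> s \<le> s' \<Longrightarrow> s' \<le> t0 \<Longrightarrow>
      \<bar>(z s' $ i - w s' $ i) - (z s $ i - w s $ i)\<bar> \<le> \<Lambda> * (s' - s)"
    and t: "t0 \<le> t"
  shows "\<bar>z t $ i - w t $ i\<bar> \<le> stab_const * (e + \<Lambda>)"
proof -
  define k where "k = cone_unit * (e + \<Lambda>)"
  have k: "0 \<le> k" using cone_unit_ge(1) e L by (simp add: k_def)
  have small': "(z s - w s) $ i \<le> e" "(w s - z s) $ i \<le> e" if "t0 - r \<le> s" "s \<le> t0" for s i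
    using small[OF that, of i] by (simp_all add: abs_le_iff)
  have lip': "(z s' - w s') $ i - (z s - w s) $ i \<le> \<Lambda> * (s' - s)"
    "(w s' - z s') $ i - (w s - z s) $ i \<le> \<Lambda> * (s' - s)"
    if "t0 - r \<le> s" "s \<le> s'" "s' \<le> t0" for s s' i
    using lip[OF that, of i] by (simp_all add: abs_le_iff)
  have "cone t0 (\<lambda>s. vec k - (z s - w s))"
    by (rule cone_const_minus[OF small'(1) e L lip'(1)]) (auto simp: k_def)
  then have "cone t0 (\<lambda>s. w s + vec k - z s)" by (simp add: algebra_simps)
  then have 1: "z t $ i - w t $ i \<le> mass_const / \<theta> * k" by (rule upper_bound_stable[OF \<omega> z w k _ t])
  have "cone t0 (\<lambda>s. vec k - (w s - z s))"
    by (rule cone_const_minus[OF small'(2) e L lip'(2)]) (auto simp: k_def)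
  then have "cone t0 (\<lambda>s. z s + vec k - w s)" by (simp add: algebra_simps)
  then have 2: "w t $ i - z t $ i \<le> mass_const / \<theta> * k" by (rule upper_bound_stable[OF \<omega> w z k _ t])
  have "mass_const / \<theta> * k = stab_const * (e + \<Lambda>)" by (simp add: stab_const_def k_def)
  then show ?thesis using 1 2 by (simp add: abs_le_iff)
qed

end

section \<open>Compactness\<close>

definition bounded_by :: "real \<Rightarrow> (real \<Rightarrow> real ^ 'm) \<Rightarrow> bool" where
  "bounded_by B z \<longleftrightarrow> (\<forall>t i. \<bar>z t $ i\<bar> \<le> B)"

definition lip_by :: "real \<Rightarrow> (real \<Rightarrow> real ^ 'm) \<Rightarrow> bool" where
  "lip_by \<Lambda> z \<longleftrightarrow> (\<forall>s s' i. s \<le> s' \<longrightarrow> \<bar>z s' $ i - z s $ i\<bar> \<le> \<Lambda> * (s' - s))"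

lemma lip_by_norm:
  fixes z :: "real \<Rightarrow> real ^ 'm::finite"
  assumes "lip_by \<Lambda> z"
  shows "norm (z s - z s') \<le> real CARD('m) * (\<Lambda> * \<bar>s - s'\<bar>)"
proof (rule norm_vec_le_card)
  fix i
  have *: "\<bar>z b $ i - z a $ i\<bar> \<le> \<Lambda> * (b - a)" if "a \<le> b" for a b
    using assms that by (simp add: lip_by_def)
  show "\<bar>(z s - z s') $ i\<bar> \<le> \<Lambda> * \<bar>s - s'\<bar>"
  proof (cases "s \<le> s'")
    case True
    then show ?thesis using *[OF True] by (simp add: abs_minus_commute)
  next
    case False
    then show ?thesis using *[of s' s] by simp
  qed
qed

lemma lip_by_nonneg: "lip_by \<Lambda> z \<Longrightarrow> 0 \<le> \<Lambda>"
  unfolding lip_by_def by (metis abs_ge_zero diff_zero le_numeral_extra(1) less_imp_le mult.right_neutral order_trans zero_less_one_class.zero_le_one)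

lemma lip_by_cont:
  fixes z :: "real \<Rightarrow> real ^ 'm::finite"
  assumes "lip_by \<Lambda> z"
  shows "continuous_on S z"
proof -
  have "(real CARD('m) * \<Lambda>)-lipschitz_on S z"
    using lip_by_norm[OF assms] lip_by_nonneg[OF assms] by (intro lipschitz_onI) (auto simp: dist_norm mult.assoc)
  then show ?thesis by (rule lipschitz_on_continuous_on)
qed

lemma bounded_by_limit:
  assumes "\<And>n. bounded_by B (z n)" "\<And>t. (\<lambda>n. z n t) \<longlonglongrightarrow> l t"
  shows "bounded_by B l"
  unfolding bounded_by_def
proof (intro allI)
  fix t i
  show "\<bar>l t $ i\<bar> \<le> B"
    by (rule tendsto_upperbound[OF tendsto_rabs[OF tendsto_vec_nth[OF assms(2)]]])
      (use assms(1) in \<open>auto simp: bounded_by_def\<close>)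
qed

lemma lip_by_limit:
  assumes "\<And>n. lip_by \<Lambda> (z n)" "\<And>t. (\<lambda>n. z n t) \<longlonglongrightarrow> l t"
  shows "lip_by \<Lambda> l"
  unfolding lip_by_def
proof (intro allI impI)
  fix s s' :: real and i assume "s \<le> s'"
  show "\<bar>l s' $ i - l s $ i\<bar> \<le> \<Lambda> * (s' - s)"
    by (rule tendsto_upperbound[OF tendsto_rabs[OF tendsto_diff[OF tendsto_vec_nth[OF assms(2)] tendsto_vec_nth[OF assms(2)]]]])
      (use assms(1) \<open>s \<le> s'\<close> in \<open>auto simp: lip_by_def\<close>)
qed

lemma bounded_by_shift: "bounded_by B z \<Longrightarrow> bounded_by B (\<lambda>t. z (s + t))"
  by (simp add: bounded_by_def)

lemma lip_by_shift: "lip_by \<Lambda> z \<Longrightarrow> lip_by \<Lambda> (\<lambda>t. z (s + t))"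
  unfolding lip_by_def
proof (intro allI impI)
  fix a b :: real and i
  assume *: "\<forall>s s' i. s \<le> s' \<longrightarrow> \<bar>z s' $ i - z s $ i\<bar> \<le> \<Lambda> * (s' - s)" and "a \<le> b"
  then have "\<bar>z (s + b) $ i - z (s + a) $ i\<bar> \<le> \<Lambda> * ((s + b) - (s + a))" by (intro *[rule_format]) simp
  then show "\<bar>z (s + b) $ i - z (s + a) $ i\<bar> \<le> \<Lambda> * (b - a)" by simp
qed

lemma lip_by_mono: "lip_by \<Lambda> z \<Longrightarrow> \<Lambda> \<le> \<Lambda>' \<Longrightarrow> lip_by \<Lambda>' z"
  unfolding lip_by_def by (meson diff_ge_0_iff_ge mult_right_mono order_trans)

lemma trajectory_compact:
  fixes z :: "nat \<Rightarrow> real \<Rightarrow> real ^ 'm::finite"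
  assumes "\<And>n. bounded_by B (z n)" "\<And>n. lip_by \<Lambda> (z n)"
  obtains l \<sigma> where "strict_mono (\<sigma> :: nat \<Rightarrow> nat)" "ucc_lim (\<lambda>n. z (\<sigma> n)) l"
proof (rule ucc_Arzela_Ascoli)
  fix R :: real
  have "norm (z n x) \<le> real CARD('m) * B" for n x
    using assms(1)[of n] by (intro norm_vec_le_card) (simp add: bounded_by_def)
  then show "\<exists>M. \<forall>n. \<forall>x\<in>cball 0 R. norm (z n x) \<le> M" by blast
next
  fix x e :: real assume e: "0 < e"
  have \<Lambda>: "0 \<le> \<Lambda>" using lip_by_nonneg[OF assms(2)[of 0]] .
  define C where "C = real CARD('m) * \<Lambda> + 1"
  have C: "0 < C" using \<Lambda> by (simp add: C_def add_nonneg_pos)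
  have "dist (z n y) (z n x) < e" if "dist y x < e / C" for n y
  proof -
    have "dist (z n y) (z n x) \<le> real CARD('m) * \<Lambda> * dist y x"
      using lip_by_norm[OF assms(2), of n y x] by (simp add: dist_norm mult.assoc)
    also have "\<dots> \<le> C * dist y x" by (intro mult_right_mono) (auto simp: C_def)
    also have "\<dots> < e" using that C by (simp add: field_simps)
    finally show ?thesis .
  qed
  then show "\<exists>d>0. \<forall>n y. dist y x < d \<longrightarrow> dist (z n y) (z n x) < e"
    using e C by (intro exI[of _ "e / C"]) auto
qed (rule that)

lemma uniform_limit_sum':
  fixes f :: "'a \<Rightarrow> nat \<Rightarrow> 'b \<Rightarrow> real"
  assumes "finite A" "\<And>a. a \<in> A \<Longrightarrow> uniform_limit X (f a) (l a) sequentially"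
  shows "uniform_limit X (\<lambda>n x. \<Sum>a\<in>A. f a n x) (\<lambda>x. \<Sum>a\<in>A. l a x) sequentially"
  using assms by (induction A) (auto intro!: uniform_limit_intros)

lemma integral_uniform_tendsto:
  fixes f :: "nat \<Rightarrow> real \<Rightarrow> real"
  assumes "uniform_limit {a..b} f l sequentially" "\<And>n. continuous_on {a..b} (f n)"
  shows "(\<lambda>n. integral {a..b} (f n)) \<longlonglongrightarrow> integral {a..b} l"
proof -
  obtain I J where I: "\<And>n. (f n has_integral I n) {a..b}" and J: "(l has_integral J) {a..b}" and "I \<longlonglongrightarrow> J"
    using uniform_limit_integral[OF assms] by auto
  then show ?thesis by (simp add: integral_unique[OF I] integral_unique[OF J])
qed

lemma ucc_translate:
  assumes "ucc_lim f \<omega>"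
  shows "ucc_lim (\<lambda>n. translate (f n) s) (translate \<omega> s)"
  unfolding limitin_ucc_topology uniform_limit_iff
proof (intro allI impI)
  fix K :: "(real \<times> real) set" and e :: real assume K: "compact K" and e: "0 < e"
  have "compact ((\<lambda>x. (s, 0) + x) ` K)" by (intro compact_translation K)
  from ucc_limD[OF assms this e]
  show "\<forall>\<^sub>F n in sequentially. \<forall>x\<in>K. dist (translate (f n) s x) (translate \<omega> s x) < e"
    by eventually_elim (auto simp: translate_def)
qed

context compartmental
begin

text \<open>Both the coefficient and the state vary with \<open>n\<close>. The common bound
  \<open>B\<close> confines the states to a compact interval, where \<open>f n\<close> is uniformly
  close to \<omega>, and the Lipschitz bound in \<open>v\<close> handles the change of
  state.\<close>

lemma entry_uniform_limit:
  assumes f: "\<And>n. f n \<in> H" "ucc_lim f \<omega>" and z: "ucc_lim z l" "\<And>n. bounded_by B (z n)"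
  shows "uniform_limit {a..b} (\<lambda>n s. f n (s + c, z n (s + c) $ k) $ i $ j) (\<lambda>s. \<omega> (s + c, l (s + c) $ k) $ i $ j) sequentially"
proof -
  have \<omega>: "\<omega> \<in> H" using H_closed f by blast
  have "uniform_limit {a + c..b + c} (\<lambda>n s. f n (s, z n s $ k) $ i $ j) (\<lambda>s. \<omega> (s, l s $ k) $ i $ j) sequentially"
  proof (rule uniform_limitI)
    fix e :: real assume e: "0 < e"
    \<comment> \<open>The added 1 covers the case \<open>lp i j = 0\<close>.\<close>
    define d where "d = e / (2 * (lp i j + 1))"
    have d: "0 < d" using e lp[of i j] by (simp add: d_def)
    have "lp i j * d \<le> (lp i j + 1) * d" using d by (intro mult_right_mono) auto
    also have "\<dots> = e / 2" using lp[of i j] by (simp add: d_def field_simps)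
    finally have ld: "lp i j * d \<le> e / 2" .
    have "\<forall>\<^sub>F n in sequentially. \<forall>x\<in>{a + c..b + c} \<times> {- B..B}. dist (f n x) (\<omega> x) < e / 2"
      using e by (intro ucc_limD[OF f(2)] compact_Times) auto
    moreover have "\<forall>\<^sub>F n in sequentially. \<forall>s\<in>{a + c..b + c}. dist (z n s) (l s) < d"
      using d by (intro ucc_limD[OF z(1)]) auto
    ultimately show "\<forall>\<^sub>F n in sequentially. \<forall>s\<in>{a + c..b + c}. dist (f n (s, z n s $ k) $ i $ j) (\<omega> (s, l s $ k) $ i $ j) < e"
    proof eventually_elim
      case (elim n)
      show ?case
      proof
        fix s assume s: "s \<in> {a + c..b + c}"
        have "z n s $ k \<in> {- B..B}" using z(2)[of n] by (auto simp: bounded_by_def abs_le_iff minus_le_iff)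
        then have "dist (f n (s, z n s $ k)) (\<omega> (s, z n s $ k)) < e / 2" using elim(1) s by blast
        then have 1: "\<bar>f n (s, z n s $ k) $ i $ j - \<omega> (s, z n s $ k) $ i $ j\<bar> < e / 2"
          using dist_vec_nth_le[of "f n (s, z n s $ k)" i "\<omega> (s, z n s $ k)"]
            dist_vec_nth_le[of "f n (s, z n s $ k) $ i" j "\<omega> (s, z n s $ k) $ i"] by (simp add: dist_real_def)
        have "\<bar>z n s $ k - l s $ k\<bar> \<le> d"
          using elim(2) s dist_vec_nth_le[of "z n s" k "l s"] by (force simp: dist_real_def)
        then have "lp i j * \<bar>z n s $ k - l s $ k\<bar> \<le> lp i j * d" using lp by (intro mult_left_mono)
        then have "\<bar>\<omega> (s, z n s $ k) $ i $ j - \<omega> (s, l s $ k) $ i $ j\<bar> \<le> e / 2"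
          using H_lipschitz[OF \<omega>, of s "z n s $ k" i j "l s $ k"] ld by linarith
        then show "dist (f n (s, z n s $ k) $ i $ j) (\<omega> (s, l s $ k) $ i $ j) < e"
          using 1 unfolding dist_real_def by linarith
      qed
    qed
  qed
  then show ?thesis
    by (rule uniform_limit_compose'[where h = "\<lambda>s. s + c"]) auto
qed

lemma D_at_tendsto:
  assumes "ucc_lim z l"
  shows "(\<lambda>n. D_at (z n) t i) \<longlonglongrightarrow> D_at l t i"
  unfolding D_at_def by (intro tendsto_intros tendsto_vec_nth ucc_lim_pointwise[OF assms])

lemma solves_limit:
  assumes f: "\<And>n. f n \<in> H" "ucc_lim f \<omega>" and z: "ucc_lim z l" "\<And>n. bounded_by B (z n)" "\<And>n. lip_by \<Lambda> (z n)"
    and s: "\<forall>\<^sub>F n in sequentially. solves (f n) t0 (z n)"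
  shows "solves \<omega> t0 l"
proof (rule solvesI_integral)
  show \<omega>: "\<omega> \<in> H" using H_closed f by blast
  show "continuous_on UNIV l"
    by (rule lip_by_cont[OF lip_by_limit[OF z(3) ucc_lim_pointwise[OF z(1)]]])
  fix t i assume t: "t0 \<le> t"
  have "uniform_limit {t0..t} (\<lambda>n s. rhs (f n) (z n) s i) (\<lambda>s. rhs \<omega> l s i) sequentially"
    unfolding rhs_def
    using entry_uniform_limit[OF f z(1,2), where c = 0] entry_uniform_limit[OF f z(1,2), where c = "- \<rho> i j" for j]
    by (intro uniform_limit_add uniform_limit_uminus uniform_limit_sum') auto
  then have "(\<lambda>n. integral {t0..t} (\<lambda>s. rhs (f n) (z n) s i)) \<longlonglongrightarrow> integral {t0..t} (\<lambda>s. rhs \<omega> l s i)"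
    by (rule integral_uniform_tendsto) (intro rhs_cont f lip_by_cont[OF z(3)])
  then have "(\<lambda>n. D_at (z n) t0 i + integral {t0..t} (\<lambda>s. rhs (f n) (z n) s i)) \<longlonglongrightarrow> D_at l t0 i + integral {t0..t} (\<lambda>s. rhs \<omega> l s i)"
    by (intro tendsto_add D_at_tendsto z)
  moreover have "\<forall>\<^sub>F n in sequentially. D_at (z n) t i = D_at (z n) t0 i + integral {t0..t} (\<lambda>s. rhs (f n) (z n) s i)"
    using s by eventually_elim (use solves_integral[OF _ order_refl t, of _ _ i] in \<open>auto simp: algebra_simps\<close>)
  then have "(\<lambda>n. D_at (z n) t0 i + integral {t0..t} (\<lambda>s. rhs (f n) (z n) s i)) \<longlonglongrightarrow> D_at l t i"
    by (rule Lim_transform_eventually[OF D_at_tendsto[OF z(1)]])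
  ultimately show "D_at l t i = D_at l t0 i + integral {t0..t} (\<lambda>s. rhs \<omega> l s i)"
    using LIMSEQ_unique by blast
qed

lemma mass_limit:
  assumes f: "\<And>n. f n \<in> H" "ucc_lim f \<omega>" and z: "ucc_lim z l" "\<And>n. bounded_by B (z n)" "\<And>n. lip_by \<Lambda> (z n)"
  shows "(\<lambda>n. mass (f n) (z n) t) \<longlonglongrightarrow> mass \<omega> l t"
  unfolding mass_def
proof (intro tendsto_add tendsto_sum D_at_tendsto z(1))
  fix i j
  show "(\<lambda>n. integral {t - \<rho> i j..t} (\<lambda>s. f n (s, z n s $ j) $ i $ j)) \<longlonglongrightarrow>
      integral {t - \<rho> i j..t} (\<lambda>s. \<omega> (s, l s $ j) $ i $ j)"
    using entry_uniform_limit[OF f z(1,2), where c = 0]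
    by (intro integral_uniform_tendsto entry_cont_at f lip_by_cont[OF z(3)]) auto
qed

section \<open>Lipschitz bounds for bounded solutions\<close>

definition gmax :: real where "gmax = Max (range \<gamma>)"

lemma gmax: "\<gamma> i \<le> gmax" "0 \<le> gmax" "gmax < 1"
proof -
  show *: "\<gamma> i \<le> gmax" for i unfolding gmax_def by (intro Max_ge) auto
  show "0 \<le> gmax" using *[of undefined] gam(1)[of undefined] by linarith
  have "gmax \<in> range \<gamma>" unfolding gmax_def by (intro Max_in) auto
  then show "gmax < 1" using gam(2) by auto
qed

text \<open>The difference operator is stable: taking suprema over all of the real line turns a Lipschitz bound
  for \<open>D_at z\<close> into one for \<open>z\<close>.\<close>

lemma neutral_lipschitz:
  assumes B: "bounded_by B z" and K: "\<And>s s' i. s \<le> s' \<Longrightarrow> \<bar>D_at z s' i - D_at z s i\<bar> \<le> K * (s' - s)"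
  shows "lip_by (K / (1 - gmax)) z"
  unfolding lip_by_def
proof (intro allI impI)
  fix s s' :: real and i assume s: "s \<le> s'"
  define h where "h = s' - s"
  define S where "S = (SUP u. \<bar>z (u + h) $ i - z u $ i\<bar>)"
  have "\<bar>z (u + h) $ i - z u $ i\<bar> \<le> 2 * B" for u
  proof -
    have "\<bar>z (u + h) $ i\<bar> \<le> B" "\<bar>z u $ i\<bar> \<le> B" using B by (auto simp: bounded_by_def)
    then show ?thesis by linarith
  qed
  then have bdd: "bdd_above (range (\<lambda>u. \<bar>z (u + h) $ i - z u $ i\<bar>))" by (intro bdd_aboveI) auto
  have S: "\<bar>z (u + h) $ i - z u $ i\<bar> \<le> S" for u unfolding S_def by (rule cSUP_upper[OF UNIV_I bdd])
  have S0: "0 \<le> S" using S[of 0] abs_ge_zero order_trans by blast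
  have "S \<le> K * h + gmax * S"
    unfolding S_def
  proof (rule cSUP_least)
    fix u
    have "\<gamma> i * \<bar>z (u - \<alpha> i + h) $ i - z (u - \<alpha> i) $ i\<bar> \<le> gmax * S"
      using gmax S by (intro mult_mono) auto
    moreover have "u - \<alpha> i + h = u + h - \<alpha> i" by simp
    ultimately have "\<bar>\<gamma> i * z (u + h - \<alpha> i) $ i - \<gamma> i * z (u - \<alpha> i) $ i\<bar> \<le> gmax * S"
      using gam[of i] by (simp only: right_diff_distrib[symmetric] abs_mult abs_of_nonneg)
    moreover have "\<bar>D_at z (u + h) i - D_at z u i\<bar> \<le> K * h" using K[of u "u + h" i] s by (simp add: h_def)
    ultimately show "\<bar>z (u + h) $ i - z u $ i\<bar> \<le> K * h + gmax * (SUP u. \<bar>z (u + h) $ i - z u $ i\<bar>)"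
      unfolding D_at_def S_def by linarith
  qed simp
  then have "S \<le> K / (1 - gmax) * h" using gmax(3) by (simp add: field_simps)
  then show "\<bar>z s' $ i - z s $ i\<bar> \<le> K / (1 - gmax) * (s' - s)" using S[of s] by (simp add: h_def)
qed

text \<open>Before the start a Lipschitz constant \<Lambda> of the history gives
  \<open>2 * \<Lambda>\<close> for D, afterwards the equation gives \<open>rhs_lip * B\<close>;
  their sum covers intervals across the start, and \<open>neutral_lipschitz\<close> supplies the
  denominator.\<close>

definition lip_const :: "real \<Rightarrow> real \<Rightarrow> real" where
  "lip_const B \<Lambda> = (2 * \<Lambda> + rhs_lip * B) / (1 - gmax)"

lemma D_at_lipschitz_forward:
  assumes \<omega>: "\<omega> \<in> H" and z: "solves \<omega> t0 z" and B: "bounded_by B z" and s: "t0 \<le> s" "s \<le> s'"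
  shows "\<bar>D_at z s' i - D_at z s i\<bar> \<le> rhs_lip * B * (s' - s)"
proof -
  have "\<bar>D_at z s' i - D_at z s i\<bar> = norm (integral {s..s'} (\<lambda>\<tau>. rhs \<omega> z \<tau> i))"
    using solves_integral[OF z s, of i] by simp
  also have "\<dots> \<le> integral {s..s'} (\<lambda>_. rhs_lip * B)"
    using B by (intro integral_norm_bound_integral rhs_integrable \<omega> solves_cont[OF z])
      (auto intro!: rhs_bound[OF \<omega>] simp: bounded_by_def)
  also have "\<dots> = rhs_lip * B * (s' - s)" using s by simp
  finally show ?thesis .
qed

lemma solution_lipschitz:
  assumes \<omega>: "\<omega> \<in> H" and z: "solves \<omega> t0 z" and B: "bounded_by B z" and \<Lambda>: "0 \<le> \<Lambda>"
    and init: "\<And>s s' i. s \<le> s' \<Longrightarrow> s' \<le> t0 \<Longrightarrow> \<bar>z s' $ i - z s $ i\<bar> \<le> \<Lambda> * (s' - s)"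
  shows "lip_by (lip_const B \<Lambda>) z"
  unfolding lip_const_def
proof (rule neutral_lipschitz[OF B])
  have "0 \<le> B" using B abs_ge_zero order_trans unfolding bounded_by_def by blast
  then have B0: "0 \<le> rhs_lip * B" using rhs_lip_nonneg by simp
  have early: "\<bar>D_at z s' i - D_at z s i\<bar> \<le> 2 * \<Lambda> * (s' - s)" if s: "s \<le> s'" "s' \<le> t0" for s s' i
  proof -
    have "\<gamma> i * \<bar>z (s' - \<alpha> i) $ i - z (s - \<alpha> i) $ i\<bar> \<le> 1 * (\<Lambda> * (s' - s))"
      using gam[of i] init[of "s - \<alpha> i" "s' - \<alpha> i" i] s alp[of i] by (intro mult_mono) auto
    then have "\<bar>\<gamma> i * z (s' - \<alpha> i) $ i - \<gamma> i * z (s - \<alpha> i) $ i\<bar> \<le> \<Lambda> * (s' - s)"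
      using gam[of i] by (simp add: right_diff_distrib[symmetric] abs_mult)
    then show ?thesis using init[OF s, of i] unfolding D_at_def by linarith
  qed
  have late: "\<bar>D_at z s' i - D_at z s i\<bar> \<le> rhs_lip * B * (s' - s)" if "t0 \<le> s" "s \<le> s'" for s s' i
    by (rule D_at_lipschitz_forward[OF \<omega> z B that])
  fix s s' :: real and i assume s: "s \<le> s'"
  have 1: "2 * \<Lambda> * u \<le> (2 * \<Lambda> + rhs_lip * B) * u" "rhs_lip * B * u \<le> (2 * \<Lambda> + rhs_lip * B) * u" if "0 \<le> u" for u
    using that \<Lambda> B0 by (auto intro!: mult_right_mono)
  consider "s' \<le> t0" | "t0 \<le> s" | "s \<le> t0" "t0 \<le> s'" by linarith
  then show "\<bar>D_at z s' i - D_at z s i\<bar> \<le> (2 * \<Lambda> + rhs_lip * B) * (s' - s)"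
  proof cases
    case 1
    then show ?thesis using early[OF s, of i] \<open>\<And>u. 0 \<le> u \<Longrightarrow> 2 * \<Lambda> * u \<le> _\<close>[of "s' - s"] s by linarith
  next
    case 2
    then show ?thesis using late[OF _ s, of i] \<open>\<And>u. 0 \<le> u \<Longrightarrow> rhs_lip * B * u \<le> _\<close>[of "s' - s"] s by linarith
  next
    case 3
    have "\<bar>D_at z s' i - D_at z s i\<bar> \<le> (2 * \<Lambda> + rhs_lip * B) * (s' - t0) + (2 * \<Lambda> + rhs_lip * B) * (t0 - s)"
      using early[of s t0 i] late[of t0 s' i] 3 \<open>\<And>u. 0 \<le> u \<Longrightarrow> 2 * \<Lambda> * u \<le> _\<close>[of "t0 - s"]
        \<open>\<And>u. 0 \<le> u \<Longrightarrow> rhs_lip * B * u \<le> _\<close>[of "s' - t0"] by linarith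
    then show ?thesis by (simp add: distrib_left[symmetric])
  qed
qed

text \<open>An entire solution has no history of its own: any time can serve as the start, so the
  constant depends on \<open>B\<close> only.\<close>

lemma entire_lipschitz:
  assumes \<omega>: "\<omega> \<in> H" and z: "entire \<omega> z" and B: "bounded_by B z"
  shows "lip_by (lip_const B 0) z"
  unfolding lip_const_def
proof (rule neutral_lipschitz[OF B])
  fix s s' :: real and i assume s: "s \<le> s'"
  show "\<bar>D_at z s' i - D_at z s i\<bar> \<le> (2 * 0 + rhs_lip * B) * (s' - s)"
    using D_at_lipschitz_forward[OF \<omega> _ B order_refl s, of i] z by (simp add: entire_def)
qed

text \<open>The starting times tend to -infinity, so each fixed \<open>t0\<close> is eventually
  admissible and the limit solves the equation from every \<open>t0\<close>.\<close>

lemma extract_entire: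
  assumes f: "\<And>n. f n \<in> H" and z: "\<And>n. bounded_by B (z n)" "\<And>n. lip_by \<Lambda> (z n)"
    and s: "\<And>t0. \<forall>\<^sub>F n in sequentially. solves (f n) t0 (z n)"
  obtains \<sigma> \<omega> l where "strict_mono (\<sigma> :: nat \<Rightarrow> nat)" "ucc_lim (\<lambda>n. f (\<sigma> n)) \<omega>" "ucc_lim (\<lambda>n. z (\<sigma> n)) l"
    "\<omega> \<in> H" "entire \<omega> l" "bounded_by B l"
proof -
  obtain \<omega> and \<sigma> :: "nat \<Rightarrow> nat" where \<sigma>: "\<omega> \<in> H" "strict_mono \<sigma>" "ucc_lim (\<lambda>n. f (\<sigma> n)) \<omega>"
    using H_compact[of f] f by blast
  obtain l \<tau> where \<tau>: "strict_mono (\<tau> :: nat \<Rightarrow> nat)" "ucc_lim (\<lambda>n. z (\<sigma> (\<tau> n))) l"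
    by (rule trajectory_compact[of B "\<lambda>n. z (\<sigma> n)" \<Lambda>]) (use z in auto)
  have sm: "strict_mono (\<lambda>n. \<sigma> (\<tau> n))" using strict_mono_o[OF \<sigma>(2) \<tau>(1)] by (simp add: o_def)
  have lim: "ucc_lim (\<lambda>n. f (\<sigma> (\<tau> n))) \<omega>" by (rule ucc_lim_subseq[OF \<sigma>(3) \<tau>(1)])
  have "solves \<omega> t0 l" for t0
  proof (rule solves_limit[OF _ lim \<tau>(2)])
    have "filterlim (\<lambda>n. \<sigma> (\<tau> n)) sequentially sequentially" by (rule filterlim_subseq[OF sm])
    then show "\<forall>\<^sub>F n in sequentially. solves (f (\<sigma> (\<tau> n))) t0 (z (\<sigma> (\<tau> n)))"
      using s[of t0] unfolding filterlim_iff by blast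
  qed (rule f z)+
  moreover have "bounded_by B l" by (rule bounded_by_limit[OF _ ucc_lim_pointwise[OF \<tau>(2)]]) (rule z)
  ultimately show ?thesis using that[OF sm lim \<tau>(2) \<sigma>(1)] by (simp add: entire_def)
qed

section \<open>Backward recurrence of the hull\<close>

text \<open>The set \<open>S\<close> of points approximated by the orbit of \<omega> at arbitrarily
  negative times is nonempty by compactness, closed and invariant, hence all of \<open>H\<close> by
  minimality.\<close>

lemma alpha_limit:
  assumes \<omega>: "\<omega> \<in> H" and \<omega>': "\<omega>' \<in> H"
  obtains \<tau> where "\<And>n. \<tau> n \<le> - real n" "ucc_lim (\<lambda>n. translate \<omega> (\<tau> n)) \<omega>'"
proof -
  define S where "S = {\<omega>'\<in>H. \<forall>R e T. 0 < e \<longrightarrow> (\<exists>t\<le>T. \<forall>x\<in>cball 0 R. dist (translate \<omega> t x) (\<omega>' x) < e)}"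
  have "S = H"
  proof (rule H_minimal)
    show "S \<subseteq> H" by (auto simp: S_def)
    obtain \<omega>1 and \<sigma> :: "nat \<Rightarrow> nat" where \<sigma>: "\<omega>1 \<in> H" "strict_mono \<sigma>" "ucc_lim (\<lambda>n. translate \<omega> (- real (\<sigma> n))) \<omega>1"
      using H_compact[of "\<lambda>n. translate \<omega> (- real n)"] H_translate[OF \<omega>] by blast
    have "\<exists>t\<le>T. \<forall>x\<in>cball 0 R. dist (translate \<omega> t x) (\<omega>1 x) < e" if e: "0 < e" for R e T
    proof -
      obtain N where N: "- T \<le> real N" using real_arch_simple by blast
      have "\<forall>\<^sub>F n in sequentially. n \<ge> N \<and> (\<forall>x\<in>cball 0 R. dist (translate \<omega> (- real (\<sigma> n)) x) (\<omega>1 x) < e)"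
        by (intro eventually_conj eventually_ge_at_top ucc_limD[OF \<sigma>(3) compact_cball e])
      then obtain n where n: "n \<ge> N" "\<forall>x\<in>cball 0 R. dist (translate \<omega> (- real (\<sigma> n)) x) (\<omega>1 x) < e"
        using eventually_happens'[OF sequentially_bot] by blast
      have "N \<le> \<sigma> n" using n(1) seq_suble[OF \<sigma>(2), of n] by linarith
      then have "- real (\<sigma> n) \<le> T" using N by linarith
      then show ?thesis using n(2) by blast
    qed
    then show "S \<noteq> {}" using \<sigma>(1) by (auto simp: S_def)
  next
    fix \<omega>1 s assume w: "\<omega>1 \<in> S"
    have "\<exists>t\<le>T. \<forall>x\<in>cball 0 R. dist (translate \<omega> t x) (translate \<omega>1 s x) < e" if e: "0 < e" for R e T
    proof -
      obtain t where t: "t \<le> T - s" "\<forall>x\<in>cball 0 (R + \<bar>s\<bar>). dist (translate \<omega> t x) (\<omega>1 x) < e"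
        using w e unfolding S_def by blast
      have "dist (translate \<omega> (t + s) x) (translate \<omega>1 s x) < e" if x: "x \<in> cball 0 R" for x
      proof -
        have "norm ((s, 0::real) + x) \<le> \<bar>s\<bar> + R"
          using norm_triangle_ineq[of "(s, 0::real)" x] x by (simp add: norm_Pair)
        then have "dist (translate \<omega> t ((s, 0) + x)) (\<omega>1 ((s, 0) + x)) < e" using t(2) by (auto simp: add.commute)
        then show ?thesis by (cases x) (simp add: add.assoc)
      qed
      then show ?thesis using t(1) by (intro exI[of _ "t + s"]) auto
    qed
    then show "translate \<omega>1 s \<in> S" using w H_translate unfolding S_def by blast
  next
    fix f \<omega>1 assume f: "\<And>n. f n \<in> S" "ucc_lim f \<omega>1"
    have "\<exists>t\<le>T. \<forall>x\<in>cball 0 R. dist (translate \<omega> t x) (\<omega>1 x) < e" if e: "0 < e" for R e T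
    proof -
      have "\<forall>\<^sub>F n in sequentially. \<forall>x\<in>cball 0 R. dist (f n x) (\<omega>1 x) < e / 2"
        using e by (intro ucc_limD[OF f(2) compact_cball]) simp
      then obtain n where n: "\<forall>x\<in>cball 0 R. dist (f n x) (\<omega>1 x) < e / 2"
        using eventually_happens'[OF sequentially_bot] by blast
      obtain t where t: "t \<le> T" "\<forall>x\<in>cball 0 R. dist (translate \<omega> t x) (f n x) < e / 2"
        using f(1)[of n] half_gt_zero[OF e] unfolding S_def by blast
      have "dist (translate \<omega> t x) (\<omega>1 x) < e" if "x \<in> cball 0 R" for x
        using n t that dist_triangle_half_r[of "f n x"] by (metis dist_commute)
      then show ?thesis using t(1) by blast
    qed
    moreover have "\<omega>1 \<in> H" by (rule H_closed[OF _ f(2)]) (use f(1) in \<open>auto simp: S_def\<close>)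
    ultimately show "\<omega>1 \<in> S" by (auto simp: S_def)
  qed
  then have *: "\<exists>t\<le>T. \<forall>x\<in>cball 0 R. dist (translate \<omega> t x) (\<omega>' x) < e" if "0 < e" for R e T
    using \<omega>' that unfolding S_def by blast
  have "\<exists>t\<le>- real n. \<forall>x\<in>cball 0 (real n). dist (translate \<omega> t x) (\<omega>' x) < inverse (real (Suc n))" for n
    by (rule *) simp
  then obtain \<tau> where \<tau>: "\<And>n. \<tau> n \<le> - real n"
    "\<And>n x. x \<in> cball 0 (real n) \<Longrightarrow> dist (translate \<omega> (\<tau> n) x) (\<omega>' x) < inverse (real (Suc n))"
    by metis
  show ?thesis by (rule that[OF \<tau>(1) ucc_limI_balls]) (rule \<tau>(2))
qed

section \<open>Stability from closeness on long windows\<close>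

text \<open>The difference \<open>y\<close> satisfies y(s) = \<gamma> y(s - \<alpha>) + (difference
  of D), and the last term has a small Lipschitz constant where the solutions are \<delta>-close.
  Going back one delay multiplies the crude constant \<open>2 * \<Lambda>\<close> by at most
  \<open>gmax\<close>; after \<open>N\<close> delays it is negligible.\<close>

lemma difference_lipschitz_small:
  assumes "0 < \<epsilon>" "0 \<le> \<Lambda>"
  obtains \<delta> R where "0 < \<delta>" "r \<le> R" "\<And>\<omega> t0 z w s s' i. \<omega> \<in> H \<Longrightarrow> solves \<omega> (t0 - R) z \<Longrightarrow> solves \<omega> (t0 - R) w \<Longrightarrow>
     lip_by \<Lambda> z \<Longrightarrow> lip_by \<Lambda> w \<Longrightarrow> (\<And>s i. t0 - R \<le> s \<Longrightarrow> s \<le> t0 \<Longrightarrow> \<bar>z s $ i - w s $ i\<bar> \<le> \<delta>) \<Longrightarrow>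
     t0 - r \<le> s \<Longrightarrow> s \<le> s' \<Longrightarrow> s' \<le> t0 \<Longrightarrow> \<bar>(z s' $ i - w s' $ i) - (z s $ i - w s $ i)\<bar> \<le> \<epsilon> * (s' - s)"
proof -
  have "(\<lambda>N. gmax ^ N * (2 * \<Lambda>)) \<longlonglongrightarrow> 0 * (2 * \<Lambda>)"
    using gmax by (intro tendsto_intros LIMSEQ_realpow_zero)
  then have "\<forall>\<^sub>F N in sequentially. gmax ^ N * (2 * \<Lambda>) < \<epsilon> / 2"
    using assms by (intro order_tendstoD(2)[where y = "0 * (2 * \<Lambda>)"]) auto
  then obtain N where N: "gmax ^ N * (2 * \<Lambda>) < \<epsilon> / 2"
    using eventually_happens'[OF sequentially_bot] by blast
  define K where "K = rhs_lip + 1"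
  have K: "rhs_lip \<le> K" "0 < K" using rhs_lip_nonneg by (auto simp: K_def)
  \<comment> \<open>Makes the geometric series of the contributions of D,
    \<open>rhs_lip * \<delta> / (1 - gmax)\<close>, at most half of \<epsilon>; \<open>K\<close>
    replaces \<open>rhs_lip\<close>, which may vanish.\<close>
  define \<delta> where "\<delta> = \<epsilon> / 2 * (1 - gmax) / K"
  have \<delta>: "0 < \<delta>" using assms gmax K by (simp add: \<delta>_def)
  have "rhs_lip * \<delta> \<le> K * \<delta>" using \<delta> K by (intro mult_right_mono) auto
  also have "\<dots> = \<epsilon> / 2 * (1 - gmax)" using K by (simp add: \<delta>_def)
  finally have L\<delta>: "rhs_lip * \<delta> / (1 - gmax) \<le> \<epsilon> / 2" using gmax by (simp add: pos_divide_le_eq)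
  \<comment> \<open>\<open>N\<close> delays of the iteration, one \<open>r\<close> for the window on
    which the claim is made, and one \<open>r\<close> for the delays inside
    \<open>rhs\<close>.\<close>
  define R where "R = 2 * r + real N * r"
  have R: "r \<le> R" using r_pos by (simp add: R_def add_nonneg_nonneg)
  have "\<bar>(z s' $ i - w s' $ i) - (z s $ i - w s $ i)\<bar> \<le> \<epsilon> * (s' - s)"
    if \<omega>: "\<omega> \<in> H" and z: "solves \<omega> (t0 - R) z" and w: "solves \<omega> (t0 - R) w" and lip: "lip_by \<Lambda> z" "lip_by \<Lambda> w"
      and small: "\<And>s i. t0 - R \<le> s \<Longrightarrow> s \<le> t0 \<Longrightarrow> \<bar>z s $ i - w s $ i\<bar> \<le> \<delta>"
      and s: "t0 - r \<le> s" "s \<le> s'" "s' \<le> t0" for \<omega> t0 z w s s' i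
  proof -
    define y where "y s = z s $ i - w s $ i" for s
    have Dy: "\<bar>(D_at z s' i - D_at w s' i) - (D_at z s i - D_at w s i)\<bar> \<le> rhs_lip * \<delta> * (s' - s)"
      if s: "t0 - R + r \<le> s" "s \<le> s'" "s' \<le> t0" for s s'
    proof -
      have "(D_at z s' i - D_at w s' i) - (D_at z s i - D_at w s i) = integral {s..s'} (\<lambda>\<tau>. rhs \<omega> z \<tau> i - rhs \<omega> w \<tau> i)"
        using solves_integral[OF z _ s(2), of i] solves_integral[OF w _ s(2), of i] s r_pos
        by (simp add: integral_diff rhs_integrable[OF \<omega> solves_cont[OF z]] rhs_integrable[OF \<omega> solves_cont[OF w]])
      also have "norm \<dots> \<le> integral {s..s'} (\<lambda>_. rhs_lip * \<delta>)"
      proof (rule integral_norm_bound_integral)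
        show "(\<lambda>\<tau>. rhs \<omega> z \<tau> i - rhs \<omega> w \<tau> i) integrable_on {s..s'}"
          by (intro integrable_diff rhs_integrable \<omega> solves_cont[OF z] solves_cont[OF w])
        fix \<tau> assume "\<tau> \<in> {s..s'}"
        then have "\<bar>rhs \<omega> z \<tau> i - rhs \<omega> w \<tau> i\<bar> \<le> rhs_lip * \<delta>" using s by (intro rhs_lipschitz[OF \<omega>] small) auto
        then show "norm (rhs \<omega> z \<tau> i - rhs \<omega> w \<tau> i) \<le> rhs_lip * \<delta>" by simp
      qed auto
      also have "\<dots> = rhs_lip * \<delta> * (s' - s)" using s by simp
      finally show ?thesis by simp
    qed
    have iter: "\<bar>y s' - y s\<bar> \<le> (rhs_lip * \<delta> / (1 - gmax) + gmax ^ n * (2 * \<Lambda>)) * (s' - s)"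
      if "t0 - R + r + real n * r \<le> s" "s \<le> s'" "s' \<le> t0" for n s s'
      using that
    proof (induction n arbitrary: s s')
      case 0
      have "\<bar>y s' - y s\<bar> \<le> \<Lambda> * (s' - s) + \<Lambda> * (s' - s)"
        using lip 0 unfolding lip_by_def y_def by (smt (verit))
      moreover have "0 \<le> rhs_lip * \<delta> / (1 - gmax) * (s' - s)" using rhs_lip_nonneg \<delta> gmax 0 by simp
      ultimately show ?case by (simp add: distrib_right)
    next
      case (Suc n)
      define L where "L = rhs_lip * \<delta> / (1 - gmax) + gmax ^ n * (2 * \<Lambda>)"
      have "\<bar>y (s' - \<alpha> i) - y (s - \<alpha> i)\<bar> \<le> L * ((s' - \<alpha> i) - (s - \<alpha> i))"
        unfolding L_def using Suc.prems alp[of i] by (intro Suc.IH) (auto simp: distrib_right)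
      then have "\<gamma> i * \<bar>y (s' - \<alpha> i) - y (s - \<alpha> i)\<bar> \<le> gmax * (L * (s' - s))"
        using gmax(1)[of i] gmax(2) by (intro mult_mono) auto
      then have "\<bar>\<gamma> i * y (s' - \<alpha> i) - \<gamma> i * y (s - \<alpha> i)\<bar> \<le> gmax * (L * (s' - s))"
        using gam[of i] by (simp add: right_diff_distrib[symmetric] abs_mult)
      moreover have "0 \<le> real (Suc n) * r" using r_pos by simp
      then have "t0 - R + r \<le> s" using Suc.prems by linarith
      then have "\<bar>(y s' - y s) - (\<gamma> i * y (s' - \<alpha> i) - \<gamma> i * y (s - \<alpha> i))\<bar> \<le> rhs_lip * \<delta> * (s' - s)"
        using Dy[of s s'] Suc.prems by (simp add: y_def D_at_def algebra_simps)
      ultimately have "\<bar>y s' - y s\<bar> \<le> (rhs_lip * \<delta> + gmax * L) * (s' - s)" by (simp add: algebra_simps)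
      moreover have "rhs_lip * \<delta> + gmax * L = rhs_lip * \<delta> / (1 - gmax) + gmax ^ Suc n * (2 * \<Lambda>)"
        using gmax(3) by (simp add: L_def field_simps)
      ultimately show ?case by simp
    qed
    have "\<bar>y s' - y s\<bar> \<le> (rhs_lip * \<delta> / (1 - gmax) + gmax ^ N * (2 * \<Lambda>)) * (s' - s)"
      using s by (intro iter) (auto simp: R_def)
    also have "\<dots> \<le> \<epsilon> * (s' - s)" using s L\<delta> N by (intro mult_right_mono; linarith)
    finally show ?thesis by (simp add: y_def)
  qed
  then show ?thesis using that[OF \<delta> R] by blast
qed

text \<open>The Lipschitz constant of the difference, which \<open>stability\<close> asks to be
  small, is here a consequence of uniform closeness on a window of length \<open>R\<close>. Both
  summands in \<open>stab_const * (e + e)\<close> equal \<epsilon>/2.\<close>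

lemma stability_small:
  assumes "0 < \<epsilon>" "0 \<le> \<Lambda>"
  obtains \<delta> R where "0 < \<delta>" "r \<le> R" "\<And>\<omega> t0 z w t i. \<omega> \<in> H \<Longrightarrow> solves \<omega> (t0 - R) z \<Longrightarrow> solves \<omega> (t0 - R) w \<Longrightarrow>
     lip_by \<Lambda> z \<Longrightarrow> lip_by \<Lambda> w \<Longrightarrow> (\<And>s i. t0 - R \<le> s \<Longrightarrow> s \<le> t0 \<Longrightarrow> \<bar>z s $ i - w s $ i\<bar> \<le> \<delta>) \<Longrightarrow>
     t0 \<le> t \<Longrightarrow> \<bar>z t $ i - w t $ i\<bar> \<le> \<epsilon>"
proof -
  define e where "e = \<epsilon> / (2 * stab_const)"
  have e: "0 < e" using assms stab_const_pos by (simp add: e_def)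
  obtain \<delta> R where \<delta>: "0 < \<delta>" "r \<le> R" and lip: "\<And>\<omega> t0 z w s s' i. \<omega> \<in> H \<Longrightarrow> solves \<omega> (t0 - R) z \<Longrightarrow> solves \<omega> (t0 - R) w \<Longrightarrow>
     lip_by \<Lambda> z \<Longrightarrow> lip_by \<Lambda> w \<Longrightarrow> (\<And>s i. t0 - R \<le> s \<Longrightarrow> s \<le> t0 \<Longrightarrow> \<bar>z s $ i - w s $ i\<bar> \<le> \<delta>) \<Longrightarrow>
     t0 - r \<le> s \<Longrightarrow> s \<le> s' \<Longrightarrow> s' \<le> t0 \<Longrightarrow> \<bar>(z s' $ i - w s' $ i) - (z s $ i - w s $ i)\<bar> \<le> e * (s' - s)"
    using difference_lipschitz_small[OF e assms(2)] by blast
  show ?thesis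
  proof (rule that[of "min \<delta> e" R])
    fix \<omega> t0 z w t i
    assume \<omega>: "\<omega> \<in> H" and z: "solves \<omega> (t0 - R) z" and w: "solves \<omega> (t0 - R) w"
      and l: "lip_by \<Lambda> z" "lip_by \<Lambda> w" and t: "t0 \<le> t"
      and small: "\<And>s i. t0 - R \<le> s \<Longrightarrow> s \<le> t0 \<Longrightarrow> \<bar>z s $ i - w s $ i\<bar> \<le> min \<delta> e"
    have small': "\<bar>z s $ i - w s $ i\<bar> \<le> \<delta>" "\<bar>z s $ i - w s $ i\<bar> \<le> e" if "t0 - R \<le> s" "s \<le> t0" for s i
      using small[OF that, of i] by auto
    have z0: "solves \<omega> t0 z" and w0: "solves \<omega> t0 w" using z w \<delta>(2) r_pos by (auto elim!: solves_later)
    have "\<bar>z t $ i - w t $ i\<bar> \<le> stab_const * (e + e)"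
    proof (rule stability[OF \<omega> z0 w0 _ _ _ _ t])
      fix s s' i assume s: "t0 - r \<le> s" "s \<le> s'" "s' \<le> t0"
      show "\<bar>(z s' $ i - w s' $ i) - (z s $ i - w s $ i)\<bar> \<le> e * (s' - s)"
        by (rule lip[OF \<omega> z w l small'(1) s])
    qed (use e small'(2) \<delta>(2) in auto)
    also have "\<dots> = \<epsilon>" using stab_const_pos by (simp add: e_def)
    finally show "\<bar>z t $ i - w t $ i\<bar> \<le> \<epsilon>" .
  qed (use \<delta> e in auto)
qed

end

section \<open>Compact invariant sets and their fibres\<close>

text \<open>Tailored to \<open>stability_small\<close>: if it fails at some
  \<open>t \<le> T\<close>, the two functions are close on a whole window of length \<open>R\<close>
  ending at \<open>t\<close>, and for suitable \<delta> and \<open>R\<close> solutions then stay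
  close from \<open>T\<close> on.\<close>

definition separated :: "real \<Rightarrow> real \<Rightarrow> real \<Rightarrow> (real \<Rightarrow> real ^ 'm) \<Rightarrow> (real \<Rightarrow> real ^ 'm::finite) \<Rightarrow> bool" where
  "separated R \<delta> T z w \<longleftrightarrow> (\<forall>t\<le>T. \<exists>s\<in>{t - R..t}. \<delta> \<le> norm (z s - w s))"

lemma separated_sym: "separated R \<delta> T z w \<Longrightarrow> separated R \<delta> T w z"
  by (simp add: separated_def norm_minus_commute)

lemma separated_shift:
  assumes "separated R \<delta> T z w" "s \<le> 0"
  shows "separated R \<delta> T (\<lambda>t. z (s + t)) (\<lambda>t. w (s + t))"
  unfolding separated_def
proof (intro allI impI)
  fix t assume "t \<le> T"
  then obtain u where u: "u \<in> {s + t - R..s + t}" "\<delta> \<le> norm (z u - w u)"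
    using assms unfolding separated_def by (metis add.commute add_mono_thms_linordered_semiring(1) add_0)
  then show "\<exists>u\<in>{t - R..t}. \<delta> \<le> norm (z (s + u) - w (s + u))"
    by (intro bexI[of _ "u - s"]) auto
qed

lemma separated_limit:
  assumes "\<And>n. separated R \<delta> T (z n) (w n)" "ucc_lim z z'" "ucc_lim w w'" "lip_by \<Lambda> z'" "lip_by \<Lambda> w'" "0 \<le> R"
  shows "separated R \<delta> T z' w'"
  unfolding separated_def
proof (intro allI impI)
  fix t assume t: "t \<le> T"
  \<comment> \<open>In the limit the inequality survives only up to arbitrary errors and at points
    depending on \<open>n\<close>; a maximum point of the limit difference serves for all of
    them.\<close>
  have "continuous_on {t - R..t} (\<lambda>s. norm (z' s - w' s))"
    by (intro continuous_intros lip_by_cont[OF assms(4)] lip_by_cont[OF assms(5)])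
  then obtain s where s: "s \<in> {t - R..t}" "\<forall>u\<in>{t - R..t}. norm (z' u - w' u) \<le> norm (z' s - w' s)"
    using continuous_attains_sup[of "{t - R..t}" "\<lambda>s. norm (z' s - w' s)"] assms(6) by auto
  have "\<delta> \<le> norm (z' s - w' s)"
  proof (rule field_le_epsilon)
    fix e :: real assume e: "0 < e"
    have "\<forall>\<^sub>F n in sequentially. (\<forall>u\<in>{t - R..t}. dist (z n u) (z' u) < e / 2) \<and> (\<forall>u\<in>{t - R..t}. dist (w n u) (w' u) < e / 2)"
      using e by (intro eventually_conj ucc_limD[OF assms(2)] ucc_limD[OF assms(3)]) auto
    then obtain n where n: "\<forall>u\<in>{t - R..t}. dist (z n u) (z' u) < e / 2" "\<forall>u\<in>{t - R..t}. dist (w n u) (w' u) < e / 2"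
      using eventually_happens'[OF sequentially_bot] by blast
    obtain u where u: "u \<in> {t - R..t}" "\<delta> \<le> norm (z n u - w n u)"
      using assms(1)[of n] t unfolding separated_def by blast
    have "norm (z n u - w n u) \<le> norm (z n u - z' u) + norm (z' u - w' u) + norm (w' u - w n u)"
      using norm_triangle_ineq[of "z n u - z' u" "z' u - w' u"] norm_triangle_ineq[of "z n u - w' u" "w' u - w n u"]
      by simp
    moreover have "norm (z n u - z' u) < e / 2" "norm (w' u - w n u) < e / 2"
      using n u(1) by (auto simp: dist_norm norm_minus_commute)
    moreover have "norm (z' u - w' u) \<le> norm (z' s - w' s)" using s(2) u(1) by blast
    ultimately show "\<delta> \<le> norm (z' s - w' s) + e" using u(2) by linarith
  qed
  then show "\<exists>s\<in>{t - R..t}. \<delta> \<le> norm (z' s - w' s)" using s(1) by blast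
qed

context compartmental
begin

text \<open>Members are whole entire solutions over their base points, so translations act in both
  directions. Closedness and the common bound \<open>B\<close> suffice for compactness, because the
  Lipschitz bound comes from the equation.\<close>

definition invariant_compact :: "real \<Rightarrow> ((real \<times> real \<Rightarrow> real ^ 'm ^ 'm) \<times> (real \<Rightarrow> real ^ 'm)) set \<Rightarrow> bool" where
  "invariant_compact B K \<longleftrightarrow> K \<noteq> {} \<and>
    (\<forall>\<omega> z. (\<omega>, z) \<in> K \<longrightarrow> \<omega> \<in> H \<and> entire \<omega> z \<and> bounded_by B z) \<and>
    (\<forall>\<omega> z s. (\<omega>, z) \<in> K \<longrightarrow> (translate \<omega> s, \<lambda>t. z (s + t)) \<in> K) \<and>
    (\<forall>f z \<omega> l. (\<forall>n. (f n, z n) \<in> K) \<longrightarrow> ucc_lim f \<omega> \<longrightarrow> ucc_lim z l \<longrightarrow> (\<omega>, l) \<in> K)"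

lemma
  assumes "invariant_compact B K"
  shows ic_nonempty: "K \<noteq> {}"
    and ic_H: "(\<omega>, z) \<in> K \<Longrightarrow> \<omega> \<in> H"
    and ic_entire: "(\<omega>, z) \<in> K \<Longrightarrow> entire \<omega> z"
    and ic_bounded: "(\<omega>, z) \<in> K \<Longrightarrow> bounded_by B z"
    and ic_shift: "(\<omega>, z) \<in> K \<Longrightarrow> (translate \<omega> s, \<lambda>t. z (s + t)) \<in> K"
    and ic_closed: "(\<And>n. (f n, x n) \<in> K) \<Longrightarrow> ucc_lim f \<omega> \<Longrightarrow> ucc_lim x l \<Longrightarrow> (\<omega>, l) \<in> K"
  using assms unfolding invariant_compact_def by blast+

lemma ic_lip: "invariant_compact B K \<Longrightarrow> (\<omega>, z) \<in> K \<Longrightarrow> lip_by (lip_const B 0) z"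
  by (rule entire_lipschitz) (auto dest: ic_H ic_entire ic_bounded)

lemma ic_extract:
  assumes ic: "invariant_compact B K" and fz: "\<And>n. (f n, z n) \<in> K"
  obtains \<sigma> \<omega> l where "strict_mono (\<sigma> :: nat \<Rightarrow> nat)" "ucc_lim (\<lambda>n. f (\<sigma> n)) \<omega>" "ucc_lim (\<lambda>n. z (\<sigma> n)) l" "(\<omega>, l) \<in> K"
proof (rule extract_entire[of f B z "lip_const B 0"])
  show "f n \<in> H" "bounded_by B (z n)" "lip_by (lip_const B 0) (z n)" for n
    using ic_H[OF ic fz] ic_bounded[OF ic fz] ic_lip[OF ic fz] by auto
  show "\<forall>\<^sub>F n in sequentially. solves (f n) t0 (z n)" for t0
    using ic_entire[OF ic fz] by (simp add: entire_def)
  fix \<sigma> :: "nat \<Rightarrow> nat" and \<omega> l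
  assume *: "strict_mono \<sigma>" "ucc_lim (\<lambda>n. f (\<sigma> n)) \<omega>" "ucc_lim (\<lambda>n. z (\<sigma> n)) l"
  then have "(\<omega>, l) \<in> K" by (intro ic_closed[OF ic _ *(2,3)] fz)
  with * show thesis by (rule that)
qed

text \<open>Every base point is a limit of translates of any other one, and compactness of
  \<open>K\<close> lifts the convergence to the fibres.\<close>

lemma ic_projection:
  assumes ic: "invariant_compact B K" and \<omega>: "\<omega> \<in> H"
  obtains z where "(\<omega>, z) \<in> K"
proof -
  obtain \<omega>1 z1 where 1: "(\<omega>1, z1) \<in> K" using ic_nonempty[OF ic] by (metis ex_in_conv surj_pair)
  obtain \<tau> where \<tau>: "ucc_lim (\<lambda>n. translate \<omega>1 (\<tau> n)) \<omega>"
    using alpha_limit[OF ic_H[OF ic 1] \<omega>] by blast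
  obtain \<sigma> \<omega>' l where s: "strict_mono (\<sigma> :: nat \<Rightarrow> nat)" "ucc_lim (\<lambda>n. translate \<omega>1 (\<tau> (\<sigma> n))) \<omega>'" "(\<omega>', l) \<in> K"
    by (rule ic_extract[OF ic, of "\<lambda>n. translate \<omega>1 (\<tau> n)" "\<lambda>n t. z1 (\<tau> n + t)"]) (use ic_shift[OF ic 1] in auto)
  have "\<omega>' = \<omega>" by (rule ucc_lim_unique[OF s(2) ucc_lim_subseq[OF \<tau> s(1)]])
  then show ?thesis using s(3) that by blast
qed

text \<open>The base points converge already, so each further extraction keeps their limit and all
  members of the tuple end up over the same \<omega>.\<close>

lemma ic_extract_finite:
  fixes k :: nat
  assumes ic: "invariant_compact B K" and fz: "\<And>n i. i < k \<Longrightarrow> (f n, z n i) \<in> K" and f: "ucc_lim f \<omega>"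
  shows "\<exists>(\<sigma> :: nat \<Rightarrow> nat) l. strict_mono \<sigma> \<and> (\<forall>i<k. ucc_lim (\<lambda>n. z (\<sigma> n) i) (l i) \<and> (\<omega>, l i) \<in> K)"
  using fz
proof (induction k)
  case 0
  then show ?case by (intro exI[of _ id]) (auto simp: strict_mono_def)
next
  case (Suc k)
  then obtain \<sigma> l where \<sigma>: "strict_mono (\<sigma> :: nat \<Rightarrow> nat)" "\<And>i. i < k \<Longrightarrow> ucc_lim (\<lambda>n. z (\<sigma> n) i) (l i)"
    "\<And>i. i < k \<Longrightarrow> (\<omega>, l i) \<in> K"
    by (metis less_Suc_eq)
  obtain \<tau> \<omega>' l' where \<tau>: "strict_mono (\<tau> :: nat \<Rightarrow> nat)" "ucc_lim (\<lambda>n. f (\<sigma> (\<tau> n))) \<omega>'"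
      "ucc_lim (\<lambda>n. z (\<sigma> (\<tau> n)) k) l'" "(\<omega>', l') \<in> K"
    by (rule ic_extract[OF ic, of "\<lambda>n. f (\<sigma> n)" "\<lambda>n. z (\<sigma> n) k"]) (use Suc.prems in auto)
  have "\<omega>' = \<omega>" by (rule ucc_lim_unique[OF \<tau>(2) ucc_lim_subseq[OF ucc_lim_subseq[OF f \<sigma>(1)] \<tau>(1)]])
  have "strict_mono (\<lambda>n. \<sigma> (\<tau> n))" using strict_mono_o[OF \<sigma>(1) \<tau>(1)] by (simp add: o_def)
  moreover have "ucc_lim (\<lambda>n. z (\<sigma> (\<tau> n)) i) ((l(k := l')) i) \<and> (\<omega>, (l(k := l')) i) \<in> K" if "i < Suc k" for i
    using that \<tau>(3,4) \<open>\<omega>' = \<omega>\<close> \<sigma>(3) ucc_lim_subseq[OF \<sigma>(2) \<tau>(1)] by (cases "i = k") auto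
  ultimately show ?case by (intro exI[of _ "\<lambda>n. \<sigma> (\<tau> n)"] exI[of _ "l(k := l')"]) blast
qed

section \<open>Separated tuples and lower semicontinuity of the fibres\<close>

definition sep_tuple :: "real \<Rightarrow> real \<Rightarrow> real \<Rightarrow> ((real \<times> real \<Rightarrow> real ^ 'm ^ 'm) \<times> (real \<Rightarrow> real ^ 'm)) set \<Rightarrow>
    (real \<times> real \<Rightarrow> real ^ 'm ^ 'm) \<Rightarrow> nat \<Rightarrow> (nat \<Rightarrow> real \<Rightarrow> real ^ 'm) \<Rightarrow> bool" where
  "sep_tuple R \<delta> T K \<omega> k g \<longleftrightarrow> (\<forall>i<k. (\<omega>, g i) \<in> K) \<and> (\<forall>i<k. \<forall>j<k. i \<noteq> j \<longrightarrow> separated R \<delta> T (g i) (g j))"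

lemma sep_tuple_limit:
  assumes ic: "invariant_compact B K" and R: "0 \<le> R" and f: "ucc_lim f \<omega>" and g: "\<And>n. sep_tuple R \<delta> T K (f n) k (g n)"
  obtains \<sigma> l where "strict_mono (\<sigma> :: nat \<Rightarrow> nat)" "sep_tuple R \<delta> T K \<omega> k l" "\<And>i. i < k \<Longrightarrow> ucc_lim (\<lambda>n. g (\<sigma> n) i) (l i)"
proof -
  obtain \<sigma> l where \<sigma>: "strict_mono (\<sigma> :: nat \<Rightarrow> nat)" "\<And>i. i < k \<Longrightarrow> ucc_lim (\<lambda>n. g (\<sigma> n) i) (l i)" "\<And>i. i < k \<Longrightarrow> (\<omega>, l i) \<in> K"
    using ic_extract_finite[OF ic _ f, of k g] g unfolding sep_tuple_def by blast
  have "separated R \<delta> T (l i) (l j)" if "i < k" "j < k" "i \<noteq> j" for i j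
    using g that
    by (intro separated_limit[OF _ \<sigma>(2) \<sigma>(2) ic_lip[OF ic \<sigma>(3)] ic_lip[OF ic \<sigma>(3)] R]) (auto simp: sep_tuple_def)
  then have "sep_tuple R \<delta> T K \<omega> k l" using \<sigma>(3) by (auto simp: sep_tuple_def)
  then show ?thesis using \<sigma>(1,2) that by blast
qed

text \<open>Separation persists backwards in time and under limits, so the alpha-limit of any fibre inherits its
  separated tuples; by minimality all fibres carry separated tuples of the same sizes.\<close>

lemma sep_tuple_every_fibre:
  assumes ic: "invariant_compact B K" and R: "0 \<le> R" and g: "sep_tuple R \<delta> T K \<omega> k g" "\<omega> \<in> H" and \<omega>': "\<omega>' \<in> H"
  shows "\<exists>g'. sep_tuple R \<delta> T K \<omega>' k g'"
proof -
  obtain \<tau> where \<tau>: "\<And>n. \<tau> n \<le> - real n" "ucc_lim (\<lambda>n. translate \<omega> (\<tau> n)) \<omega>'"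
    using alpha_limit[OF g(2) \<omega>'] by blast
  have "sep_tuple R \<delta> T K (translate \<omega> (\<tau> n)) k (\<lambda>i t. g i (\<tau> n + t))" for n
  proof -
    have "\<tau> n \<le> 0" using \<tau>(1)[of n] by linarith
    then show ?thesis
      using g(1) unfolding sep_tuple_def by (auto intro!: separated_shift ic_shift[OF ic])
  qed
  from sep_tuple_limit[OF ic R \<tau>(2) this] show ?thesis by blast
qed

text \<open>On the window ending at \<open>T\<close> the set \<open>K\<close> has a finite net of
  radius \<delta>/2; two members of a tuple near the same point of the net would violate separation
  at time \<open>T\<close>.\<close>

lemma sep_tuple_bounded:
  assumes ic: "invariant_compact B K" and \<delta>: "0 < \<delta>" and R: "0 \<le> R"
  shows "\<exists>N. \<forall>\<omega> k g. sep_tuple R \<delta> T K \<omega> k g \<longrightarrow> k \<le> N"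
proof -
  define close where "close z w \<longleftrightarrow> (\<forall>s\<in>{T - R..T}. norm (z s - w s) < \<delta> / 2)" for z w :: "real \<Rightarrow> real ^ 'm"
  \<comment> \<open>Without such a net one could choose an infinite sequence in \<open>K\<close> of
    pairwise distant members, and it would have no subsequence converging uniformly on the
    window.\<close>
  have "\<exists>F. finite F \<and> F \<subseteq> K \<and> (\<forall>p\<in>K. \<exists>q\<in>F. close (snd p) (snd q))"
  proof (rule ccontr)
    assume no: "\<not> ?thesis"
    have "\<exists>p. \<forall>n::nat. p n \<in> K \<and> (\<forall>m<n. \<not> close (snd (p n)) (snd (p m)))"
    proof (rule dependent_wellorder_choice)
      fix n and p :: "nat \<Rightarrow> (real \<times> real \<Rightarrow> real ^ 'm ^ 'm) \<times> (real \<Rightarrow> real ^ 'm)"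
      assume "\<And>m. m < n \<Longrightarrow> p m \<in> K \<and> (\<forall>l<m. \<not> close (snd (p m)) (snd (p l)))"
      then have "finite (p ` {..<n}) \<and> p ` {..<n} \<subseteq> K" by auto
      then have "\<not> (\<forall>x\<in>K. \<exists>q\<in>p ` {..<n}. close (snd x) (snd q))" using no by blast
      then show "\<exists>x. x \<in> K \<and> (\<forall>m<n. \<not> close (snd x) (snd (p m)))" by blast
    qed simp
    then obtain p where p: "\<And>n::nat. p n \<in> K" "\<And>n m. m < n \<Longrightarrow> \<not> close (snd (p n)) (snd (p m))" by blast
    obtain \<sigma> \<omega> l where \<sigma>: "strict_mono (\<sigma> :: nat \<Rightarrow> nat)" "ucc_lim (\<lambda>n. snd (p (\<sigma> n))) l"
      by (rule ic_extract[OF ic, of "\<lambda>n. fst (p n)" "\<lambda>n. snd (p n)"]) (use p(1) in auto)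
    have "\<forall>\<^sub>F n in sequentially. \<forall>s\<in>{T - R..T}. dist (snd (p (\<sigma> n)) s) (l s) < \<delta> / 4"
      using \<delta> by (intro ucc_limD[OF \<sigma>(2)]) auto
    then obtain N where N: "\<And>n. n \<ge> N \<Longrightarrow> \<forall>s\<in>{T - R..T}. dist (snd (p (\<sigma> n)) s) (l s) < \<delta> / 4"
      unfolding eventually_sequentially by blast
    have "close (snd (p (\<sigma> (Suc N)))) (snd (p (\<sigma> N)))"
      unfolding close_def
    proof
      fix s assume s: "s \<in> {T - R..T}"
      have "dist (snd (p (\<sigma> (Suc N))) s) (l s) < \<delta> / 4" "dist (snd (p (\<sigma> N)) s) (l s) < \<delta> / 4"
        using N[of "Suc N"] N[of N] s by auto
      then have "dist (snd (p (\<sigma> (Suc N))) s) (snd (p (\<sigma> N)) s) < \<delta> / 2"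
        using dist_triangle2[of "snd (p (\<sigma> (Suc N))) s" "snd (p (\<sigma> N)) s" "l s"] by linarith
      then show "norm (snd (p (\<sigma> (Suc N))) s - snd (p (\<sigma> N)) s) < \<delta> / 2" by (simp add: dist_norm)
    qed
    moreover have "\<sigma> N < \<sigma> (Suc N)" using \<sigma>(1) by (simp add: strict_mono_def)
    ultimately show False using p(2) by blast
  qed
  then obtain F where F: "finite F \<and> F \<subseteq> K \<and> (\<forall>p\<in>K. \<exists>q\<in>F. close (snd p) (snd q))" ..
  have F1: "finite F" and F2: "\<forall>p\<in>K. \<exists>q\<in>F. close (snd p) (snd q)" using F by simp_all
  have "k \<le> card F" if g: "sep_tuple R \<delta> T K \<omega> k g" for \<omega> k g
  proof (rule ccontr)
    assume "\<not> k \<le> card F"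
    have "\<exists>q\<in>F. close (g i) (snd q)" if "i < k" for i
      using bspec[OF F2, of "(\<omega>, g i)"] g that unfolding sep_tuple_def by simp
    then obtain q where q: "\<And>i. i < k \<Longrightarrow> q i \<in> F" "\<And>i. i < k \<Longrightarrow> close (g i) (snd (q i))"
      by metis
    have "card (q ` {..<k}) \<le> card F" using q(1) by (intro card_mono F1) auto
    then have "\<not> inj_on q {..<k}" using \<open>\<not> k \<le> card F\<close> by (intro pigeonhole) simp
    then obtain i j where ij: "i < k" "j < k" "i \<noteq> j" "q i = q j" by (auto simp: inj_on_def)
    obtain s where s: "s \<in> {T - R..T}" "\<delta> \<le> norm (g i s - g j s)"
      using g ij unfolding sep_tuple_def separated_def by blast
    have "norm (g i s - snd (q i) s) < \<delta> / 2" "norm (g j s - snd (q i) s) < \<delta> / 2"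
      using q(2)[OF ij(1)] q(2)[OF ij(2)] ij(4) s(1) by (auto simp: close_def)
    then show False using s(2) norm_triangle_ineq4[of "g i s - snd (q i) s" "g j s - snd (q i) s"] by simp
  qed
  then show ?thesis by blast
qed

text \<open>Lower semicontinuity of the fibres of \<open>K\<close>: a maximal separated tuple in the fibre over \<open>f n\<close> converges to
  one over \<open>\<omega>\<close>, which is again maximal, so that every point of the fibre over \<open>\<omega>\<close> was at some time close to it.\<close>

lemma fibre_lower_semicontinuous:
  assumes ic: "invariant_compact B K" and f: "\<And>n. f n \<in> H" "ucc_lim f \<omega>" and z: "(\<omega>, z) \<in> K" and \<epsilon>: "0 < \<epsilon>"
  obtains \<sigma> w l where "strict_mono (\<sigma> :: nat \<Rightarrow> nat)" "\<And>n. (f (\<sigma> n), w n) \<in> K" "ucc_lim w l"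
    "\<And>t i. T \<le> t \<Longrightarrow> \<bar>l t $ i - z t $ i\<bar> \<le> \<epsilon>"
proof -
  have \<Lambda>: "0 \<le> lip_const B 0" by (rule lip_by_nonneg[OF ic_lip[OF ic z]])
  obtain \<delta> R where \<delta>: "0 < \<delta>" "r \<le> R" and stab: "\<And>\<omega> t0 z w t i. \<omega> \<in> H \<Longrightarrow> solves \<omega> (t0 - R) z \<Longrightarrow> solves \<omega> (t0 - R) w \<Longrightarrow>
     lip_by (lip_const B 0) z \<Longrightarrow> lip_by (lip_const B 0) w \<Longrightarrow> (\<And>s i. t0 - R \<le> s \<Longrightarrow> s \<le> t0 \<Longrightarrow> \<bar>z s $ i - w s $ i\<bar> \<le> \<delta>) \<Longrightarrow>
     t0 \<le> t \<Longrightarrow> \<bar>z t $ i - w t $ i\<bar> \<le> \<epsilon>"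
    using stability_small[OF \<epsilon> \<Lambda>] by blast
  have R: "0 \<le> R" using \<delta>(2) r_pos by simp
  have \<omega>: "\<omega> \<in> H" by (rule ic_H[OF ic z])
  \<comment> \<open>The largest size \<open>k\<close> is taken over all fibres together;
    \<open>sep_tuple_every_fibre\<close> then realises it in each of them.\<close>
  define P where "P k \<longleftrightarrow> (\<exists>\<omega>\<in>H. \<exists>g. sep_tuple R \<delta> T K \<omega> k g)" for k
  obtain N where N: "\<And>\<omega> k g. sep_tuple R \<delta> T K \<omega> k g \<Longrightarrow> k \<le> N" using sep_tuple_bounded[OF ic \<delta>(1) R] by blast
  have "P 0" using \<omega> by (auto simp: P_def sep_tuple_def)
  moreover have "\<forall>k. P k \<longrightarrow> k \<le> N" using N by (auto simp: P_def)
  ultimately obtain k where k: "P k" "\<And>k'. P k' \<Longrightarrow> k' \<le> k"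
    using ex_has_greatest_nat[of P 0 "\<lambda>k. k" "Suc N"] by (auto simp: less_Suc_eq_le)
  have "\<exists>g. sep_tuple R \<delta> T K (f n) k g" for n
    using k(1) sep_tuple_every_fibre[OF ic R _ _ f(1)] unfolding P_def by blast
  then obtain g where g: "\<And>n. sep_tuple R \<delta> T K (f n) k (g n)" by metis
  obtain \<sigma> l where \<sigma>: "strict_mono (\<sigma> :: nat \<Rightarrow> nat)" "sep_tuple R \<delta> T K \<omega> k l" "\<And>i. i < k \<Longrightarrow> ucc_lim (\<lambda>n. g (\<sigma> n) i) (l i)"
    using sep_tuple_limit[OF ic R f(2) g] by blast
  \<comment> \<open>Otherwise \<open>z\<close> could be adjoined as entry number \<open>k\<close>,
    giving a separated tuple of size \<open>k + 1\<close>.\<close>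
  have "\<exists>i<k. \<not> separated R \<delta> T (l i) z"
  proof (rule ccontr)
    assume "\<not> ?thesis"
    then have *: "separated R \<delta> T (l i) z" "separated R \<delta> T z (l i)" if "i < k" for i
      using that separated_sym by blast+
    have "sep_tuple R \<delta> T K \<omega> (Suc k) (l(k := z))"
      using \<sigma>(2) z * unfolding sep_tuple_def by (auto simp: less_Suc_eq)
    then have "P (Suc k)" using \<omega> by (auto simp: P_def)
    then show False using k(2) by fastforce
  qed
  \<comment> \<open>Failure of separation is closeness on one window ending at
    \<open>t \<le> T\<close>; stability carries it to all times from \<open>T\<close> on.\<close>
  then obtain i t where i: "i < k" and t: "t \<le> T" "\<And>s. s \<in> {t - R..t} \<Longrightarrow> norm (l i s - z s) < \<delta>"
    unfolding separated_def by (metis not_le)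
  have li: "(\<omega>, l i) \<in> K" using \<sigma>(2) i by (simp add: sep_tuple_def)
  have "\<bar>l i u $ j - z u $ j\<bar> \<le> \<epsilon>" if u: "T \<le> u" for u j
  proof (rule stab[OF \<omega>, of t "l i" z u j])
    show "solves \<omega> (t - R) (l i)" "solves \<omega> (t - R) z"
      using ic_entire[OF ic li] ic_entire[OF ic z] by (auto simp: entire_def)
    show "lip_by (lip_const B 0) (l i)" "lip_by (lip_const B 0) z" by (rule ic_lip[OF ic li], rule ic_lip[OF ic z])
    show "\<bar>l i s $ j - z s $ j\<bar> \<le> \<delta>" if "t - R \<le> s" "s \<le> t" for s j
      using component_le_norm_cart[of "l i s - z s" j] t(2)[of s] that by simp
    show "t \<le> u" using t u by simp
  qed
  moreover have "(f (\<sigma> n), g (\<sigma> n) i) \<in> K" for n using g[of "\<sigma> n"] i by (simp add: sep_tuple_def)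
  ultimately show ?thesis using that[OF \<sigma>(1) _ \<sigma>(3)[OF i]] by blast
qed

end

section \<open>Minimal upper bounds\<close>

context compartmental
begin

text \<open>The bound \<open>B\<close> refers to \<open>p\<close> alone and may exceed that of
  \<open>K\<close>; domination is in the cone, on every window of the line.\<close>

definition upper_set :: "real \<Rightarrow> ((real \<times> real \<Rightarrow> real ^ 'm ^ 'm) \<times> (real \<Rightarrow> real ^ 'm)) set \<Rightarrow>
    ((real \<times> real \<Rightarrow> real ^ 'm ^ 'm) \<times> (real \<Rightarrow> real ^ 'm)) set" where
  "upper_set B K = {(\<omega>, p). \<omega> \<in> H \<and> entire \<omega> p \<and> bounded_by B p \<and>
     (\<forall>z t. (\<omega>, z) \<in> K \<longrightarrow> cone t (\<lambda>s. p s - z s))}"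

text \<open>A point \<open>z\<close> of the limit fibre has to be reached from the fibres over the
  \<open>f n\<close>, where domination is known: this is the use of lower semicontinuity. It reaches
  \<open>z\<close> up to an error 1/(n+1), and closedness of the cone removes the error.\<close>

lemma upper_set_closed:
  assumes ic: "invariant_compact B K" and fp: "\<And>n. (f n, p n) \<in> upper_set B' K" and f: "ucc_lim f \<omega>" and p: "ucc_lim p l"
  shows "(\<omega>, l) \<in> upper_set B' K"
proof -
  have fH: "f n \<in> H" and pe: "entire (f n) (p n)" and pb: "bounded_by B' (p n)" for n
    using fp[of n] by (auto simp: upper_set_def)
  have pl: "lip_by (lip_const B' 0) (p n)" for n by (rule entire_lipschitz[OF fH pe pb])
  have \<omega>: "\<omega> \<in> H" by (rule H_closed[OF fH f])
  have "solves \<omega> t0 l" for t0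
    by (rule solves_limit[OF fH f p pb pl]) (use pe in \<open>simp add: entire_def\<close>)
  then have le: "entire \<omega> l" by (simp add: entire_def)
  have lb: "bounded_by B' l" by (rule bounded_by_limit[OF pb ucc_lim_pointwise[OF p]])
  have "cone t (\<lambda>s. l s - z s)" if z: "(\<omega>, z) \<in> K" for z t
  proof -
    have "\<exists>w. cone t (\<lambda>s. l s - w s) \<and> (\<forall>s i. t - r \<le> s \<longrightarrow> \<bar>w s $ i - z s $ i\<bar> \<le> inverse (real (Suc n)))" for n
    proof -
      obtain \<sigma> w l' where \<sigma>: "strict_mono (\<sigma> :: nat \<Rightarrow> nat)" "\<And>n. (f (\<sigma> n), w n) \<in> K" "ucc_lim w l'"
        "\<And>s i. t - r \<le> s \<Longrightarrow> \<bar>l' s $ i - z s $ i\<bar> \<le> inverse (real (Suc n))"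
        by (rule fibre_lower_semicontinuous[OF ic fH f z, of "inverse (real (Suc n))" "t - r"]) auto
      have "cone t (\<lambda>s. l s - l' s)"
      proof (rule cone_limit)
        show "\<forall>\<^sub>F n in sequentially. cone t (\<lambda>s. p (\<sigma> n) s - w n s)"
          using fp[of "\<sigma> n" for n] \<sigma>(2) by (simp add: upper_set_def)
        show "(\<lambda>n. p (\<sigma> n) s - w n s) \<longlonglongrightarrow> l s - l' s" for s
          by (intro tendsto_diff ucc_lim_pointwise[OF ucc_lim_subseq[OF p \<sigma>(1)]] ucc_lim_pointwise[OF \<sigma>(3)])
      qed
      then show ?thesis using \<sigma>(4) by blast
    qed
    then obtain w where w: "\<And>n. cone t (\<lambda>s. l s - w n s)"
      "\<And>n s i. t - r \<le> s \<Longrightarrow> \<bar>w n s $ i - z s $ i\<bar> \<le> inverse (real (Suc n))" by metis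
    show ?thesis
    proof (rule cone_limit[where f = "\<lambda>n s. l s - w n s"])
      fix s assume s: "t - r \<le> s"
      have "(\<lambda>n. w n s $ i - z s $ i) \<longlonglongrightarrow> 0" for i
        by (rule Lim_null_comparison[OF _ LIMSEQ_inverse_real_of_nat]) (use w(2)[OF s] in simp)
      then have "(\<lambda>n. w n s) \<longlonglongrightarrow> z s" by (intro vec_tendstoI) (simp add: LIM_zero_iff)
      then show "(\<lambda>n. l s - w n s) \<longlonglongrightarrow> l s - z s" by (intro tendsto_intros)
    qed (use w(1) in simp)
  qed
  then show ?thesis using \<omega> le lb by (simp add: upper_set_def)
qed

lemma upper_set_extract:
  assumes ic: "invariant_compact B K" and fp: "\<And>n. (f n, p n) \<in> upper_set B' K"
  obtains \<sigma> \<omega> l where "strict_mono (\<sigma> :: nat \<Rightarrow> nat)" "ucc_lim (\<lambda>n. f (\<sigma> n)) \<omega>" "ucc_lim (\<lambda>n. p (\<sigma> n)) l"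
    "(\<omega>, l) \<in> upper_set B' K"
proof (rule extract_entire[of f B' p "lip_const B' 0"])
  have *: "f n \<in> H" "entire (f n) (p n)" "bounded_by B' (p n)" for n
    using fp[of n] by (auto simp: upper_set_def)
  show "f n \<in> H" "bounded_by B' (p n)" "lip_by (lip_const B' 0) (p n)" for n
    using * entire_lipschitz[OF *] by auto
  show "\<forall>\<^sub>F n in sequentially. solves (f n) t0 (p n)" for t0
    using * by (simp add: entire_def)
  fix \<sigma> :: "nat \<Rightarrow> nat" and \<omega> l
  assume **: "strict_mono \<sigma>" "ucc_lim (\<lambda>n. f (\<sigma> n)) \<omega>" "ucc_lim (\<lambda>n. p (\<sigma> n)) l"
  then have "(\<omega>, l) \<in> upper_set B' K" by (intro upper_set_closed[OF ic _ **(2,3)] fp)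
  with ** show thesis by (rule that)
qed

lemma upper_set_shift:
  assumes ic: "invariant_compact B K" and p: "(\<omega>, p) \<in> upper_set B' K"
  shows "(translate \<omega> s, \<lambda>t. p (s + t)) \<in> upper_set B' K"
proof -
  have "cone t (\<lambda>u. p (s + u) - z u)" if z: "(translate \<omega> s, z) \<in> K" for z t
  proof -
    have "(\<omega>, \<lambda>t. z (- s + t)) \<in> K" using ic_shift[OF ic z, of "- s"] by simp
    then have "cone (s + t) (\<lambda>u. p u - z (- s + u))" using p by (auto simp: upper_set_def)
    then show ?thesis using cone_shift[of t "\<lambda>u. p u - z (- s + u)" s] by simp
  qed
  then show ?thesis using p by (auto simp: upper_set_def intro: H_translate entire_shift bounded_by_shift)
qed

text \<open>Solutions started at times - n above the fibre stay above it by invariance of the cone,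
  and their limit is entire.\<close>

lemma upper_set_build:
  assumes \<omega>: "\<omega> \<in> H" and p: "\<And>n. solves \<omega> (- real n) (p n)" "\<And>n. bounded_by B' (p n)" "\<And>n. lip_by \<Lambda> (p n)"
    and c: "\<And>n z. (\<omega>, z) \<in> K \<Longrightarrow> cone (- real n) (\<lambda>s. p n s - z s)"
    and K: "\<And>z. (\<omega>, z) \<in> K \<Longrightarrow> entire \<omega> z"
  obtains \<sigma> q where "strict_mono (\<sigma> :: nat \<Rightarrow> nat)" "ucc_lim (\<lambda>n. p (\<sigma> n)) q" "(\<omega>, q) \<in> upper_set B' K"
proof -
  have ev: "\<forall>\<^sub>F n in sequentially. - real n \<le> t" for t
  proof -
    obtain N where "- t \<le> real N" using real_arch_simple by blast
    then show ?thesis by (intro eventually_sequentiallyI[of N]) (auto intro: order_trans)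
  qed
  obtain \<sigma> \<omega>' q where \<sigma>: "strict_mono (\<sigma> :: nat \<Rightarrow> nat)" "ucc_lim (\<lambda>n. \<omega>) \<omega>'" "ucc_lim (\<lambda>n. p (\<sigma> n)) q"
    "entire \<omega>' q" "bounded_by B' q"
  proof (rule extract_entire[of "\<lambda>_. \<omega>" B' p \<Lambda>])
    show "\<forall>\<^sub>F n in sequentially. solves \<omega> t0 (p n)" for t0
      using ev[of t0] by eventually_elim (rule solves_later[OF p(1)])
  qed (use \<omega> p in auto)
  have \<omega>': "\<omega>' = \<omega>" by (rule ucc_lim_unique[OF \<sigma>(2) ucc_lim_const])
  have "cone t (\<lambda>s. q s - z s)" if z: "(\<omega>, z) \<in> K" for z t
  proof (rule cone_limit)
    have "\<forall>\<^sub>F n in sequentially. cone t (\<lambda>s. p n s - z s)"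
      using ev[of t]
    proof eventually_elim
      case (elim n)
      show ?case by (rule cone_invariant[OF \<omega> p(1) _ c[OF z] elim]) (use K[OF z] in \<open>simp add: entire_def\<close>)
    qed
    then show "\<forall>\<^sub>F n in sequentially. cone t (\<lambda>s. p (\<sigma> n) s - z s)"
      using filterlim_subseq[OF \<sigma>(1)] unfolding filterlim_iff by blast
    show "(\<lambda>n. p (\<sigma> n) s - z s) \<longlonglongrightarrow> q s - z s" for s
      by (intro tendsto_intros ucc_lim_pointwise[OF \<sigma>(3)])
  qed
  then have "(\<omega>, q) \<in> upper_set B' K" using \<omega> \<sigma>(4,5) \<omega>' by (simp add: upper_set_def)
  then show ?thesis using \<sigma>(1,3) that by blast
qed

text \<open>\<open>cone_unit * (B + lip_const B 0)\<close> is a constant dominating every member of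
  \<open>K\<close> in the cone; \<open>mass_const / \<theta>\<close> is the growth that stability
  permits, and the maximum with 1 covers the times before the start.\<close>

definition upper_bound :: "real \<Rightarrow> real" where
  "upper_bound B = max 1 (mass_const / \<theta>) * (cone_unit * (B + lip_const B 0))"

text \<open>The dominating constant is used as history at each time - n. Comparison with the zero
  solution bounds these solutions independently of \<open>n\<close>.\<close>

lemma upper_set_nonempty:
  assumes ic: "invariant_compact B K"
  shows "upper_set (upper_bound B) K \<noteq> {}" "B \<le> upper_bound B"
proof -
  obtain \<omega> z0 where z0: "(\<omega>, z0) \<in> K" using ic_nonempty[OF ic] by (metis ex_in_conv surj_pair)
  have \<omega>: "\<omega> \<in> H" by (rule ic_H[OF ic z0])
  define k where "k = cone_unit * (B + lip_const B 0)"
  define C where "C = max 1 (mass_const / \<theta>)"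
  have B: "0 \<le> B" using ic_bounded[OF ic z0] abs_ge_zero order_trans unfolding bounded_by_def by blast
  have \<Lambda>: "0 \<le> lip_const B 0" by (rule lip_by_nonneg[OF ic_lip[OF ic z0]])
  have "1 * B \<le> cone_unit * (B + lip_const B 0)"
    using cone_unit_ge(1) B \<Lambda> by (intro mult_mono) auto
  then have Bk: "B \<le> k" by (simp add: k_def)
  then have k: "0 \<le> k" using B by simp
  have "1 * k \<le> C * k" using k by (intro mult_right_mono) (auto simp: C_def)
  then have kU: "k \<le> upper_bound B" by (simp add: upper_bound_def C_def k_def)
  then show "B \<le> upper_bound B" using Bk by simp
  have ck: "cone t (\<lambda>s. vec k - z s)" if z: "(\<omega>, z) \<in> K" for z t
  proof (rule cone_const_minus[OF _ B \<Lambda>])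
    show "z s $ i \<le> B" for s i using ic_bounded[OF ic z] by (auto simp: bounded_by_def abs_le_iff)
    show "z s' $ i - z s $ i \<le> lip_const B 0 * (s' - s)" if "s \<le> s'" for s s' i
      using ic_lip[OF ic z] that by (auto simp: lip_by_def abs_le_iff)
  qed (simp add: k_def)
  have "\<exists>p. solves \<omega> (- real n) p \<and> (\<forall>s\<le>- real n. p s = vec k)" for n
    by (intro solves_exists \<omega> continuous_intros)
  then obtain p where p: "\<And>n. solves \<omega> (- real n) (p n)" "\<And>n s. s \<le> - real n \<Longrightarrow> p n s = vec k" by metis
  have pb: "bounded_by (upper_bound B) (p n)" for n
    unfolding bounded_by_def
  proof (intro allI)
    fix t i
    show "\<bar>p n t $ i\<bar> \<le> upper_bound B"
    proof (cases "t \<le> - real n")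
      case True
      then show ?thesis using p(2) k kU by simp
    next
      case False
      then have t: "- real n \<le> t" by simp
      have 0: "solves \<omega> (- real n) (\<lambda>_. 0)" by (rule solves_zero[OF \<omega>])
      have "cone (- real n) (\<lambda>s. (0 :: real ^ 'm))" by (rule cone_const) simp
      then have "cone (- real n) (\<lambda>s. 0 + vec k - p n s)" by (rule cone_cong) (simp add: p(2))
      then have "p n t $ i - (0 :: real ^ 'm) $ i \<le> mass_const / \<theta> * k"
        by (rule upper_bound_stable[OF \<omega> p(1) 0 k _ t])
      also have "\<dots> \<le> C * k" using k by (intro mult_right_mono) (auto simp: C_def)
      finally have 1: "p n t $ i \<le> upper_bound B" by (simp add: upper_bound_def C_def k_def)
      have "cone (- real n) (\<lambda>s. vec k)" by (rule cone_const) (simp add: k)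
      then have "cone (- real n) (\<lambda>s. p n s - 0)" by (rule cone_cong) (simp add: p(2))
      then have "cone t (\<lambda>s. p n s - 0)" by (rule cone_invariant[OF \<omega> p(1) 0 _ t])
      then have "0 \<le> p n t $ i" using cone_nonneg[of t "\<lambda>s. p n s - 0" t i] r_pos by simp
      then show ?thesis using 1 by simp
    qed
  qed
  have pl: "lip_by (lip_const (upper_bound B) 0) (p n)" for n
    by (rule solution_lipschitz[OF \<omega> p(1) pb]) (auto simp: p(2))
  obtain \<sigma> q where "(\<omega>, q) \<in> upper_set (upper_bound B) K"
  proof (rule upper_set_build[OF \<omega> p(1) pb pl])
    show "cone (- real n) (\<lambda>s. p n s - z s)" if "(\<omega>, z) \<in> K" for n z
      by (rule cone_cong[OF ck[OF that]]) (simp add: p(2))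
    show "entire \<omega> z" if "(\<omega>, z) \<in> K" for z by (rule ic_entire[OF ic that])
  qed
  then show "upper_set (upper_bound B) K \<noteq> {}" by blast
qed

lemma entire_mass: "\<omega> \<in> H \<Longrightarrow> entire \<omega> p \<Longrightarrow> mass \<omega> p t = mass \<omega> p 0"
  using mass_constant[of \<omega> t p 0] mass_constant[of \<omega> 0 p t] by (cases "0 \<le> t") (auto simp: entire_def)

lemma mass_shift:
  assumes \<omega>: "\<omega> \<in> H" and z: "continuous_on UNIV z"
  shows "mass (translate \<omega> s) (\<lambda>t. z (s + t)) t = mass \<omega> z (s + t)"
proof -
  have "integral {t - \<rho> i j..t} (\<lambda>u. \<omega> (s + u, z (s + u) $ j) $ i $ j)
      = integral {s + t - \<rho> i j..s + t} (\<lambda>u. \<omega> (u, z u $ j) $ i $ j)" for i j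
    using integral_shift[of "t - \<rho> i j" s t "\<lambda>u. \<omega> (u, z u $ j) $ i $ j"] entry_cont_at[OF \<omega> z]
    by (simp add: o_def algebra_simps)
  then show ?thesis by (simp add: mass_def D_at_def algebra_simps)
qed

text \<open>The minimum runs over all base points together. The mass of an entire solution is
  constant in time, so evaluation at 0 is compatible with translations.\<close>

definition minimal_upper :: "real \<Rightarrow> ((real \<times> real \<Rightarrow> real ^ 'm ^ 'm) \<times> (real \<Rightarrow> real ^ 'm)) set \<Rightarrow>
    ((real \<times> real \<Rightarrow> real ^ 'm ^ 'm) \<times> (real \<Rightarrow> real ^ 'm)) set" where
  "minimal_upper B K = {(\<omega>, p)\<in>upper_set B K. \<forall>(\<omega>', p')\<in>upper_set B K. mass \<omega> p 0 \<le> mass \<omega>' p' 0}"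

lemma upper_setD:
  assumes "(\<omega>, p) \<in> upper_set B K"
  shows "\<omega> \<in> H" "entire \<omega> p" "bounded_by B p" "(\<omega>, z) \<in> K \<Longrightarrow> cone t (\<lambda>s. p s - z s)"
  using assms by (auto simp: upper_set_def)

lemma minimal_upperD: "(\<omega>, p) \<in> minimal_upper B K \<Longrightarrow> (\<omega>, p) \<in> upper_set B K"
  by (auto simp: minimal_upper_def)

lemma upper_set_lip: "(\<omega>, p) \<in> upper_set B K \<Longrightarrow> lip_by (lip_const B 0) p"
  by (rule entire_lipschitz) (auto dest: upper_setD)

text \<open>A minimizing sequence has a convergent subsequence, and mass is continuous; comparison
  with the zero solution bounds the mass from below.\<close>

lemma minimal_upper_nonempty:
  assumes ic: "invariant_compact B K" and ne: "upper_set B' K \<noteq> {}"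
  shows "minimal_upper B' K \<noteq> {}"
proof -
  define m where "m = (INF (\<omega>, p)\<in>upper_set B' K. mass \<omega> p 0)"
  have "- (mass_const * B') \<le> mass \<omega> p 0" if p: "(\<omega>, p) \<in> upper_set B' K" for \<omega> p
  proof -
    have "\<bar>mass \<omega> p 0 - mass \<omega> (\<lambda>_. 0) 0\<bar> \<le> mass_const * B'"
      using upper_setD(3)[OF p]
      by (intro mass_upper upper_setD(1)[OF p] lip_by_cont[OF upper_set_lip[OF p]]) (auto simp: bounded_by_def)
    moreover have "mass \<omega> (\<lambda>_. 0) 0 = 0" using upper_setD(1)[OF p] by (simp add: mass_def D_at_def H_zero)
    ultimately show ?thesis by simp
  qed
  then have bdd: "bdd_below ((\<lambda>(\<omega>, p). mass \<omega> p 0) ` upper_set B' K)"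
    by (intro bdd_belowI[of _ "- (mass_const * B')"]) auto
  have ge: "m \<le> mass \<omega> p 0" if "(\<omega>, p) \<in> upper_set B' K" for \<omega> p
    unfolding m_def using cINF_lower[OF bdd that] by simp
  have "\<exists>q\<in>upper_set B' K. (case q of (\<omega>, p) \<Rightarrow> mass \<omega> p 0) < m + inverse (real (Suc n))" for n
  proof -
    have "m < m + inverse (real (Suc n))" by simp
    then show ?thesis unfolding m_def using cINF_less_iff[OF ne bdd] by blast
  qed
  then obtain q where q: "\<And>n. q n \<in> upper_set B' K" "\<And>n. (case q n of (\<omega>, p) \<Rightarrow> mass \<omega> p 0) < m + inverse (real (Suc n))"
    by metis
  define f p where "f n = fst (q n)" and "p n = snd (q n)" for n
  have fp: "(f n, p n) \<in> upper_set B' K" and M: "mass (f n) (p n) 0 < m + inverse (real (Suc n))" for n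
    using q[of n] by (auto simp: f_def p_def split: prod.splits)
  obtain \<sigma> \<omega> l where \<sigma>: "strict_mono (\<sigma> :: nat \<Rightarrow> nat)" "ucc_lim (\<lambda>n. f (\<sigma> n)) \<omega>" "ucc_lim (\<lambda>n. p (\<sigma> n)) l"
    "(\<omega>, l) \<in> upper_set B' K"
    by (rule upper_set_extract[OF ic fp])
  have "(\<lambda>n. mass (f (\<sigma> n)) (p (\<sigma> n)) 0) \<longlonglongrightarrow> mass \<omega> l 0"
    by (rule mass_limit[OF _ \<sigma>(2,3)]) (auto intro: upper_setD[OF fp] upper_set_lip[OF fp])
  moreover have "(\<lambda>n. m + inverse (real (Suc (\<sigma> n)))) \<longlonglongrightarrow> m + 0"
    using filterlim_compose[OF LIMSEQ_inverse_real_of_nat filterlim_subseq[OF \<sigma>(1)]] by (intro tendsto_intros)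
  ultimately have "mass \<omega> l 0 \<le> m + 0"
    by (rule LIMSEQ_le) (use less_imp_le[OF M] in blast)
  then have "(\<omega>, l) \<in> minimal_upper B' K" using \<sigma>(4) ge unfolding minimal_upper_def by fastforce
  then show ?thesis by blast
qed

lemma minimal_upper_mass: "(\<omega>, p) \<in> minimal_upper B K \<Longrightarrow> (\<omega>', p') \<in> minimal_upper B K \<Longrightarrow> mass \<omega> p 0 = mass \<omega>' p' 0"
  unfolding minimal_upper_def by (force intro: antisym)

lemma minimal_upper_shift:
  assumes ic: "invariant_compact B K" and p: "(\<omega>, p) \<in> minimal_upper B' K"
  shows "(translate \<omega> s, \<lambda>t. p (s + t)) \<in> minimal_upper B' K"
proof -
  note u = minimal_upperD[OF p]
  have "mass (translate \<omega> s) (\<lambda>t. p (s + t)) 0 = mass \<omega> p 0"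
    using mass_shift[OF upper_setD(1)[OF u] lip_by_cont[OF upper_set_lip[OF u]], of s 0]
      entire_mass[OF upper_setD(1,2)[OF u], of s] by simp
  then show ?thesis using p upper_set_shift[OF ic u, of s] by (auto simp: minimal_upper_def)
qed

lemma minimal_upper_extract:
  assumes ic: "invariant_compact B K" and fp: "\<And>n. (f n, p n) \<in> minimal_upper B' K"
  obtains \<sigma> \<omega> l where "strict_mono (\<sigma> :: nat \<Rightarrow> nat)" "ucc_lim (\<lambda>n. f (\<sigma> n)) \<omega>" "ucc_lim (\<lambda>n. p (\<sigma> n)) l"
    "(\<omega>, l) \<in> minimal_upper B' K"
proof -
  note u = minimal_upperD[OF fp]
  obtain \<sigma> \<omega> l where \<sigma>: "strict_mono (\<sigma> :: nat \<Rightarrow> nat)" "ucc_lim (\<lambda>n. f (\<sigma> n)) \<omega>" "ucc_lim (\<lambda>n. p (\<sigma> n)) l"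
    "(\<omega>, l) \<in> upper_set B' K"
    by (rule upper_set_extract[OF ic u])
  have "(\<lambda>n. mass (f (\<sigma> n)) (p (\<sigma> n)) 0) \<longlonglongrightarrow> mass \<omega> l 0"
    by (rule mass_limit[OF _ \<sigma>(2,3)]) (auto intro: upper_setD[OF u] upper_set_lip[OF u])
  moreover have "mass (f (\<sigma> n)) (p (\<sigma> n)) 0 = mass (f 0) (p 0) 0" for n by (rule minimal_upper_mass[OF fp fp])
  ultimately have "mass \<omega> l 0 = mass (f 0) (p 0) 0" using LIMSEQ_unique[OF _ tendsto_const] by simp
  then have "(\<omega>, l) \<in> minimal_upper B' K" using \<sigma>(4) fp[of 0] by (auto simp: minimal_upper_def)
  then show ?thesis using \<sigma>(1-3) that by blast
qed

text \<open>Windows of length \<open>r\<close> overlap, so monotonicity on each of them can be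
  chained.\<close>

lemma cone_global:
  assumes "\<And>t. cone t y" "s \<le> s'"
  shows "exp (\<beta> i * s) * y s $ i \<le> exp (\<beta> i * s') * y s' $ i"
proof -
  have ind: "exp (\<beta> i * s) * y s $ i \<le> exp (\<beta> i * s') * y s' $ i" if "s \<le> s'" "s' \<le> s + real n * r" for n s s'
    using that
  proof (induction n arbitrary: s')
    case 0
    then show ?case by simp
  next
    case (Suc n)
    define u where "u = max s (s' - r)"
    have "exp (\<beta> i * s) * y s $ i \<le> exp (\<beta> i * u) * y u $ i"
      using Suc.prems r_pos by (intro Suc.IH) (auto simp: u_def algebra_simps)
    also have "\<dots> \<le> exp (\<beta> i * s') * y s' $ i"
      using assms(1)[of s'] Suc.prems r_pos unfolding cone_def exp_mono_def by (simp add: u_def)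
    finally show ?case .
  qed
  obtain n where "(s' - s) / r \<le> real n" using real_arch_simple by blast
  then have "s' \<le> s + real n * r" using r_pos by (simp add: field_simps)
  then show ?thesis using ind assms(2) by blast
qed

text \<open>If the minimal upper bounds stayed a distance \<open>\<delta>\<close> above \<open>K\<close> in the \<open>i\<close>-th component, then one could restart them
  slightly lower at times \<open>- n\<close>: the strict inequality in the rate condition keeps the restarted
  solutions above \<open>K\<close>, and their limit is an upper bound of smaller mass.\<close>

lemma minimal_upper_touches:
  assumes ic: "invariant_compact B K" and BB: "B \<le> B'" and p: "(\<omega>, p) \<in> minimal_upper B' K" and \<delta>: "0 < \<delta>"
  shows "\<exists>z t. (\<omega>, z) \<in> K \<and> p t $ i - z t $ i < \<delta>"
proof (rule ccontr)
  assume no: "\<not> ?thesis"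
  note u = minimal_upperD[OF p]
  note \<omega> = upper_setD(1)[OF u] and pe = upper_setD(2)[OF u] and pb = upper_setD(3)[OF u] and pc = upper_setD(4)[OF u]
  have pl: "lip_by (lip_const B' 0) p" by (rule upper_set_lip[OF u])
  have gap: "\<delta> \<le> p t $ i - z t $ i" if "(\<omega>, z) \<in> K" for z t using no that by (meson not_le)
  \<comment> \<open>\<open>\<eta> \<le> \<delta>\<close> keeps the lowered function above the fibre.
    Lowering by \<eta> costs the drift \<open>\<beta> i * \<eta>\<close>, and the gap provides a
    drift of at least \<open>\<kappa> * \<delta>\<close>.\<close>
  define \<eta> where "\<eta> = min \<delta> (\<kappa> * \<delta> / \<beta> i)"
  have \<eta>: "0 < \<eta>" "\<eta> \<le> \<delta>" "\<eta> \<le> \<kappa> * \<delta> / \<beta> i" using \<delta> kappa_pos bet[of i] by (auto simp: \<eta>_def)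
  have "\<exists>q. solves \<omega> (- real n) q \<and> (\<forall>s\<le>- real n. q s = p s - axis i \<eta>)" for n
    by (intro solves_exists \<omega> continuous_intros lip_by_cont[OF pl])
  then obtain q where q: "\<And>n. solves \<omega> (- real n) (q n)" "\<And>n s. s \<le> - real n \<Longrightarrow> q n s = p s - axis i \<eta>" by metis
  have ps: "solves \<omega> t0 p" for t0 using pe by (simp add: entire_def)
  have zs: "solves \<omega> t0 z" if "(\<omega>, z) \<in> K" for z t0 using ic_entire[OF ic that] by (simp add: entire_def)
  have lower: "cone (- real n) (\<lambda>s. q n s - z s)" if z: "(\<omega>, z) \<in> K" for n z
  proof -
    have "cone t (\<lambda>s. (p s - axis i \<eta>) - z s)" for t
      unfolding cone_def
    proof
      fix j
      show "exp_mono (\<beta> j) (t - r) t (\<lambda>s. ((p s - axis i \<eta>) - z s) $ j)"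
      proof (cases "j = i")
        case False
        then show ?thesis using pc[OF z, of t] by (simp add: cone_def axis_def)
      next
        case True
        let ?Y = "\<lambda>s. exp (\<beta> i * s) * (p s $ i - z s $ i)"
        have "exp (\<beta> i * s) * (p s $ i - \<eta> - z s $ i) \<le> exp (\<beta> i * s') * (p s' $ i - \<eta> - z s' $ i)" if s: "s \<le> s'" for s s'
        proof -
          \<comment> \<open>Here the delayed values are ordered on the whole line already, so no
            induction over delays is needed.\<close>
          have "?Y (s - \<alpha> i) \<le> ?Y (s' - \<alpha> i)"
            using cone_global[OF pc[OF z], of "s - \<alpha> i" "s' - \<alpha> i" i] s by simp
          then have g: "\<gamma> i * exp (\<beta> i * \<alpha> i) * ?Y (s - \<alpha> i) \<le> \<gamma> i * exp (\<beta> i * \<alpha> i) * ?Y (s' - \<alpha> i)"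
            using gam(1) by (intro mult_left_mono) auto
          have "\<kappa> * \<delta> / \<beta> i * (exp (\<beta> i * s') - exp (\<beta> i * s)) \<le>
            exp (\<beta> i * s') * (D_at p s' i - D_at z s' i) - exp (\<beta> i * s) * (D_at p s i - D_at z s i)"
          proof (rule D_at_weighted_increase[OF ps zs[OF z] order_refl s])
            fix t
            have "\<kappa> * \<delta> \<le> \<kappa> * (p (t - r) $ i - z (t - r) $ i)" using gap[OF z] kappa_pos by (intro mult_left_mono) auto
            also have "\<dots> \<le> drift \<omega> p z t i" by (rule drift_lower[OF \<omega> pc[OF z]])
            finally show "\<kappa> * \<delta> \<le> drift \<omega> p z t i" .
          qed
          then have "\<kappa> * \<delta> / \<beta> i * (exp (\<beta> i * s') - exp (\<beta> i * s)) \<le> ?Y s' - ?Y s"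
            using g weighted_neutral[of i s p z] weighted_neutral[of i s' p z] by linarith
          moreover have "\<eta> * (exp (\<beta> i * s') - exp (\<beta> i * s)) \<le> \<kappa> * \<delta> / \<beta> i * (exp (\<beta> i * s') - exp (\<beta> i * s))"
            using \<eta> s bet[of i] by (intro mult_right_mono) auto
          ultimately show ?thesis by (simp add: algebra_simps)
        qed
        then show ?thesis using gap[OF z, of "t - r"] \<eta> True by (simp add: exp_mono_def axis_def)
      qed
    qed
    then show ?thesis by (rule cone_cong) (simp add: q(2))
  qed
  have upper: "cone (- real n) (\<lambda>s. p s - q n s)" for n
  proof -
    have "cone (- real n) (\<lambda>s. axis i \<eta>)" by (rule cone_const) (use \<eta> in \<open>simp add: axis_def\<close>)
    then show ?thesis by (rule cone_cong) (simp add: q(2))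
  qed
  obtain z0 where z0: "(\<omega>, z0) \<in> K" by (rule ic_projection[OF ic \<omega>])
  have qb: "bounded_by B' (q n)" for n
    unfolding bounded_by_def
  proof (intro allI)
    fix t j
    \<comment> \<open>Trapped between a member of the fibre and \<open>p\<close>, the lowered
      solutions obey the same bound \<open>B'\<close>; only then is their limit a competitor in
      \<open>upper_set B' K\<close>.\<close>
    have "z0 t $ j \<le> q n t $ j \<and> q n t $ j \<le> p t $ j"
    proof (cases "- real n \<le> t")
      case True
      have "cone t (\<lambda>s. q n s - z0 s)" by (rule cone_invariant[OF \<omega> q(1) zs[OF z0] lower[OF z0] True])
      moreover have "cone t (\<lambda>s. p s - q n s)" by (rule cone_invariant[OF \<omega> ps q(1) upper True])
      ultimately show ?thesis using cone_nonneg[of t _ t j] r_pos by fastforce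
    next
      case False
      then show ?thesis using gap[OF z0, of t] \<eta> cone_nonneg[OF pc[OF z0, of t], of t j] r_pos
        by (auto simp: q(2) axis_def)
    qed
    moreover have "- B' \<le> z0 t $ j" using ic_bounded[OF ic z0] BB unfolding bounded_by_def by (smt (verit))
    moreover have "p t $ j \<le> B'" using pb unfolding bounded_by_def by (smt (verit))
    ultimately show "\<bar>q n t $ j\<bar> \<le> B'" by linarith
  qed
  have ql: "lip_by (lip_const B' (lip_const B' 0)) (q n)" for n
    by (rule solution_lipschitz[OF \<omega> q(1) qb lip_by_nonneg[OF pl]]) (use pl in \<open>simp add: q(2) lip_by_def\<close>)
  obtain \<sigma> q' where \<sigma>: "strict_mono (\<sigma> :: nat \<Rightarrow> nat)" "ucc_lim (\<lambda>n. q (\<sigma> n)) q'" "(\<omega>, q') \<in> upper_set B' K"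
    by (rule upper_set_build[OF \<omega> q(1) qb ql lower ic_entire[OF ic]])
  \<comment> \<open>At time - n the deficit is exactly \<eta> in one component; conservation carries
    the corresponding loss of mass to time 0, uniformly in \<open>n\<close>.\<close>
  have M: "mass \<omega> (q n) 0 \<le> mass \<omega> p 0 - \<theta> * \<eta>" for n
  proof -
    have "(\<Sum>j\<in>UNIV. p (- real n) $ j - q n (- real n) $ j) = (\<Sum>j\<in>UNIV. if j = i then \<eta> else 0)"
      by (intro sum.cong) (auto simp: q(2) axis_def)
    also have "\<dots> = \<eta>" by simp
    finally have "\<theta> * \<eta> \<le> mass \<omega> p (- real n) - mass \<omega> (q n) (- real n)"
      using mass_lower[OF \<omega> solves_cont[OF ps] solves_cont[OF q(1)] upper, of n] by simp
    then show ?thesis using entire_mass[OF \<omega> pe, of "- real n"] mass_constant[OF \<omega> q(1)[of n], of 0] by simp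
  qed
  have "(\<lambda>n. mass \<omega> (q (\<sigma> n)) 0) \<longlonglongrightarrow> mass \<omega> q' 0"
    by (rule mass_limit[OF \<omega> ucc_lim_const \<sigma>(2) qb ql])
  then have "mass \<omega> q' 0 \<le> mass \<omega> p 0 - \<theta> * \<eta>"
    using M by (intro LIMSEQ_le_const2) auto
  moreover have "mass \<omega> p 0 \<le> mass \<omega> q' 0" using p \<sigma>(3) by (auto simp: minimal_upper_def)
  moreover have "0 < \<theta> * \<eta>" using theta_pos \<eta>(1) by simp
  ultimately show False by simp
qed

text \<open>Arbitrarily small gaps become contact at time 0 after translation and a first limit. The
  weighted gap is nonnegative and increasing, so contact at 0 forces contact at all earlier times; a
  second limit, of translates by - n, extends it to all times.\<close>

lemma minimal_upper_coincides:
  assumes ic: "invariant_compact B K" and BB: "B \<le> B'" and ne: "upper_set B' K \<noteq> {}"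
  obtains \<omega> p z where "(\<omega>, p) \<in> minimal_upper B' K" "(\<omega>, z) \<in> K" "\<And>t. p t $ i = z t $ i"
proof -
  obtain \<omega>0 p0 where p0: "(\<omega>0, p0) \<in> minimal_upper B' K"
    using minimal_upper_nonempty[OF ic ne] by (metis ex_in_conv surj_pair)
  have "\<exists>z t. (\<omega>0, z) \<in> K \<and> p0 t $ i - z t $ i < inverse (real (Suc n))" for n
    by (rule minimal_upper_touches[OF ic BB p0]) simp
  then obtain z0 t0 where z0: "\<And>n. (\<omega>0, z0 n) \<in> K" "\<And>n. p0 (t0 n) $ i - z0 n (t0 n) $ i < inverse (real (Suc n))"
    by metis
  let ?f = "\<lambda>n. translate \<omega>0 (t0 n)" and ?p = "\<lambda>n t. p0 (t0 n + t)" and ?z = "\<lambda>n t. z0 n (t0 n + t)"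
  obtain \<sigma> \<omega>1 p1 where \<sigma>: "strict_mono (\<sigma> :: nat \<Rightarrow> nat)" "ucc_lim (\<lambda>n. ?f (\<sigma> n)) \<omega>1" "ucc_lim (\<lambda>n. ?p (\<sigma> n)) p1"
    "(\<omega>1, p1) \<in> minimal_upper B' K"
    by (rule minimal_upper_extract[OF ic, of ?f ?p]) (rule minimal_upper_shift[OF ic p0])
  obtain \<tau> \<omega>1' z1 where \<tau>: "strict_mono (\<tau> :: nat \<Rightarrow> nat)" "ucc_lim (\<lambda>n. ?f (\<sigma> (\<tau> n))) \<omega>1'" "ucc_lim (\<lambda>n. ?z (\<sigma> (\<tau> n))) z1"
    "(\<omega>1', z1) \<in> K"
    by (rule ic_extract[OF ic, of "\<lambda>n. ?f (\<sigma> n)" "\<lambda>n. ?z (\<sigma> n)"]) (rule ic_shift[OF ic z0(1)])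
  have "\<omega>1' = \<omega>1" by (rule ucc_lim_unique[OF \<tau>(2) ucc_lim_subseq[OF \<sigma>(2) \<tau>(1)]])
  then have z1: "(\<omega>1, z1) \<in> K" using \<tau>(4) by simp
  have sm: "strict_mono (\<lambda>n. \<sigma> (\<tau> n))" using strict_mono_o[OF \<sigma>(1) \<tau>(1)] by (simp add: o_def)
  have "(\<lambda>n. ?p (\<sigma> (\<tau> n)) 0 $ i - ?z (\<sigma> (\<tau> n)) 0 $ i) \<longlonglongrightarrow> p1 0 $ i - z1 0 $ i"
    by (intro tendsto_diff tendsto_vec_nth ucc_lim_pointwise[OF ucc_lim_subseq[OF \<sigma>(3) \<tau>(1)]] ucc_lim_pointwise[OF \<tau>(3)])
  moreover have "(\<lambda>n. inverse (real (Suc (\<sigma> (\<tau> n))))) \<longlonglongrightarrow> 0"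
    by (rule filterlim_compose[OF LIMSEQ_inverse_real_of_nat filterlim_subseq[OF sm]])
  ultimately have "p1 0 $ i - z1 0 $ i \<le> 0"
    by (rule LIMSEQ_le) (use less_imp_le[OF z0(2)] in auto)
  note pc = upper_setD(4)[OF minimal_upperD[OF \<sigma>(4)] z1]
  have eq: "p1 t $ i = z1 t $ i" if t: "t \<le> 0" for t
  proof -
    have "exp (\<beta> i * t) * (p1 t - z1 t) $ i \<le> exp (\<beta> i * 0) * (p1 0 - z1 0) $ i" by (rule cone_global[OF pc t])
    then have "exp (\<beta> i * t) * (p1 t $ i - z1 t $ i) \<le> 0" using \<open>p1 0 $ i - z1 0 $ i \<le> 0\<close> by simp
    then have "p1 t $ i - z1 t $ i \<le> 0" by (simp add: mult_le_0_iff)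
    then show ?thesis using cone_nonneg[OF pc[of t], of t i] r_pos by simp
  qed
  \<comment> \<open>The n-th translates agree in component \<open>i\<close> up to time
    \<open>n\<close>, hence their limits agree everywhere.\<close>
  let ?f = "\<lambda>n. translate \<omega>1 (- real n)" and ?p = "\<lambda>n t. p1 (- real n + t)" and ?z = "\<lambda>n t. z1 (- real n + t)"
  obtain \<sigma> \<omega>2 p2 where \<sigma>: "strict_mono (\<sigma> :: nat \<Rightarrow> nat)" "ucc_lim (\<lambda>n. ?f (\<sigma> n)) \<omega>2" "ucc_lim (\<lambda>n. ?p (\<sigma> n)) p2"
    "(\<omega>2, p2) \<in> minimal_upper B' K"
    by (rule minimal_upper_extract[OF ic, of ?f ?p]) (rule minimal_upper_shift[OF ic \<sigma>(4)])
  obtain \<tau> \<omega>2' z2 where \<tau>: "strict_mono (\<tau> :: nat \<Rightarrow> nat)" "ucc_lim (\<lambda>n. ?f (\<sigma> (\<tau> n))) \<omega>2'" "ucc_lim (\<lambda>n. ?z (\<sigma> (\<tau> n))) z2"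
    "(\<omega>2', z2) \<in> K"
    by (rule ic_extract[OF ic, of "\<lambda>n. ?f (\<sigma> n)" "\<lambda>n. ?z (\<sigma> n)"]) (rule ic_shift[OF ic z1])
  have "\<omega>2' = \<omega>2" by (rule ucc_lim_unique[OF \<tau>(2) ucc_lim_subseq[OF \<sigma>(2) \<tau>(1)]])
  have sm: "strict_mono (\<lambda>n. \<sigma> (\<tau> n))" using strict_mono_o[OF \<sigma>(1) \<tau>(1)] by (simp add: o_def)
  have "p2 t $ i = z2 t $ i" for t
  proof (rule LIMSEQ_unique)
    show "(\<lambda>n. ?p (\<sigma> (\<tau> n)) t $ i) \<longlonglongrightarrow> p2 t $ i"
      by (intro tendsto_vec_nth ucc_lim_pointwise[OF ucc_lim_subseq[OF \<sigma>(3) \<tau>(1)]])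
    have "(\<lambda>n. ?z (\<sigma> (\<tau> n)) t $ i) \<longlonglongrightarrow> z2 t $ i" by (intro tendsto_vec_nth ucc_lim_pointwise[OF \<tau>(3)])
    moreover have "\<forall>\<^sub>F n in sequentially. ?z (\<sigma> (\<tau> n)) t $ i = ?p (\<sigma> (\<tau> n)) t $ i"
    proof -
      obtain N where N: "t \<le> real N" using real_arch_simple by blast
      show ?thesis
      proof (rule eventually_sequentiallyI[of N])
        fix n assume "N \<le> n"
        then have "N \<le> \<sigma> (\<tau> n)" using seq_suble[OF sm, of n] by simp
        then show "?z (\<sigma> (\<tau> n)) t $ i = ?p (\<sigma> (\<tau> n)) t $ i" using N by (intro eq[symmetric]) simp
      qed
    qed
    ultimately show "(\<lambda>n. ?p (\<sigma> (\<tau> n)) t $ i) \<longlonglongrightarrow> z2 t $ i" by (rule Lim_transform_eventually)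
  qed
  then show ?thesis using that[OF \<sigma>(4)] \<tau>(4) \<open>\<omega>2' = \<omega>2\<close> by blast
qed

text \<open>Two members of \<open>K'\<close> over one base point may touch different minimal bounds.
  Each bound dominates the whole fibre, so each of the two i-th components lies below the
  other.\<close>

lemma ic_component_determined:
  assumes ic: "invariant_compact B K"
  obtains K' where "K' \<subseteq> K" "invariant_compact B K'"
    "\<And>\<omega> z z' t. (\<omega>, z) \<in> K' \<Longrightarrow> (\<omega>, z') \<in> K' \<Longrightarrow> z t $ i = z' t $ i"
proof -
  define B' where "B' = upper_bound B"
  note ne = upper_set_nonempty[OF ic, folded B'_def]
  define K' where "K' = {(\<omega>, z)\<in>K. \<exists>p. (\<omega>, p) \<in> minimal_upper B' K \<and> (\<forall>t. p t $ i = z t $ i)}"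
  have "K' \<subseteq> K" by (auto simp: K'_def)
  moreover have "invariant_compact B K'"
    unfolding invariant_compact_def
  proof (intro conjI allI impI)
    show "K' \<noteq> {}"
      by (rule minimal_upper_coincides[OF ic ne(2,1), of i]) (auto simp: K'_def)
    fix \<omega> z assume z: "(\<omega>, z) \<in> K'"
    then have zK: "(\<omega>, z) \<in> K" by (simp add: K'_def)
    show "\<omega> \<in> H" "entire \<omega> z" "bounded_by B z" by (rule ic_H[OF ic zK], rule ic_entire[OF ic zK], rule ic_bounded[OF ic zK])
    fix s
    obtain p where p: "(\<omega>, p) \<in> minimal_upper B' K" "\<And>t. p t $ i = z t $ i" using z by (auto simp: K'_def)
    show "(translate \<omega> s, \<lambda>t. z (s + t)) \<in> K'"
      using ic_shift[OF ic zK, of s] minimal_upper_shift[OF ic p(1), of s] p(2)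
      unfolding K'_def by (auto intro!: exI[of _ "\<lambda>t. p (s + t)"])
  next
    fix f z \<omega> l assume z: "\<forall>n. (f n, z n) \<in> K'" and f: "ucc_lim f \<omega>" and l: "ucc_lim z l"
    then have "\<forall>n. \<exists>p. (f n, p) \<in> minimal_upper B' K \<and> (\<forall>t. p t $ i = z n t $ i)" by (auto simp: K'_def)
    then obtain p where p: "\<And>n. (f n, p n) \<in> minimal_upper B' K" "\<And>n t. p n t $ i = z n t $ i" by metis
    obtain \<sigma> \<omega>' q where \<sigma>: "strict_mono (\<sigma> :: nat \<Rightarrow> nat)" "ucc_lim (\<lambda>n. f (\<sigma> n)) \<omega>'" "ucc_lim (\<lambda>n. p (\<sigma> n)) q"
      "(\<omega>', q) \<in> minimal_upper B' K"
      by (rule minimal_upper_extract[OF ic p(1)])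
    have "\<omega>' = \<omega>" by (rule ucc_lim_unique[OF \<sigma>(2) ucc_lim_subseq[OF f \<sigma>(1)]])
    moreover have "q t $ i = l t $ i" for t
      by (rule LIMSEQ_unique[OF tendsto_vec_nth[OF ucc_lim_pointwise[OF \<sigma>(3)], of t i, unfolded p(2)]
        tendsto_vec_nth[OF ucc_lim_pointwise[OF ucc_lim_subseq[OF l \<sigma>(1)]]]])
    moreover have "(\<omega>, l) \<in> K" by (rule ic_closed[OF ic _ f l]) (use z in \<open>simp add: K'_def\<close>)
    ultimately show "(\<omega>, l) \<in> K'" using \<sigma>(4) by (auto simp: K'_def)
  qed
  moreover have "z t $ i = z' t $ i" if z: "(\<omega>, z) \<in> K'" and z': "(\<omega>, z') \<in> K'" for \<omega> z z' t
  proof -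
    have *: "z' t $ i \<le> z t $ i" if z: "(\<omega>, z) \<in> K'" and z': "(\<omega>, z') \<in> K'" for z z'
    proof -
      obtain p where p: "(\<omega>, p) \<in> minimal_upper B' K" "\<And>t. p t $ i = z t $ i" using z by (auto simp: K'_def)
      have "(\<omega>, z') \<in> K" using z' by (simp add: K'_def)
      then have "cone t (\<lambda>s. p s - z' s)" by (rule upper_setD(4)[OF minimal_upperD[OF p(1)]])
      then show ?thesis using cone_nonneg[of t "\<lambda>s. p s - z' s" t i] r_pos p(2) by simp
    qed
    show ?thesis using *[OF z z'] *[OF z' z] by simp
  qed
  ultimately show ?thesis by (rule that)
qed

text \<open>Agreement in the components already treated is inherited by subsets, so the index set
  can be exhausted by induction.\<close>

lemma ic_single_valued:
  assumes ic: "invariant_compact B K"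
  obtains K' where "K' \<subseteq> K" "invariant_compact B K'" "\<And>\<omega> z z'. (\<omega>, z) \<in> K' \<Longrightarrow> (\<omega>, z') \<in> K' \<Longrightarrow> z = z'"
proof -
  have "\<exists>K'\<subseteq>K. invariant_compact B K' \<and> (\<forall>i\<in>A. \<forall>\<omega> z z' t. (\<omega>, z) \<in> K' \<longrightarrow> (\<omega>, z') \<in> K' \<longrightarrow> z t $ i = z' t $ i)"
    if "finite A" for A
    using that
  proof (induction A)
    case empty
    then show ?case using ic by blast
  next
    case (insert i A)
    then obtain K1 where K1: "K1 \<subseteq> K" "invariant_compact B K1"
      "\<forall>i\<in>A. \<forall>\<omega> z z' t. (\<omega>, z) \<in> K1 \<longrightarrow> (\<omega>, z') \<in> K1 \<longrightarrow> z t $ i = z' t $ i" by blast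
    obtain K2 where K2: "K2 \<subseteq> K1" "invariant_compact B K2"
      "\<And>\<omega> z z' t. (\<omega>, z) \<in> K2 \<Longrightarrow> (\<omega>, z') \<in> K2 \<Longrightarrow> z t $ i = z' t $ i"
      using ic_component_determined[OF K1(2), of i] by blast
    show ?case
    proof (intro exI conjI)
      show "K2 \<subseteq> K" using K1 K2 by blast
      show "\<forall>j\<in>insert i A. \<forall>\<omega> z z' t. (\<omega>, z) \<in> K2 \<longrightarrow> (\<omega>, z') \<in> K2 \<longrightarrow> z t $ j = z' t $ j"
        using K1(3) K2(1,3) by blast
    qed (rule K2)
  qed
  from this[OF finite[of UNIV]] obtain K' where K': "K' \<subseteq> K" "invariant_compact B K'"
    "\<And>i \<omega> z z' t. (\<omega>, z) \<in> K' \<Longrightarrow> (\<omega>, z') \<in> K' \<Longrightarrow> z t $ i = z' t $ i" by blast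
  have "z = z'" if "(\<omega>, z) \<in> K'" "(\<omega>, z') \<in> K'" for \<omega> z z'
    using K'(3)[OF that] by (simp add: fun_eq_iff vec_eq_iff)
  then show ?thesis using K'(1,2) that by blast
qed

end

section \<open>Convergence to a copy of the base\<close>

lemma ucc_lim_by_subsequences:
  fixes z :: "nat \<Rightarrow> 'a::euclidean_space \<Rightarrow> 'b::metric_space"
  assumes "\<And>\<sigma>. strict_mono (\<sigma> :: nat \<Rightarrow> nat) \<Longrightarrow> \<exists>\<tau>. strict_mono (\<tau> :: nat \<Rightarrow> nat) \<and> ucc_lim (\<lambda>n. z (\<sigma> (\<tau> n))) l"
  shows "ucc_lim z l"
proof (rule ucc_limI, rule ccontr)
  fix e :: real and m assume e: "0 < e"
  assume "\<not> (\<forall>\<^sub>F n in sequentially. \<forall>x\<in>cball 0 (real m). dist (z n x) (l x) < e)"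
  from not_eventually_sequentiallyD[OF this]
  obtain \<sigma> where \<sigma>: "strict_mono (\<sigma> :: nat \<Rightarrow> nat)" "\<And>n. \<not> (\<forall>x\<in>cball 0 (real m). dist (z (\<sigma> n) x) (l x) < e)"
    by blast
  from assms[OF \<sigma>(1)] obtain \<tau> where \<tau>: "ucc_lim (\<lambda>n. z (\<sigma> (\<tau> n))) l" by blast
  have "\<forall>\<^sub>F n in sequentially. \<forall>x\<in>cball 0 (real m). dist (z (\<sigma> (\<tau> n)) x) (l x) < e"
    by (rule ucc_limD[OF \<tau> compact_cball e])
  from eventually_happens'[OF sequentially_bot this] show False using \<sigma>(2) by blast
qed

context compartmental
begin

text \<open>Comparison with the zero solution; \<open>stability\<close> draws here on the Lipschitz
  hypothesis on the initial value.\<close>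

lemma solution_bounded_lipschitz:
  assumes \<omega>: "\<omega> \<in> H" and z: "solves \<omega> 0 z" and B: "\<And>s i. s \<le> 0 \<Longrightarrow> \<bar>z s $ i\<bar> \<le> B" and C: "0 \<le> C"
    and lip: "\<And>s s' i. s \<le> s' \<Longrightarrow> s' \<le> 0 \<Longrightarrow> \<bar>z s' $ i - z s $ i\<bar> \<le> C * (s' - s)"
  obtains B' \<Lambda> where "bounded_by B' z" "lip_by \<Lambda> z"
proof -
  have B0: "0 \<le> B" using B[of 0] abs_ge_zero order_trans by blast
  have "\<bar>z t $ i\<bar> \<le> stab_const * (B + C) + B" for t i
  proof (cases "t \<le> 0")
    case True
    then show ?thesis using B[OF True, of i] stab_const_pos B0 C by (smt (verit) mult_nonneg_nonneg)
  next
    case False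
    have "\<bar>z t $ i - (0 :: real ^ 'm) $ i\<bar> \<le> stab_const * (B + C)"
      by (rule stability[OF \<omega> z solves_zero[OF \<omega>] B0 C]) (use B lip False in auto)
    then show ?thesis using B0 by simp
  qed
  then have b: "bounded_by (stab_const * (B + C) + B) z" by (simp add: bounded_by_def)
  show ?thesis by (rule that[OF b solution_lipschitz[OF \<omega> z b C lip]])
qed

text \<open>Convergence is required on two-sided windows \<open>cball 0 R\<close>, so that the
  limits are functions on the whole line. Approximation at arbitrarily late times, in place of a
  sequence, reduces closedness to the triangle inequality.\<close>

definition limit_set :: "(real \<times> real \<Rightarrow> real ^ 'm ^ 'm) \<Rightarrow> (real \<Rightarrow> real ^ 'm) \<Rightarrow>
    ((real \<times> real \<Rightarrow> real ^ 'm ^ 'm) \<times> (real \<Rightarrow> real ^ 'm)) set" where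
  "limit_set \<omega>0 z0 = {(\<omega>, z). \<forall>R e T. 0 < e \<longrightarrow> (\<exists>t\<ge>T.
     (\<forall>x\<in>cball 0 R. dist (translate \<omega>0 t x) (\<omega> x) < e) \<and> (\<forall>s\<in>cball 0 R. dist (z0 (t + s)) (z s) < e))}"

lemma limit_setD:
  assumes "(\<omega>, z) \<in> limit_set \<omega>0 z0" "0 < e"
  obtains t where "T \<le> t" "\<And>x. x \<in> cball 0 R \<Longrightarrow> dist (translate \<omega>0 t x) (\<omega> x) < e"
    "\<And>s. s \<in> cball 0 R \<Longrightarrow> dist (z0 (t + s)) (z s) < e"
  using assms unfolding limit_set_def by blast

lemma limit_set_seq:
  assumes "(\<omega>, z) \<in> limit_set \<omega>0 z0"
  obtains \<tau> where "incseq \<tau>" "\<And>n. real n \<le> \<tau> n" "ucc_lim (\<lambda>n. translate \<omega>0 (\<tau> n)) \<omega>" "ucc_lim (\<lambda>n s. z0 (\<tau> n + s)) z"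
proof -
  let ?P = "\<lambda>n t. real n \<le> t \<and> (\<forall>x\<in>cball 0 (real n). dist (translate \<omega>0 t x) (\<omega> x) < inverse (real (Suc n))) \<and>
    (\<forall>s\<in>cball 0 (real n). dist (z0 (t + s)) (z s) < inverse (real (Suc n)))"
  have ex: "\<exists>t. ?P n t \<and> T \<le> t" for n T
    by (rule limit_setD[OF assms, of "inverse (real (Suc n))" "max (real n) T" "real n"]) auto
  have "\<exists>\<tau>. \<forall>n. ?P n (\<tau> n) \<and> \<tau> n \<le> \<tau> (Suc n)"
    by (rule dependent_nat_choice) (use ex in blast)+
  then obtain \<tau> where \<tau>: "\<And>n. ?P n (\<tau> n)" "\<And>n. \<tau> n \<le> \<tau> (Suc n)" by blast
  show ?thesis
  proof (rule that)
    show "incseq \<tau>" using \<tau>(2) by (rule incseq_SucI)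
    show "real n \<le> \<tau> n" for n using \<tau>(1) by blast
    show "ucc_lim (\<lambda>n. translate \<omega>0 (\<tau> n)) \<omega>" "ucc_lim (\<lambda>n s. z0 (\<tau> n + s)) z"
      by (rule ucc_limI_balls, use \<tau>(1) in blast)+
  qed
qed

text \<open>Translation by \<tau> n moves the starting time to - \<tau> n, so that limits are
  entire; the bound and the Lipschitz constant of \<open>z0\<close> give compactness.\<close>

lemma limit_set_invariant_compact:
  assumes \<omega>0: "\<omega>0 \<in> H" and z0: "solves \<omega>0 0 z0" and B: "bounded_by B z0" and \<Lambda>: "lip_by \<Lambda> z0"
  shows "invariant_compact B (limit_set \<omega>0 z0)"
proof -
  have sol: "\<forall>\<^sub>F n in sequentially. solves (translate \<omega>0 (\<tau> n)) t0 (\<lambda>s. z0 (\<tau> n + s))"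
    if \<tau>: "\<And>n. real n \<le> \<tau> n" for \<tau> t0
  proof -
    obtain N where N: "- t0 \<le> real N" using real_arch_simple by blast
    show ?thesis
    proof (rule eventually_sequentiallyI[of N])
      fix n assume "N \<le> n"
      then have "0 - \<tau> n \<le> t0" using N \<tau>[of n] by linarith
      then show "solves (translate \<omega>0 (\<tau> n)) t0 (\<lambda>s. z0 (\<tau> n + s))"
        by (rule solves_later[OF solves_shift[OF z0]])
    qed
  qed
  show ?thesis
    unfolding invariant_compact_def
  proof (intro conjI allI impI)
    obtain \<sigma> \<omega> l where \<sigma>: "strict_mono (\<sigma> :: nat \<Rightarrow> nat)" "ucc_lim (\<lambda>n. translate \<omega>0 (real (\<sigma> n))) \<omega>"
      "ucc_lim (\<lambda>n s. z0 (real (\<sigma> n) + s)) l"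
      by (rule extract_entire[of "\<lambda>n. translate \<omega>0 (real n)" B "\<lambda>n s. z0 (real n + s)" \<Lambda>])
        (use H_translate[OF \<omega>0] bounded_by_shift[OF B] lip_by_shift[OF \<Lambda>] sol[of real] in auto)
    have "(\<omega>, l) \<in> limit_set \<omega>0 z0"
      unfolding limit_set_def
    proof (intro CollectI case_prodI allI impI)
      fix R e T :: real assume e: "0 < e"
      obtain N where N: "T \<le> real N" using real_arch_simple by blast
      have "\<forall>\<^sub>F n in sequentially. N \<le> n \<and> (\<forall>x\<in>cball 0 R. dist (translate \<omega>0 (real (\<sigma> n)) x) (\<omega> x) < e) \<and>
          (\<forall>s\<in>cball 0 R. dist (z0 (real (\<sigma> n) + s)) (l s) < e)"
        by (intro eventually_conj eventually_ge_at_top ucc_limD[OF \<sigma>(2) compact_cball e] ucc_limD[OF \<sigma>(3) compact_cball e])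
      from eventually_happens'[OF sequentially_bot this]
      obtain n where n: "N \<le> n" "\<forall>x\<in>cball 0 R. dist (translate \<omega>0 (real (\<sigma> n)) x) (\<omega> x) < e"
          "\<forall>s\<in>cball 0 R. dist (z0 (real (\<sigma> n) + s)) (l s) < e"
        by blast
      have "T \<le> real (\<sigma> n)" using N n(1) seq_suble[OF \<sigma>(1), of n] by linarith
      then show "\<exists>t\<ge>T. (\<forall>x\<in>cball 0 R. dist (translate \<omega>0 t x) (\<omega> x) < e) \<and> (\<forall>s\<in>cball 0 R. dist (z0 (t + s)) (l s) < e)"
        using n(2,3) by blast
    qed
    then show "limit_set \<omega>0 z0 \<noteq> {}" by blast
  next
    fix \<omega> z assume z: "(\<omega>, z) \<in> limit_set \<omega>0 z0"
    obtain \<tau> where \<tau>: "\<And>n. real n \<le> \<tau> n" "ucc_lim (\<lambda>n. translate \<omega>0 (\<tau> n)) \<omega>" "ucc_lim (\<lambda>n s. z0 (\<tau> n + s)) z"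
      by (rule limit_set_seq[OF z]) (rule that)
    show "\<omega> \<in> H" by (rule H_closed[OF H_translate[OF \<omega>0] \<tau>(2)])
    show "bounded_by B z" by (rule bounded_by_limit[OF bounded_by_shift[OF B] ucc_lim_pointwise[OF \<tau>(3)]])
    have "solves \<omega> t0 z" for t0
      by (rule solves_limit[OF H_translate[OF \<omega>0] \<tau>(2,3) bounded_by_shift[OF B] lip_by_shift[OF \<Lambda>] sol[OF \<tau>(1)]])
    then show "entire \<omega> z" by (simp add: entire_def)
    fix s
    show "(translate \<omega> s, \<lambda>t. z (s + t)) \<in> limit_set \<omega>0 z0"
      unfolding limit_set_def
    proof (intro CollectI case_prodI allI impI)
      fix R e T :: real assume e: "0 < e"
      obtain t where t: "T - s \<le> t" "\<And>x. x \<in> cball 0 (R + \<bar>s\<bar>) \<Longrightarrow> dist (translate \<omega>0 t x) (\<omega> x) < e"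
          "\<And>u. u \<in> cball 0 (R + \<bar>s\<bar>) \<Longrightarrow> dist (z0 (t + u)) (z u) < e"
        by (rule limit_setD[OF z e, of "T - s" "R + \<bar>s\<bar>"]) (rule that, assumption, blast+)
      have "dist (translate \<omega>0 (t + s) x) (translate \<omega> s x) < e" if x: "x \<in> cball 0 R" for x
      proof -
        have "norm ((s, 0::real) + x) \<le> \<bar>s\<bar> + R"
          using norm_triangle_ineq[of "(s, 0::real)" x] x by (simp add: norm_Pair)
        then have "dist (translate \<omega>0 t ((s, 0) + x)) (\<omega> ((s, 0) + x)) < e" by (intro t(2)) (simp add: add.commute)
        then show ?thesis by (cases x) (simp add: add.assoc)
      qed
      moreover have "dist (z0 (t + s + u)) (z (s + u)) < e" if u: "u \<in> cball 0 R" for u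
        using t(3)[of "s + u"] u by (auto simp: add.assoc)
      ultimately show "\<exists>t\<ge>T. (\<forall>x\<in>cball 0 R. dist (translate \<omega>0 t x) (translate \<omega> s x) < e) \<and>
          (\<forall>u\<in>cball 0 R. dist (z0 (t + u)) (z (s + u)) < e)"
        using t(1) by (intro exI[of _ "t + s"]) auto
    qed
  next
    fix f z \<omega> l assume fz: "\<forall>n. (f n, z n) \<in> limit_set \<omega>0 z0" and f: "ucc_lim f \<omega>" and z: "ucc_lim z l"
    show "(\<omega>, l) \<in> limit_set \<omega>0 z0"
      unfolding limit_set_def
    proof (intro CollectI case_prodI allI impI)
      fix R e T :: real assume e: "0 < e"
      have "\<forall>\<^sub>F n in sequentially. (\<forall>x\<in>cball 0 R. dist (f n x) (\<omega> x) < e / 2) \<and> (\<forall>s\<in>cball 0 R. dist (z n s) (l s) < e / 2)"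
        using e by (intro eventually_conj ucc_limD[OF f compact_cball] ucc_limD[OF z compact_cball]) auto
      from eventually_happens'[OF sequentially_bot this]
      obtain n where n: "\<forall>x\<in>cball 0 R. dist (f n x) (\<omega> x) < e / 2" "\<forall>s\<in>cball 0 R. dist (z n s) (l s) < e / 2"
        by blast
      obtain t where t: "T \<le> t" "\<And>x. x \<in> cball 0 R \<Longrightarrow> dist (translate \<omega>0 t x) (f n x) < e / 2"
          "\<And>s. s \<in> cball 0 R \<Longrightarrow> dist (z0 (t + s)) (z n s) < e / 2"
        using limit_setD[OF fz[rule_format, of n] half_gt_zero[OF e]] by metis
      have "dist (translate \<omega>0 t x) (\<omega> x) < e" if "x \<in> cball 0 R" for x
        using dist_triangle[of "translate \<omega>0 t x" "\<omega> x" "f n x"] t(2)[OF that] bspec[OF n(1) that] by linarith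
      moreover have "dist (z0 (t + s)) (l s) < e" if "s \<in> cball 0 R" for s
        using dist_triangle[of "z0 (t + s)" "l s" "z n s"] t(3)[OF that] bspec[OF n(2) that] by linarith
      ultimately show "\<exists>t\<ge>T. (\<forall>x\<in>cball 0 R. dist (translate \<omega>0 t x) (\<omega> x) < e) \<and> (\<forall>s\<in>cball 0 R. dist (z0 (t + s)) (l s) < e)"
        using t(1) by blast
    qed
  qed
qed

text \<open>Here \<open>c \<omega>\<close> is the whole entire solution over \<open>\<omega>\<close>; its restriction to \<open>(-\<infinity>, 0]\<close> is the equilibrium.\<close>

theorem asymptotic_copy_of_base:
  assumes \<omega>0: "\<omega>0 \<in> H" and z0: "solves \<omega>0 0 z0" and B: "bounded_by B z0" and \<Lambda>: "lip_by \<Lambda> z0"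
  obtains c \<Lambda>' where "\<And>\<omega>. \<omega> \<in> H \<Longrightarrow> entire \<omega> (c \<omega>)" "\<And>\<omega>. \<omega> \<in> H \<Longrightarrow> bounded_by B (c \<omega>)" "\<And>\<omega>. \<omega> \<in> H \<Longrightarrow> lip_by \<Lambda>' (c \<omega>)"
    "\<And>\<omega> s. \<omega> \<in> H \<Longrightarrow> c (translate \<omega> s) = (\<lambda>t. c \<omega> (s + t))"
    "\<And>f \<omega>. (\<And>n. f n \<in> H) \<Longrightarrow> ucc_lim f \<omega> \<Longrightarrow> ucc_lim (\<lambda>n. c (f n)) (c \<omega>)"
    "\<And>e. 0 < e \<Longrightarrow> \<exists>T. \<forall>t\<ge>T. \<forall>i. \<bar>z0 t $ i - c \<omega>0 t $ i\<bar> \<le> e"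
    "\<And>\<omega>. \<omega> \<in> H \<Longrightarrow> \<exists>\<tau>. incseq \<tau> \<and> (\<forall>n. real n \<le> \<tau> n) \<and> ucc_lim (\<lambda>n. translate \<omega>0 (\<tau> n)) \<omega>"
proof -
  obtain K where K: "K \<subseteq> limit_set \<omega>0 z0" and ic: "invariant_compact B K"
    and single: "\<And>\<omega> z z'. (\<omega>, z) \<in> K \<Longrightarrow> (\<omega>, z') \<in> K \<Longrightarrow> z = z'"
    by (rule ic_single_valued[OF limit_set_invariant_compact[OF assms]]) (rule that, assumption+)
  define c where "c \<omega> = (THE z. (\<omega>, z) \<in> K)" for \<omega>
  have cI: "c \<omega> = z" if "(\<omega>, z) \<in> K" for \<omega> z
    unfolding c_def using that single by blast
  have cK: "(\<omega>, c \<omega>) \<in> K" if "\<omega> \<in> H" for \<omega>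
    using ic_projection[OF ic that] cI by metis
  have cont: "ucc_lim (\<lambda>n. c (f n)) (c \<omega>)" if fH: "\<And>n. f n \<in> H" and f: "ucc_lim f \<omega>" for f \<omega>
  proof (rule ucc_lim_by_subsequences)
    fix \<sigma> :: "nat \<Rightarrow> nat" assume \<sigma>: "strict_mono \<sigma>"
    obtain \<tau> \<omega>' l where \<tau>: "strict_mono (\<tau> :: nat \<Rightarrow> nat)" "ucc_lim (\<lambda>n. f (\<sigma> (\<tau> n))) \<omega>'" "ucc_lim (\<lambda>n. c (f (\<sigma> (\<tau> n)))) l" "(\<omega>', l) \<in> K"
      by (rule ic_extract[OF ic, of "\<lambda>n. f (\<sigma> n)" "\<lambda>n. c (f (\<sigma> n))"]) (use cK[OF fH] in auto)
    have "\<omega>' = \<omega>" by (rule ucc_lim_unique[OF \<tau>(2) ucc_lim_subseq[OF ucc_lim_subseq[OF f \<sigma>] \<tau>(1)]])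
    then have "l = c \<omega>" using cI[OF \<tau>(4)] by simp
    then show "\<exists>\<tau>. strict_mono (\<tau> :: nat \<Rightarrow> nat) \<and> ucc_lim (\<lambda>n. c (f (\<sigma> (\<tau> n)))) (c \<omega>)" using \<tau>(1,3) by blast
  qed
  have shift: "c (translate \<omega> s) = (\<lambda>t. c \<omega> (s + t))" if "\<omega> \<in> H" for \<omega> s
    by (rule cI[OF ic_shift[OF ic cK[OF that]]])
  have asym: "\<exists>T. \<forall>t\<ge>T. \<forall>i. \<bar>z0 t $ i - c \<omega>0 t $ i\<bar> \<le> e" if e: "0 < e" for e
  proof -
    define L where "L = max \<Lambda> (lip_const B 0)"
    have L: "lip_by L z0" "lip_by L (c \<omega>0)"
      using lip_by_mono[OF \<Lambda>, of L] lip_by_mono[OF ic_lip[OF ic cK[OF \<omega>0]], of L] by (auto simp: L_def)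
    obtain \<delta> R where \<delta>: "0 < \<delta>" "r \<le> R" and stab: "\<And>\<omega> t0 z w t i. \<omega> \<in> H \<Longrightarrow> solves \<omega> (t0 - R) z \<Longrightarrow> solves \<omega> (t0 - R) w \<Longrightarrow>
       lip_by L z \<Longrightarrow> lip_by L w \<Longrightarrow> (\<And>s i. t0 - R \<le> s \<Longrightarrow> s \<le> t0 \<Longrightarrow> \<bar>z s $ i - w s $ i\<bar> \<le> \<delta>) \<Longrightarrow>
       t0 \<le> t \<Longrightarrow> \<bar>z t $ i - w t $ i\<bar> \<le> e"
      using stability_small[OF e lip_by_nonneg[OF L(1)]] by blast
    \<comment> \<open>Along these times \<open>z0\<close> approaches \<open>c \<omega>0\<close>, and
      by continuity of \<open>c\<close> so do the translates of \<open>c \<omega>0\<close> itself.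
      Hence the two are close on one long window, from which stability takes over.\<close>
    obtain \<tau> where \<tau>: "\<And>n. real n \<le> \<tau> n" "ucc_lim (\<lambda>n. translate \<omega>0 (\<tau> n)) \<omega>0" "ucc_lim (\<lambda>n s. z0 (\<tau> n + s)) (c \<omega>0)"
      by (rule limit_set_seq[OF subsetD[OF K cK[OF \<omega>0]]]) (rule that)
    have c\<tau>: "ucc_lim (\<lambda>n s. c \<omega>0 (\<tau> n + s)) (c \<omega>0)"
      using cont[OF H_translate[OF \<omega>0] \<tau>(2)] by (simp add: shift[OF \<omega>0])
    obtain N where N: "R \<le> real N" using real_arch_simple by blast
    have "\<forall>\<^sub>F n in sequentially. N \<le> n \<and> (\<forall>s\<in>{- R..0}. dist (z0 (\<tau> n + s)) (c \<omega>0 s) < \<delta> / 2) \<and>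
        (\<forall>s\<in>{- R..0}. dist (c \<omega>0 (\<tau> n + s)) (c \<omega>0 s) < \<delta> / 2)"
      using \<delta>(1) by (intro eventually_conj eventually_ge_at_top ucc_limD[OF \<tau>(3)] ucc_limD[OF c\<tau>]) auto
    from eventually_happens'[OF sequentially_bot this]
      obtain n where n: "N \<le> n" "\<forall>s\<in>{- R..0}. dist (z0 (\<tau> n + s)) (c \<omega>0 s) < \<delta> / 2"
        "\<forall>s\<in>{- R..0}. dist (c \<omega>0 (\<tau> n + s)) (c \<omega>0 s) < \<delta> / 2"
        by blast
    have R\<tau>: "0 \<le> \<tau> n - R" using N n(1) \<tau>(1)[of n] by linarith
    have "\<bar>z0 t $ i - c \<omega>0 t $ i\<bar> \<le> e" if t: "\<tau> n \<le> t" for t i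
    proof (rule stab[OF \<omega>0, of "\<tau> n" z0 "c \<omega>0" t i])
      show "solves \<omega>0 (\<tau> n - R) z0" by (rule solves_later[OF z0 R\<tau>])
      show "solves \<omega>0 (\<tau> n - R) (c \<omega>0)" using ic_entire[OF ic cK[OF \<omega>0]] by (simp add: entire_def)
      fix s j assume s: "\<tau> n - R \<le> s" "s \<le> \<tau> n"
      then have "s - \<tau> n \<in> {- R..0}" by simp
      then have "dist (z0 s) (c \<omega>0 (s - \<tau> n)) < \<delta> / 2" "dist (c \<omega>0 s) (c \<omega>0 (s - \<tau> n)) < \<delta> / 2"
        using n(2,3) by (metis add.commute diff_add_cancel)+
      then have "dist (z0 s) (c \<omega>0 s) < \<delta>" using dist_triangle2[of "z0 s" "c \<omega>0 s" "c \<omega>0 (s - \<tau> n)"] by linarith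
      then show "\<bar>z0 s $ j - c \<omega>0 s $ j\<bar> \<le> \<delta>"
        using component_le_norm_cart[of "z0 s - c \<omega>0 s" j] by (simp add: dist_norm)
    qed (use L t in auto)
    then show ?thesis by blast
  qed
  have rec: "\<exists>\<tau>. incseq \<tau> \<and> (\<forall>n. real n \<le> \<tau> n) \<and> ucc_lim (\<lambda>n. translate \<omega>0 (\<tau> n)) \<omega>" if "\<omega> \<in> H" for \<omega>
    using limit_set_seq[of \<omega> "c \<omega>" \<omega>0 z0] cK[OF that] K by blast
  show ?thesis
    by (rule that[of c "lip_const B 0"])
      (use ic_entire[OF ic cK] ic_bounded[OF ic cK] ic_lip[OF ic cK] shift cont asym rec in auto)
qed

section \<open>Translation to the solutions and the metric of the statement\<close>

text \<open>Since no delay is negative, D and F evaluate a segment only on the half-line where it is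
  given by \<open>z\<close>, and the vector derivative can be taken componentwise.\<close>

lemma nfde_solution_iff:
  "nfde_solution \<gamma> \<alpha> \<rho> \<omega> x z \<longleftrightarrow> solves \<omega> 0 z \<and> (\<forall>s\<le>0. z s = x s)"
proof -
  have D: "D_op \<gamma> \<alpha> (segment z t) = (\<chi> i. D_at z t i)" for t
    using alp(1) by (simp add: D_op_def D_at_def segment_def less_imp_le)
  have F: "F_op \<rho> (translate \<omega> t) (segment z t) = (\<chi> i. rhs \<omega> z t i)" for t
    using rho(1) by (simp add: F_op_def rhs_def segment_def g_hull_def)
  have "((\<lambda>t. \<chi> i. D_at z t i) has_vector_derivative (\<chi> i. rhs \<omega> z t i)) (at t within {0..}) \<longleftrightarrow>
     (\<forall>i. ((\<lambda>t. D_at z t i) has_real_derivative rhs \<omega> z t i) (at t within {0..}))" for t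
  proof -
    have "((\<lambda>t. \<chi> i. D_at z t i) has_vector_derivative (\<chi> i. rhs \<omega> z t i)) (at t within {0..}) \<longleftrightarrow>
      (\<forall>b\<in>(Basis :: (real ^ 'm) set). ((\<lambda>t. (\<chi> i. D_at z t i) \<bullet> b) has_derivative (\<lambda>h. (h *\<^sub>R (\<chi> i. rhs \<omega> z t i)) \<bullet> b)) (at t within {0..}))"
      unfolding has_vector_derivative_def by (rule has_derivative_componentwise_within)
    also have "\<dots> \<longleftrightarrow> (\<forall>i. ((\<lambda>t. D_at z t i) has_derivative (\<lambda>h. h * rhs \<omega> z t i)) (at t within {0..}))"
      by (auto simp: Basis_vec_def inner_axis)
    also have "\<dots> \<longleftrightarrow> (\<forall>i. ((\<lambda>t. D_at z t i) has_real_derivative rhs \<omega> z t i) (at t within {0..}))"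
      by (simp add: has_field_derivative_def mult.commute[of _ "rhs \<omega> z t _"] mult_commute_abs)
    finally show ?thesis .
  qed
  then show ?thesis unfolding nfde_solution_def solves_def D F by blast
qed

lemma has_sol_if:
  assumes "\<omega> \<in> H" "nfde_solution \<gamma> \<alpha> \<rho> \<omega> x z"
  shows "has_sol \<gamma> \<alpha> \<rho> \<omega> x" "sol \<gamma> \<alpha> \<rho> \<omega> x = z"
proof -
  have "z' = z" if "nfde_solution \<gamma> \<alpha> \<rho> \<omega> x z'" for z'
  proof
    fix t
    show "z' t = z t"
    proof (cases "t \<le> 0")
      case True
      then show ?thesis using assms(2) that by (simp add: nfde_solution_iff)
    next
      case False
      have h: "solves \<omega> 0 z'" "solves \<omega> 0 z" "\<And>s. s \<le> 0 \<Longrightarrow> z' s = z s"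
        using assms(2) that by (simp_all add: nfde_solution_iff)
      show ?thesis by (rule solves_unique[OF assms(1) h(1,2)]) (use h(3) False r_pos in auto)
    qed
  qed
  note unique = this
  show "has_sol \<gamma> \<alpha> \<rho> \<omega> x" unfolding has_sol_def using assms(2) unique by blast
  show "sol \<gamma> \<alpha> \<rho> \<omega> x = z" unfolding sol_def using assms(2) unique by (rule the_equality)
qed

end

lemma sum_half_powers: "(\<Sum>k<N. (1 / 2 :: real) ^ Suc k) \<le> 1"
proof -
  have "(\<Sum>k<N. (1 / 2 :: real) ^ Suc k) = 1 - (1 / 2) ^ N"
    by (induction N) auto
  then show ?thesis by simp
qed

text \<open>The tail of the series beyond \<open>N\<close> is at most 2^(-N) < e/2, and the first
  \<open>N\<close> terms, whose weights sum to at most 1, contribute at most e/3.\<close>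

lemma dist_X_small:
  assumes "0 < e"
  shows "\<exists>N. \<forall>x\<in>X_space. \<forall>y\<in>X_space. (\<forall>s. - real N \<le> s \<longrightarrow> s \<le> 0 \<longrightarrow>
    norm (x s - y s :: real ^ 'm::finite) \<le> e / 3) \<longrightarrow> dist_X x y < e"
proof -
  obtain N where N: "(1 / 2 :: real) ^ N < e / 2"
    using real_arch_pow_inv[of "e / 2" "1 / 2 :: real"] assms by auto
  have "dist_X x y < e" if x: "x \<in> X_space" and y: "y \<in> X_space"
    and small: "\<And>s. - real N \<le> s \<Longrightarrow> s \<le> 0 \<Longrightarrow> norm (x s - y s) \<le> e / 3" for x y :: "real \<Rightarrow> real ^ 'm"
  proof -
    define a where "a k = (let n = Suc k; q = seminorm_X n (\<lambda>s. x s - y s) in (1 / 2 :: real) ^ n * (q / (1 + q)))" for k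
    have sa: "summable a" unfolding a_def by (rule dist_X_summable[OF x y])
    have geo: "summable (\<lambda>k. (1 / 2 :: real) ^ Suc (k + N))"
      using summable_geometric[of "1 / 2 :: real"] summable_ignore_initial_segment[of "\<lambda>k. (1 / 2 :: real) ^ k" "Suc N"] by simp
    have "(\<lambda>k. (1 / 2) ^ N / 2 * (1 / 2 :: real) ^ k) sums ((1 / 2) ^ N / 2 * (1 / (1 - 1 / 2)))"
      by (intro sums_mult geometric_sums) simp
    then have tail: "(\<Sum>k. (1 / 2 :: real) ^ Suc (k + N)) = (1 / 2) ^ N"
      by (intro sums_unique[symmetric]) (simp add: power_add mult_ac)
    have "dist_X x y = suminf a" unfolding a_def by (rule dist_X_eq[OF x y])
    also have "\<dots> = (\<Sum>k. a (k + N)) + (\<Sum>k<N. a k)" by (rule suminf_split_initial_segment[OF sa])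
    also have "(\<Sum>k. a (k + N)) \<le> (\<Sum>k. (1 / 2 :: real) ^ Suc (k + N))"
      using dist_X_term_bounds(2)[OF x y, of "k + N" for k]
      by (intro suminf_le summable_ignore_initial_segment sa geo) (simp add: a_def)
    also have "(\<Sum>k<N. a k) \<le> (\<Sum>k<N. (1 / 2) ^ Suc k * (e / 3))"
    proof (rule sum_mono)
      fix k assume k: "k \<in> {..<N}"
      define q where "q = seminorm_X (Suc k) (\<lambda>s. x s - y s)"
      have q0: "0 \<le> q" unfolding q_def by (rule dist_X_seminorm_nonneg[OF x y])
      have "q \<le> e / 3"
        unfolding q_def seminorm_X_def
      proof (rule cSUP_least)
        fix s assume "s \<in> {- real (Suc k)..0}"
        moreover have "real (Suc k) \<le> real N" using k by simp
        ultimately have "norm (x s - y s) \<le> e / 3" by (intro small) auto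
        then show "infnorm (x s - y s) \<le> e / 3" using infnorm_le_norm[of "x s - y s"] by linarith
      qed simp
      moreover have "q / (1 + q) \<le> q" using q0 by (simp add: pos_divide_le_eq distrib_left)
      ultimately have "q / (1 + q) \<le> e / 3" by linarith
      then show "a k \<le> (1 / 2) ^ Suc k * (e / 3)"
        unfolding a_def Let_def q_def[symmetric] by (intro mult_left_mono) auto
    qed
    also have "\<dots> = (\<Sum>k<N. (1 / 2) ^ Suc k) * (e / 3)" by (rule sum_distrib_right[symmetric])
    also have "\<dots> \<le> 1 * (e / 3)" using assms by (intro mult_right_mono sum_half_powers) auto
    finally show ?thesis using tail N assms by linarith
  qed
  then show ?thesis by (intro exI[of _ N]) simp
qed

section \<open>The hull\<close>

lemma mono_deriv_nonneg:
  fixes f :: "real \<Rightarrow> real"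
  assumes "mono f" "(f has_real_derivative D) (at x)"
  shows "0 \<le> D"
proof (rule ccontr)
  assume "\<not> 0 \<le> D"
  then obtain d where d: "0 < d" "\<And>h. 0 < h \<Longrightarrow> h < d \<Longrightarrow> f (x + h) < f x"
    using DERIV_neg_dec_right[OF assms(2)] by auto
  have "f (x + d / 2) < f x" using d(1) by (intro d(2)) auto
  moreover have "f x \<le> f (x + d / 2)" using assms(1) d(1) by (intro monoD[of f]) auto
  ultimately show False by simp
qed

lemma norm_matrix_le_card:
  fixes A :: "real ^ 'n::finite ^ 'm::finite"
  assumes "\<And>i j. \<bar>A $ i $ j\<bar> \<le> e"
  shows "norm A \<le> real CARD('m) * (real CARD('n) * e)"
proof -
  have "norm A \<le> (\<Sum>i\<in>UNIV. norm (A $ i))"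
    unfolding norm_vec_def by (rule L2_set_le_sum) simp
  also have "\<dots> \<le> (\<Sum>i\<in>(UNIV :: 'm set). real CARD('n) * e)"
    by (intro sum_mono norm_vec_le_card assms)
  finally show ?thesis by simp
qed

lemma hull_of_iff:
  fixes g :: "real \<times> real \<Rightarrow> 'b::metric_space"
  shows "\<omega> \<in> hull_of g \<longleftrightarrow> (\<exists>\<tau>. ucc_lim (\<lambda>n. translate g (\<tau> n)) \<omega>)"
proof
  assume "\<omega> \<in> hull_of g"
  then obtain f where f: "\<And>n. f n \<in> range (translate g)" "ucc_lim f \<omega>"
    unfolding hull_of_def ucc_closure_seq by blast
  then have "\<forall>n. \<exists>t. f n = translate g t" by blast
  then obtain \<tau> where "\<And>n. f n = translate g (\<tau> n)" by metis
  then have "f = (\<lambda>n. translate g (\<tau> n))" by blast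
  then show "\<exists>\<tau>. ucc_lim (\<lambda>n. translate g (\<tau> n)) \<omega>" using f(2) by blast
next
  assume "\<exists>\<tau>. ucc_lim (\<lambda>n. translate g (\<tau> n)) \<omega>"
  then obtain \<tau> where "ucc_lim (\<lambda>n. translate g (\<tau> n)) \<omega>" ..
  then show "\<omega> \<in> hull_of g"
    unfolding hull_of_def ucc_closure_seq by (intro exI[of _ "\<lambda>n. translate g (\<tau> n)"]) simp
qed

lemma hull_of_translate:
  assumes "\<omega> \<in> hull_of g"
  shows "translate \<omega> t \<in> hull_of g"
proof -
  obtain \<tau> where "ucc_lim (\<lambda>n. translate g (\<tau> n)) \<omega>" using assms unfolding hull_of_iff by blast
  then have "ucc_lim (\<lambda>n. translate g (\<tau> n + t)) (translate \<omega> t)"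
    using ucc_translate[of "\<lambda>n. translate g (\<tau> n)" \<omega> t] by simp
  then show ?thesis unfolding hull_of_iff by (rule exI[of _ "\<lambda>n. \<tau> n + t"])
qed

lemma hull_of_closed:
  fixes g :: "real \<times> real \<Rightarrow> 'b::metric_space"
  assumes "\<And>n. f n \<in> hull_of g" "ucc_lim f \<omega>"
  shows "\<omega> \<in> hull_of g"
proof -
  have "\<omega> \<in> ucc_topology closure_of hull_of g" unfolding ucc_closure_seq using assms by blast
  then show ?thesis by (simp add: hull_of_def closure_of_closure_of)
qed

text \<open>\<open>recurrent\<close> speaks of sets that every translation maps onto themselves;
  applying the inclusion to -t as well gives equality. Closedness is tested by sequences.\<close>

lemma hull_of_minimal:
  fixes g :: "real \<times> real \<Rightarrow> 'b::metric_space"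
  assumes rec: "recurrent g" and S: "S \<subseteq> hull_of g" "S \<noteq> {}" and inv: "\<And>\<omega> t. \<omega> \<in> S \<Longrightarrow> translate \<omega> t \<in> S"
    and closed: "\<And>f \<omega>. (\<And>n. f n \<in> S) \<Longrightarrow> ucc_lim f \<omega> \<Longrightarrow> \<omega> \<in> S"
  shows "S = hull_of g"
proof -
  have "ucc_topology closure_of S = S"
    using closed closure_of_subset[of S ucc_topology] unfolding set_eq_iff ucc_closure_seq
    by (metis subsetD subset_UNIV topspace_ucc_topology ucc_lim_const)
  then have "closedin ucc_topology S" by (simp add: closure_of_eq)
  then have "closedin (hull_topology g) S"
    using S(1) unfolding hull_topology_def closedin_subtopology by blast
  moreover have "(\<lambda>\<omega>. translate \<omega> t) ` S = S" for t
  proof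
    show "(\<lambda>\<omega>. translate \<omega> t) ` S \<subseteq> S" using inv by blast
    show "S \<subseteq> (\<lambda>\<omega>. translate \<omega> t) ` S"
    proof
      fix \<omega> assume "\<omega> \<in> S"
      then show "\<omega> \<in> (\<lambda>\<omega>. translate \<omega> t) ` S"
        by (intro image_eqI[of _ _ "translate \<omega> (- t)"] inv) simp_all
    qed
  qed
  ultimately show ?thesis using rec S(2) unfolding recurrent_def by blast
qed

section \<open>Bounds and compactness inherited by the hull\<close>

lemma C1_admissible_deriv:
  fixes g :: "real \<times> real \<Rightarrow> real ^ 'm ^ 'm::finite"
  assumes "C1_admissible g"
  shows "((\<lambda>w. g (t, w) $ i $ j) has_real_derivative deriv_v g (t, v) $ i $ j) (at v)"
proof -
  have "(\<lambda>w. g (t, w)) differentiable at v"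
    using assms by (auto simp: C1_admissible_def C1_differentiable_on_eq)
  then have "((\<lambda>w. g (t, w)) has_vector_derivative deriv_v g (t, v)) (at v)"
    by (simp add: deriv_v_def vector_derivative_works)
  then have "((\<lambda>w. g (t, w) $ i $ j) has_vector_derivative deriv_v g (t, v) $ i $ j) (at v)"
    by (intro bounded_linear.has_vector_derivative[OF bounded_linear_vec_nth])
  then show ?thesis by (simp add: has_real_derivative_iff_has_vector_derivative)
qed

definition lp_real :: "(real \<times> real \<Rightarrow> real ^ 'm ^ 'm) \<Rightarrow> 'm::finite \<Rightarrow> 'm \<Rightarrow> real" where
  "lp_real g i j = real_of_ereal (l_plus g i j)"

definition lm_real :: "(real \<times> real \<Rightarrow> real ^ 'm ^ 'm) \<Rightarrow> 'm::finite \<Rightarrow> real" where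
  "lm_real g i = real_of_ereal (l_minus g i i)"

context
  fixes g :: "real \<times> real \<Rightarrow> real ^ 'm ^ 'm::finite"
  assumes G1: "C1_admissible g" and zero: "\<And>t i j. g (t, 0) $ i $ j = 0"
    and mono: "\<And>t i j. mono (\<lambda>v. g (t, v) $ i $ j)" and fin: "\<And>i. L_plus g i < \<infinity>"
begin

lemma deriv_v_nonneg: "0 \<le> deriv_v g p $ i $ j"
  using mono_deriv_nonneg[OF mono C1_admissible_deriv[OF G1]] by (cases p) blast

lemma deriv_v_le_l_plus: "ereal (deriv_v g p $ i $ j) \<le> l_plus g i j"
  unfolding l_plus_def by (rule SUP_upper) simp

lemma l_minus_le_deriv_v: "l_minus g i j \<le> ereal (deriv_v g p $ i $ j)"
  unfolding l_minus_def by (rule INF_lower) simp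

text \<open>An infinite entry would make the column sum \<open>L_plus\<close> infinite, and
  nonnegativity excludes -infinity; the bounds may therefore be treated as reals.\<close>

lemma l_plus_eq: "l_plus g i j = ereal (lp_real g i j)" and lp_real_nonneg: "0 \<le> lp_real g i j"
proof -
  have 0: "0 \<le> l_plus g i j"
    using deriv_v_nonneg[of "(0, 0)" i j] deriv_v_le_l_plus[of "(0, 0)" i j] by (metis ereal_less_eq(5) order_trans)
  have "l_plus g i j \<noteq> \<infinity>"
  proof
    assume "l_plus g i j = \<infinity>"
    then have "L_plus g j = \<infinity>" unfolding L_plus_def sum_Pinfty by auto
    then show False using fin[of j] by simp
  qed
  then show "l_plus g i j = ereal (lp_real g i j)" "0 \<le> lp_real g i j"
    using 0 by (auto simp: lp_real_def ereal_real real_of_ereal_pos)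
qed

lemma l_minus_eq: "l_minus g i i = ereal (lm_real g i)"
  and lm_real_nonneg: "0 \<le> lm_real g i" and lm_real_le: "lm_real g i \<le> lp_real g i i"
proof -
  have 0: "0 \<le> l_minus g i i"
    unfolding l_minus_def by (rule INF_greatest) (simp add: deriv_v_nonneg)
  have le: "l_minus g i i \<le> ereal (lp_real g i i)"
    using order_trans[OF l_minus_le_deriv_v[of i i "(0, 0)"] deriv_v_le_l_plus] unfolding l_plus_eq .
  then show eq: "l_minus g i i = ereal (lm_real g i)"
    using 0 by (cases "l_minus g i i") (auto simp: lm_real_def)
  show "0 \<le> lm_real g i" using 0 unfolding eq by simp
  show "lm_real g i \<le> lp_real g i i" using le unfolding eq by simp
qed

lemma L_plus_eq: "L_plus g i = ereal (\<Sum>j\<in>UNIV. lp_real g j i)"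
  by (simp add: L_plus_def l_plus_eq)

lemma g_upper: "v \<le> w \<Longrightarrow> g (t, w) $ i $ j - g (t, v) $ i $ j \<le> lp_real g i j * (w - v)"
  and g_lower: "v \<le> w \<Longrightarrow> lm_real g i * (w - v) \<le> g (t, w) $ i $ i - g (t, v) $ i $ i"
proof -
  assume vw: "v \<le> w"
  have mvt: "\<exists>\<xi>. g (t, w) $ i $ j - g (t, v) $ i $ j = (w - v) * deriv_v g (t, \<xi>) $ i $ j" for i j
  proof (cases "v = w")
    case False
    then show ?thesis
      using MVT2[of v w "\<lambda>w. g (t, w) $ i $ j" "\<lambda>\<xi>. deriv_v g (t, \<xi>) $ i $ j"] C1_admissible_deriv[OF G1] vw by auto
  qed simp
  have "deriv_v g p $ i $ j \<le> lp_real g i j" for p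
    using deriv_v_le_l_plus[of p i j] unfolding l_plus_eq by simp
  moreover obtain \<xi> where "g (t, w) $ i $ j - g (t, v) $ i $ j = (w - v) * deriv_v g (t, \<xi>) $ i $ j" using mvt by blast
  ultimately show "g (t, w) $ i $ j - g (t, v) $ i $ j \<le> lp_real g i j * (w - v)"
    using vw by (simp add: mult.commute mult_left_mono)
  have "lm_real g i \<le> deriv_v g p $ i $ i" for p
    using l_minus_le_deriv_v[of i i p] unfolding l_minus_eq by simp
  moreover obtain \<xi> where "g (t, w) $ i $ i - g (t, v) $ i $ i = (w - v) * deriv_v g (t, \<xi>) $ i $ i" using mvt by blast
  ultimately show "lm_real g i * (w - v) \<le> g (t, w) $ i $ i - g (t, v) $ i $ i"
    using vw by (simp add: mult.commute mult_left_mono)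
qed

lemma hull_entry_limit:
  assumes "\<omega> \<in> hull_of g"
  obtains \<tau> where "\<And>t v i j. (\<lambda>n. g (\<tau> n + t, v) $ i $ j) \<longlonglongrightarrow> \<omega> (t, v) $ i $ j"
proof -
  obtain \<tau> where \<tau>: "ucc_lim (\<lambda>n. translate g (\<tau> n)) \<omega>" using assms unfolding hull_of_iff by blast
  have "(\<lambda>n. g (\<tau> n + t, v) $ i $ j) \<longlonglongrightarrow> \<omega> (t, v) $ i $ j" for t v i j
    using ucc_lim_pointwise[OF \<tau>, of "(t, v)"] by (intro tendsto_vec_nth) simp
  then show ?thesis by (rule that)
qed

lemma hull_zero:
  assumes "\<omega> \<in> hull_of g"
  shows "\<omega> (t, 0) $ i $ j = 0"
proof -
  obtain \<tau> where \<tau>: "\<And>t v i j. (\<lambda>n. g (\<tau> n + t, v) $ i $ j) \<longlonglongrightarrow> \<omega> (t, v) $ i $ j"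
    using hull_entry_limit[OF assms] by blast
  show ?thesis using \<tau>[of t 0 i j] by (simp add: zero LIMSEQ_const_iff)
qed

lemma hull_mono:
  assumes "\<omega> \<in> hull_of g" "v \<le> w"
  shows "\<omega> (t, v) $ i $ j \<le> \<omega> (t, w) $ i $ j"
proof -
  obtain \<tau> where \<tau>: "\<And>t v i j. (\<lambda>n. g (\<tau> n + t, v) $ i $ j) \<longlonglongrightarrow> \<omega> (t, v) $ i $ j"
    using hull_entry_limit[OF assms(1)] by blast
  show ?thesis by (rule LIMSEQ_le[OF \<tau> \<tau>]) (use monoD[OF mono assms(2)] in auto)
qed

lemma hull_upper:
  assumes "\<omega> \<in> hull_of g" "v \<le> w"
  shows "\<omega> (t, w) $ i $ j - \<omega> (t, v) $ i $ j \<le> lp_real g i j * (w - v)"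
proof -
  obtain \<tau> where \<tau>: "\<And>t v i j. (\<lambda>n. g (\<tau> n + t, v) $ i $ j) \<longlonglongrightarrow> \<omega> (t, v) $ i $ j"
    using hull_entry_limit[OF assms(1)] by blast
  show ?thesis by (rule LIMSEQ_le_const2[OF tendsto_diff[OF \<tau> \<tau>]]) (use g_upper[OF assms(2)] in auto)
qed

lemma hull_lower:
  assumes "\<omega> \<in> hull_of g" "v \<le> w"
  shows "lm_real g i * (w - v) \<le> \<omega> (t, w) $ i $ i - \<omega> (t, v) $ i $ i"
proof -
  obtain \<tau> where \<tau>: "\<And>t v i j. (\<lambda>n. g (\<tau> n + t, v) $ i $ j) \<longlonglongrightarrow> \<omega> (t, v) $ i $ j"
    using hull_entry_limit[OF assms(1)] by blast
  show ?thesis by (rule LIMSEQ_le_const[OF tendsto_diff[OF \<tau> \<tau>]]) (use g_lower[OF assms(2)] in auto)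
qed

lemma hull_norm_lipschitz:
  obtains C where "0 < C" "\<And>\<omega> t v w. \<omega> \<in> hull_of g \<Longrightarrow> norm (\<omega> (t, v) - \<omega> (t, w)) \<le> C * \<bar>v - w\<bar>"
proof -
  define \<Lambda> where "\<Lambda> = (\<Sum>i\<in>UNIV. \<Sum>j\<in>UNIV. lp_real g i j)"
  define C where "C = real CARD('m) * (real CARD('m) * \<Lambda>) + 1"
  have le: "lp_real g i j \<le> \<Lambda>" for i j
  proof -
    have "lp_real g i j \<le> (\<Sum>j\<in>UNIV. lp_real g i j)" by (intro member_le_sum) (auto simp: lp_real_nonneg)
    also have "\<dots> \<le> \<Lambda>" unfolding \<Lambda>_def by (rule member_le_sum[of i]) (auto intro!: sum_nonneg lp_real_nonneg)
    finally show ?thesis .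
  qed
  have \<Lambda>: "0 \<le> \<Lambda>" using le lp_real_nonneg order_trans by blast
  have "norm (\<omega> (t, v) - \<omega> (t, w)) \<le> C * \<bar>v - w\<bar>" if \<omega>: "\<omega> \<in> hull_of g" for \<omega> t v w
  proof -
    have *: "\<bar>\<omega> (t, b) $ i $ j - \<omega> (t, a) $ i $ j\<bar> \<le> \<Lambda> * (b - a)" if "a \<le> b" for a b i j
      using hull_upper[OF \<omega> that, of t i j] hull_mono[OF \<omega> that, of t i j] mult_right_mono[OF le, of "b - a" i j] that
      by (simp add: abs_le_iff)
    have "\<bar>(\<omega> (t, v) - \<omega> (t, w)) $ i $ j\<bar> \<le> \<Lambda> * \<bar>v - w\<bar>" for i j
    proof (cases "v \<le> w")
      case True
      then show ?thesis using *[OF True, of i j] by (simp add: abs_minus_commute)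
    next
      case False
      then show ?thesis using *[of w v i j] by simp
    qed
    then have "norm (\<omega> (t, v) - \<omega> (t, w)) \<le> real CARD('m) * (real CARD('m) * (\<Lambda> * \<bar>v - w\<bar>))"
      by (rule norm_matrix_le_card)
    also have "\<dots> \<le> C * \<bar>v - w\<bar>" by (simp add: C_def distrib_right mult.assoc)
    finally show ?thesis .
  qed
  moreover have "0 < C" using \<Lambda> by (simp add: C_def add_nonneg_pos)
  ultimately show ?thesis using that by blast
qed

text \<open>Along a line of constant \<open>v\<close> the modulus of continuity of \<open>g\<close>
  is preserved by translations and inherited by limits; in the direction of \<open>v\<close> there
  is a common Lipschitz constant.\<close>

lemma hull_equicontinuous:
  assumes e: "0 < e"
  shows "\<exists>d>0. \<forall>\<omega>\<in>hull_of g. \<forall>y. dist y x < d \<longrightarrow> dist (\<omega> y) (\<omega> x) < e"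
proof -
  obtain t v where x: "x = (t, v)" by (cases x)
  obtain C where C: "0 < C" "\<And>\<omega> t v w. \<omega> \<in> hull_of g \<Longrightarrow> norm (\<omega> (t, v) - \<omega> (t, w)) \<le> C * \<bar>v - w\<bar>"
    using hull_norm_lipschitz by blast
  have "uniformly_continuous_on (UNIV \<times> {v}) g" using G1 by (simp add: C1_admissible_def)
  then obtain d where d: "0 < d" "\<And>a b. a \<in> UNIV \<times> {v} \<Longrightarrow> b \<in> UNIV \<times> {v} \<Longrightarrow> dist b a < d \<Longrightarrow> dist (g b) (g a) < e / 4"
    unfolding uniformly_continuous_on_def using e by (metis zero_less_divide_iff zero_less_numeral)
  define d' where "d' = min d (e / (4 * C))"
  have "dist (\<omega> y) (\<omega> x) < e" if \<omega>: "\<omega> \<in> hull_of g" and y: "dist y x < d'" for \<omega> y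
  proof -
    obtain s u where su: "y = (s, u)" by (cases y)
    have "\<bar>s - t\<bar> < d'" "\<bar>u - v\<bar> < d'"
      using y dist_fst_le[of y x] dist_snd_le[of y x] by (auto simp: su x dist_real_def)
    then have st: "\<bar>s - t\<bar> < d" and uv: "C * \<bar>u - v\<bar> < e / 4"
      using C(1) by (auto simp: d'_def field_simps)
    obtain \<tau> where \<tau>: "ucc_lim (\<lambda>n. translate g (\<tau> n)) \<omega>" using \<omega> unfolding hull_of_iff by blast
    have "(\<lambda>n. translate g (\<tau> n) (s, v)) \<longlonglongrightarrow> \<omega> (s, v)" "(\<lambda>n. translate g (\<tau> n) (t, v)) \<longlonglongrightarrow> \<omega> (t, v)"
      by (rule ucc_lim_pointwise[OF \<tau>])+
    then have "(\<lambda>n. dist (g (\<tau> n + s, v)) (g (\<tau> n + t, v))) \<longlonglongrightarrow> dist (\<omega> (s, v)) (\<omega> (t, v))"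
      by (intro tendsto_dist) simp_all
    moreover have "dist (g (a + s, v)) (g (a + t, v)) \<le> e / 4" for a
      using st by (intro less_imp_le d(2)) (auto simp: dist_Pair_Pair dist_real_def)
    ultimately have "dist (\<omega> (s, v)) (\<omega> (t, v)) \<le> e / 4" by (intro LIMSEQ_le_const2) auto
    moreover have "dist (\<omega> (s, u)) (\<omega> (s, v)) \<le> e / 4"
      using C(2)[OF \<omega>, of s u v] uv by (simp add: dist_norm)
    ultimately show ?thesis using dist_triangle[of "\<omega> y" "\<omega> x" "\<omega> (s, v)"] e unfolding su x by linarith
  qed
  moreover have "0 < d'" using d(1) e C(1) by (simp add: d'_def)
  ultimately show ?thesis by blast
qed

lemma hull_continuous: "\<omega> \<in> hull_of g \<Longrightarrow> continuous_on UNIV \<omega>"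
  unfolding continuous_on_iff using hull_equicontinuous by blast

text \<open>The zeros at \<open>v = 0\<close> and the common Lipschitz constant give local bounds;
  together with equicontinuity, Arzela-Ascoli applies.\<close>

lemma hull_sequentially_compact:
  assumes f: "\<And>n. f n \<in> hull_of g"
  shows "\<exists>\<omega>\<in>hull_of g. \<exists>\<sigma>::nat \<Rightarrow> nat. strict_mono \<sigma> \<and> ucc_lim (\<lambda>n. f (\<sigma> n)) \<omega>"
proof -
  obtain C where C: "0 < C" "\<And>\<omega> t v w. \<omega> \<in> hull_of g \<Longrightarrow> norm (\<omega> (t, v) - \<omega> (t, w)) \<le> C * \<bar>v - w\<bar>"
    using hull_norm_lipschitz by blast
  obtain \<omega> \<sigma> where \<sigma>: "strict_mono (\<sigma> :: nat \<Rightarrow> nat)" "ucc_lim (\<lambda>n. f (\<sigma> n)) \<omega>"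
  proof (rule ucc_Arzela_Ascoli[of f])
    fix R :: real
    have "norm (f n x) \<le> C * R" if x: "x \<in> cball 0 R" for n x
    proof -
      obtain t v where tv: "x = (t, v)" by (cases x)
      have "\<bar>v\<bar> \<le> R" using norm_snd_le[of v t] x by (simp add: tv)
      then have "C * \<bar>v - 0\<bar> \<le> C * R" using C(1) by simp
      moreover have "f n (t, 0) = 0" using hull_zero[OF f] by (simp add: vec_eq_iff)
      ultimately show ?thesis using C(2)[OF f, of n t v 0] tv by simp
    qed
    then show "\<exists>M. \<forall>n. \<forall>x\<in>cball 0 R. norm (f n x) \<le> M" by blast
  next
    fix x and e :: real assume "0 < e"
    then show "\<exists>d>0. \<forall>n y. dist y x < d \<longrightarrow> dist (f n y) (f n x) < e"
      using hull_equicontinuous[of e x] f by meson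
  qed
  have "\<omega> \<in> hull_of g" by (rule hull_of_closed[OF f \<sigma>(2)])
  then show ?thesis using \<sigma> by blast
qed

end

lemma segment_BU:
  fixes z :: "real \<Rightarrow> real ^ 'm::finite"
  assumes B: "bounded_by B z" and \<Lambda>: "lip_by \<Lambda> z"
  shows "segment z t \<in> BU"
proof -
  have "(real CARD('m) * \<Lambda>)-lipschitz_on {..0} (\<lambda>s. z (t + s))"
  proof (rule lipschitz_onI)
    show "dist (z (t + a)) (z (t + b)) \<le> real CARD('m) * \<Lambda> * dist a b" for a b
      using lip_by_norm[OF \<Lambda>, of "t + a" "t + b"] by (simp add: dist_norm mult.assoc)
    show "0 \<le> real CARD('m) * \<Lambda>" using lip_by_nonneg[OF \<Lambda>] by simp
  qed
  then have "uniformly_continuous_on {..0} (\<lambda>s. z (t + s))" by (rule lipschitz_on_uniformly_continuous)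
  then have "uniformly_continuous_on {..0} (segment z t)"
    unfolding uniformly_continuous_on_def by (simp add: segment_def)
  moreover have "norm (segment z t s) \<le> real CARD('m) * B" if "s \<le> 0" for s
    using B that by (intro norm_vec_le_card) (simp add: segment_def bounded_by_def)
  then have "bounded (segment z t ` {..0})" unfolding bounded_iff by blast
  ultimately show ?thesis by (simp add: BU_def segment_def)
qed

lemma segment_dist_tendsto:
  fixes z :: "nat \<Rightarrow> real \<Rightarrow> real ^ 'm::finite"
  assumes "ucc_lim z l" "\<And>n. segment (z n) 0 \<in> X_space" "segment l 0 \<in> X_space"
  shows "(\<lambda>n. dist_X (segment (z n) 0) (segment l 0)) \<longlonglongrightarrow> 0"
proof (rule tendstoI)
  fix e :: real assume e: "0 < e"
  obtain N where N: "\<forall>x\<in>X_space. \<forall>y\<in>X_space. (\<forall>s. - real N \<le> s \<longrightarrow> s \<le> 0 \<longrightarrow>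
      norm (x s - y s :: real ^ 'm) \<le> e / 3) \<longrightarrow> dist_X x y < e"
    using dist_X_small[OF e] ..
  have "\<forall>\<^sub>F n in sequentially. \<forall>s\<in>{- real N..0}. dist (z n s) (l s) < e / 3"
    using e by (intro ucc_limD[OF assms(1)]) auto
  then show "\<forall>\<^sub>F n in sequentially. dist (dist_X (segment (z n) 0) (segment l 0)) 0 < e"
  proof eventually_elim
    case (elim n)
    have "dist_X (segment (z n) 0) (segment l 0) < e"
      by (rule N[rule_format, OF assms(2,3)]) (use elim in \<open>auto simp: segment_def dist_norm intro: less_imp_le\<close>)
    then show ?case using dist_X_nonneg[OF assms(2,3)] by (simp add: dist_real_def)
  qed
qed

lemma segment_shift: "segment z t = segment (\<lambda>s. z (t + s)) 0"
  by (simp add: segment_def)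

theorem theorem6p3:
  fixes g :: "real \<times> real \<Rightarrow> real ^ 'm ^ 'm::finite"
    and \<gamma> \<alpha> :: "'m \<Rightarrow> real"
    and \<rho> :: "'m \<Rightarrow> 'm \<Rightarrow> real"
    and \<omega>\<^sub>0 :: "real \<times> real \<Rightarrow> real ^ 'm ^ 'm"
    and x\<^sub>0 :: "real \<Rightarrow> real ^ 'm"
  assumes gamma_nonneg: "\<And>i. 0 \<le> \<gamma> i"
    and G1: "C1_admissible g"
    and G2: "\<And>t i j. g (t, 0) $ i $ j = 0" "\<And>t i j. mono (\<lambda>v. g (t, v) $ i $ j)"
    and G3: "recurrent g"
    and G4: "(\<Sum>i\<in>UNIV. \<gamma> i) < 1" "\<And>i. 0 < \<alpha> i" "\<And>i j. 0 \<le> \<rho> i j"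
    and G5: "\<And>i.
      (L_plus g i < \<infinity> \<and> (\<exists>\<beta>>0. ereal (\<beta> * (1 - \<gamma> i * exp (\<beta> * \<alpha> i))) > L_plus g i)) \<or>
      (L_plus g i < \<infinity> \<and> \<rho> i i \<le> \<alpha> i \<and>
        (\<exists>\<beta>. ereal \<beta> \<ge> L_plus g i \<and>
           ereal (\<beta> * (1 - \<gamma> i * exp (\<beta> * \<alpha> i))) + ereal (exp (\<beta> * \<rho> i i)) * l_minus g i i
             > L_plus g i))"
    and omega0: "\<omega>\<^sub>0 \<in> hull_of g"
    and x0: "x\<^sub>0 \<in> BU" "\<exists>C. C-lipschitz_on {..0} x\<^sub>0"
  shows "has_sol \<gamma> \<alpha> \<rho> \<omega>\<^sub>0 x\<^sub>0 \<and> bounded (range (sol \<gamma> \<alpha> \<rho> \<omega>\<^sub>0 x\<^sub>0)) \<and>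
    (\<exists>c. equilibrium \<gamma> \<alpha> \<rho> (hull_of g) c \<and>
         continuous_map (hull_topology g) (Metric_space.mtopology BU dist_X) c \<and>
         omega_limit \<gamma> \<alpha> \<rho> (hull_of g) \<omega>\<^sub>0 x\<^sub>0 = {(\<omega>, c \<omega>) | \<omega>. \<omega> \<in> hull_of g} \<and>
         ((\<lambda>t. dist_X (u_flow \<gamma> \<alpha> \<rho> t \<omega>\<^sub>0 x\<^sub>0) (c (translate \<omega>\<^sub>0 t))) \<longlongrightarrow> 0) at_top)"
proof -
  have fin: "L_plus g i < \<infinity>" for i using G5[of i] by blast
  note hyp = G1 G2 fin
  have "\<exists>\<beta>>0. rate_cond \<beta> (\<gamma> i) (\<alpha> i) (\<rho> i i) (\<Sum>j\<in>UNIV. lp_real g j i) (lm_real g i)" for i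
  proof -
    have L0: "0 \<le> (\<Sum>j\<in>UNIV. lp_real g j i)" by (intro sum_nonneg lp_real_nonneg[OF hyp])
    have lmL: "lm_real g i \<le> (\<Sum>j\<in>UNIV. lp_real g j i)"
      using lm_real_le[OF hyp, of i] member_le_sum[of i UNIV "\<lambda>j. lp_real g j i"] lp_real_nonneg[OF hyp] by force
    consider (1) \<beta> where "0 < \<beta>" "ereal (\<beta> * (1 - \<gamma> i * exp (\<beta> * \<alpha> i))) > L_plus g i"
      | (2) \<beta> where "\<rho> i i \<le> \<alpha> i" "ereal \<beta> \<ge> L_plus g i"
        "ereal (\<beta> * (1 - \<gamma> i * exp (\<beta> * \<alpha> i))) + ereal (exp (\<beta> * \<rho> i i)) * l_minus g i i > L_plus g i"
      using G5[of i] by blast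
    then show ?thesis
    proof cases
      case 1
      then show ?thesis by (intro exI[of _ \<beta>]) (simp add: rate_cond_def L_plus_eq[OF hyp])
    next
      case 2
      then have *: "(\<Sum>j\<in>UNIV. lp_real g j i) \<le> \<beta>"
        "\<beta> * (1 - \<gamma> i * exp (\<beta> * \<alpha> i)) + exp (\<beta> * \<rho> i i) * lm_real g i > (\<Sum>j\<in>UNIV. lp_real g j i)"
        by (simp_all add: L_plus_eq[OF hyp] l_minus_eq[OF hyp])
      \<comment> \<open>The second alternative only gives \<open>\<beta> \<ge> 0\<close>. For
        \<open>\<beta> = 0\<close> its strict inequality would say that \<open>lm_real g i\<close>
        exceeds the column sum.\<close>
      have "\<beta> \<noteq> 0"
      proof
        assume "\<beta> = 0"
        then show False using * lmL by simp
      qed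
      then show ?thesis using * 2(1) L0 by (intro exI[of _ \<beta>]) (auto simp: rate_cond_def)
    qed
  qed
  then obtain \<beta> where \<beta>: "\<And>i. 0 < \<beta> i"
    "\<And>i. rate_cond (\<beta> i) (\<gamma> i) (\<alpha> i) (\<rho> i i) (\<Sum>j\<in>UNIV. lp_real g j i) (lm_real g i)" by metis
  \<comment> \<open>The sum of all delays serves as their common bound.\<close>
  define r where "r = (\<Sum>i\<in>UNIV. \<alpha> i) + (\<Sum>i\<in>UNIV. \<Sum>j\<in>UNIV. \<rho> i j)"
  have \<gamma>1: "\<gamma> i < 1" for i
    using member_le_sum[of i UNIV \<gamma>] gamma_nonneg G4(1) by force
  have sums0: "0 \<le> (\<Sum>i\<in>UNIV. \<alpha> i)" "0 \<le> (\<Sum>i\<in>UNIV. \<Sum>j\<in>UNIV. \<rho> i j)"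
    by (auto intro!: sum_nonneg G4(3) less_imp_le[OF G4(2)])
  have \<alpha>r: "\<alpha> i \<le> r" for i
    using member_le_sum[of i UNIV \<alpha>] G4(2) sums0(2) by (force simp: r_def less_imp_le)
  have \<rho>r: "\<rho> i j \<le> r" for i j
  proof -
    have "\<rho> i j \<le> (\<Sum>j\<in>UNIV. \<rho> i j)" using G4(3) by (intro member_le_sum) auto
    also have "\<dots> \<le> (\<Sum>i\<in>UNIV. \<Sum>j\<in>UNIV. \<rho> i j)"
      by (rule member_le_sum[of i UNIV "\<lambda>i. \<Sum>j\<in>UNIV. \<rho> i j"]) (auto intro!: sum_nonneg G4(3))
    finally show ?thesis using sums0(1) by (simp add: r_def)
  qed
  interpret compartmental \<gamma> \<alpha> \<beta> "lm_real g" \<rho> "lp_real g" r "hull_of g"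
  proof (rule compartmental.intro)
    show "0 \<le> \<gamma> i" "\<gamma> i < 1" "0 < \<alpha> i" "\<alpha> i \<le> r" "0 < \<beta> i" for i
      by (rule gamma_nonneg \<gamma>1 G4 \<alpha>r \<beta>)+
    show "0 \<le> \<rho> i j" "\<rho> i j \<le> r" "0 \<le> lp_real g i j" for i j
      by (rule G4 \<rho>r lp_real_nonneg[OF hyp])+
    show "0 \<le> lm_real g i" "lm_real g i \<le> lp_real g i i" for i
      by (rule lm_real_nonneg[OF hyp], rule lm_real_le[OF hyp])
    show "rate_cond (\<beta> i) (\<gamma> i) (\<alpha> i) (\<rho> i i) (\<Sum>j\<in>UNIV. lp_real g j i) (lm_real g i)" for i by (rule \<beta>)
    fix \<omega> assume \<omega>: "\<omega> \<in> hull_of g"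
    show "continuous_on UNIV \<omega>" by (rule hull_continuous[OF hyp \<omega>])
    show "\<omega> (t, 0) $ i $ j = 0" for t i j by (rule hull_zero[OF hyp \<omega>])
    show "translate \<omega> t \<in> hull_of g" for t by (rule hull_of_translate[OF \<omega>])
    fix v w :: real assume vw: "v \<le> w"
    show "\<omega> (t, v) $ i $ j \<le> \<omega> (t, w) $ i $ j" for t i j by (rule hull_mono[OF hyp \<omega> vw])
    show "\<omega> (t, w) $ i $ j - \<omega> (t, v) $ i $ j \<le> lp_real g i j * (w - v)" for t i j by (rule hull_upper[OF hyp \<omega> vw])
    show "lm_real g i * (w - v) \<le> \<omega> (t, w) $ i $ i - \<omega> (t, v) $ i $ i" for t i by (rule hull_lower[OF hyp \<omega> vw])
  next
    show "\<exists>\<omega>\<in>hull_of g. \<exists>\<sigma>::nat \<Rightarrow> nat. strict_mono \<sigma> \<and> ucc_lim (\<lambda>n. f (\<sigma> n)) \<omega>"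
      if "\<And>n. f n \<in> hull_of g" for f by (rule hull_sequentially_compact[OF hyp that])
  next
    show "S = hull_of g" if "S \<subseteq> hull_of g" "S \<noteq> {}" "\<And>\<omega> t. \<omega> \<in> S \<Longrightarrow> translate \<omega> t \<in> S"
      "\<And>f \<omega>. (\<And>n. f n \<in> S) \<Longrightarrow> ucc_lim f \<omega> \<Longrightarrow> \<omega> \<in> S" for S
      by (rule hull_of_minimal[OF G3 that])
  qed
  interpret BU: Metric_space "BU :: (real \<Rightarrow> real ^ 'm) set" dist_X by (rule Metric_space_BU)
  have "continuous_on {..0} x\<^sub>0" using x0(1) by (simp add: BU_def uniformly_continuous_imp_continuous)
  \<comment> \<open>\<open>x\<^sub>0\<close> is \<open>undefined\<close> to the right of 0; freezing
    it there gives a continuous function with the same history.\<close>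
  then have "continuous_on UNIV (\<lambda>s. x\<^sub>0 (min s 0))"
    by (rule continuous_on_compose2) (auto intro!: continuous_intros)
  then obtain z0 where z0: "solves \<omega>\<^sub>0 0 z0" "\<And>t. t \<le> 0 \<Longrightarrow> z0 t = x\<^sub>0 t"
    using solves_exists[OF omega0] by (metis min_absorb1)
  then have nz0: "nfde_solution \<gamma> \<alpha> \<rho> \<omega>\<^sub>0 x\<^sub>0 z0" by (simp add: nfde_solution_iff)
  note sol0 = has_sol_if[OF omega0 nz0]
  obtain b where b: "\<And>s. s \<le> 0 \<Longrightarrow> norm (x\<^sub>0 s) \<le> b"
    using x0(1) unfolding BU_def bounded_iff by auto
  obtain C where C: "C-lipschitz_on {..0} x\<^sub>0" using x0(2) by blast
  obtain B \<Lambda> where B: "bounded_by B z0" and \<Lambda>: "lip_by \<Lambda> z0"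
  proof (rule solution_bounded_lipschitz[OF omega0 z0(1)])
    show "\<bar>z0 s $ i\<bar> \<le> b" if "s \<le> 0" for s i
      using component_le_norm_cart[of "x\<^sub>0 s" i] b[OF that] z0(2)[OF that] by simp
    show "0 \<le> C" by (rule lipschitz_on_nonneg[OF C])
    show "\<bar>z0 s' $ i - z0 s $ i\<bar> \<le> C * (s' - s)" if "s \<le> s'" "s' \<le> 0" for s s' i
      using component_le_norm_cart[of "x\<^sub>0 s' - x\<^sub>0 s" i] lipschitz_onD[OF C, of s' s] that z0(2)
      by (simp add: dist_norm dist_real_def)
  qed
  have "norm (z0 t) \<le> real CARD('m) * B" for t
    using B by (intro norm_vec_le_card) (simp add: bounded_by_def)
  then have bounded: "bounded (range z0)" unfolding bounded_iff by blast
  obtain c' \<Lambda>' where c': "\<And>\<omega>. \<omega> \<in> hull_of g \<Longrightarrow> entire \<omega> (c' \<omega>)" "\<And>\<omega>. \<omega> \<in> hull_of g \<Longrightarrow> bounded_by B (c' \<omega>)"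
      "\<And>\<omega>. \<omega> \<in> hull_of g \<Longrightarrow> lip_by \<Lambda>' (c' \<omega>)"
      "\<And>\<omega> s. \<omega> \<in> hull_of g \<Longrightarrow> c' (translate \<omega> s) = (\<lambda>t. c' \<omega> (s + t))"
    and c'cont: "\<And>f \<omega>. (\<And>n. f n \<in> hull_of g) \<Longrightarrow> ucc_lim f \<omega> \<Longrightarrow> ucc_lim (\<lambda>n. c' (f n)) (c' \<omega>)"
    and c'lim: "\<And>e. 0 < e \<Longrightarrow> \<exists>T. \<forall>t\<ge>T. \<forall>i. \<bar>z0 t $ i - c' \<omega>\<^sub>0 t $ i\<bar> \<le> e"
    and rec: "\<And>\<omega>. \<omega> \<in> hull_of g \<Longrightarrow> \<exists>\<tau>. incseq \<tau> \<and> (\<forall>n. real n \<le> \<tau> n) \<and> ucc_lim (\<lambda>n. translate \<omega>\<^sub>0 (\<tau> n)) \<omega>"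
    by (rule asymptotic_copy_of_base[OF omega0 z0(1) B \<Lambda>]) blast
  define c where "c \<omega> = segment (c' \<omega>) 0" for \<omega>
  have cBU: "c \<omega> \<in> BU" if "\<omega> \<in> hull_of g" for \<omega>
    unfolding c_def by (rule segment_BU[OF c'(2,3)[OF that]])
  have nc: "nfde_solution \<gamma> \<alpha> \<rho> \<omega> (c \<omega>) (c' \<omega>)" if "\<omega> \<in> hull_of g" for \<omega>
    using c'(1)[OF that] by (simp add: nfde_solution_iff entire_def c_def segment_def)
  have cshift: "c (translate \<omega> t) = segment (c' \<omega>) t" if "\<omega> \<in> hull_of g" for \<omega> t
    unfolding c_def c'(4)[OF that] by (rule segment_shift[symmetric])
  have eq: "equilibrium \<gamma> \<alpha> \<rho> (hull_of g) c"
    using cBU has_sol_if[OF _ nc] cshift by (auto simp: equilibrium_def u_flow_def)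
  have u0: "u_flow \<gamma> \<alpha> \<rho> t \<omega>\<^sub>0 x\<^sub>0 = segment z0 t" for t by (simp add: u_flow_def sol0(2))
  have u0BU: "segment z0 t \<in> BU" for t by (rule segment_BU[OF B \<Lambda>])
  have csegX: "segment (c' \<omega>) 0 \<in> X_space" if "\<omega> \<in> hull_of g" for \<omega>
    using cBU[OF that] BU_subset_X_space by (auto simp: c_def)
  have cdist: "(\<lambda>n. dist_X (c (f n)) (c \<omega>)) \<longlonglongrightarrow> 0" if f: "\<And>n. f n \<in> hull_of g" "ucc_lim f \<omega>" for f \<omega>
    unfolding c_def by (intro segment_dist_tendsto c'cont f csegX hull_of_closed[OF f])
  have cmap: "continuous_map (hull_topology g) BU.mtopology c"
    unfolding BU.continuous_map_to_metric
  proof (intro ballI allI impI)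
    fix \<omega> and e :: real assume \<omega>: "\<omega> \<in> topspace (hull_topology g)" and e: "0 < e"
    then have \<omega>H: "\<omega> \<in> hull_of g" by (simp add: hull_topology_def)
    show "\<exists>U. openin (hull_topology g) U \<and> \<omega> \<in> U \<and> (\<forall>y\<in>U. c y \<in> BU.mball (c \<omega>) e)"
    proof (rule ccontr)
      \<comment> \<open>If no neighbourhood works, the neighbourhoods with radius \<open>n\<close>
        and tolerance 1/(n+1) yield a sequence converging to \<omega> that contradicts
        \<open>cdist\<close>.\<close>
      assume no: "\<not> ?thesis"
      have "\<exists>y\<in>hull_of g. (\<forall>x\<in>cball 0 (real n). dist (y x) (\<omega> x) < inverse (real (Suc n))) \<and> \<not> dist_X (c y) (c \<omega>) < e" for n
      proof -
        let ?V = "{h. \<exists>d<inverse (real (Suc n)). \<forall>x\<in>cball 0 (real n). dist (h x) (\<omega> x) < d}"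
        have "openin (hull_topology g) (?V \<inter> hull_of g)"
          unfolding hull_topology_def by (intro openin_subtopology_Int ucc_topology_ball_open compact_cball)
        moreover have "\<omega> \<in> ?V \<inter> hull_of g"
          using \<omega>H by (auto intro!: exI[of _ "inverse (real (Suc n)) / 2"])
        ultimately obtain y where y: "y \<in> ?V \<inter> hull_of g" "c y \<notin> BU.mball (c \<omega>) e" using no by meson
        then obtain d where "d < inverse (real (Suc n))" "\<forall>x\<in>cball 0 (real n). dist (y x) (\<omega> x) < d" by blast
        then have "\<forall>x\<in>cball 0 (real n). dist (y x) (\<omega> x) < inverse (real (Suc n))" by (meson less_trans)
        moreover have "\<not> dist_X (c y) (c \<omega>) < e"
          using y cBU \<omega>H by (auto simp: BU.in_mball BU.commute)
        ultimately show ?thesis using y(1) by blast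
      qed
      then obtain f where f: "\<And>n. f n \<in> hull_of g"
        "\<And>n x. x \<in> cball 0 (real n) \<Longrightarrow> dist (f n x) (\<omega> x) < inverse (real (Suc n))"
        "\<And>n. \<not> dist_X (c (f n)) (c \<omega>) < e" by metis
      have "(\<lambda>n. dist_X (c (f n)) (c \<omega>)) \<longlonglongrightarrow> 0" by (rule cdist[OF f(1) ucc_limI_balls[OF f(2)]])
      then have "\<forall>\<^sub>F n in sequentially. dist_X (c (f n)) (c \<omega>) < e" by (rule order_tendstoD(2)) (rule e)
      then show False using f(3) eventually_happens'[OF sequentially_bot] by blast
    qed
  qed
  have lim: "((\<lambda>t. dist_X (u_flow \<gamma> \<alpha> \<rho> t \<omega>\<^sub>0 x\<^sub>0) (c (translate \<omega>\<^sub>0 t))) \<longlongrightarrow> 0) at_top"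
  proof (rule tendstoI)
    fix e :: real assume e: "0 < e"
    obtain N where N: "\<forall>x\<in>X_space. \<forall>y\<in>X_space. (\<forall>s. - real N \<le> s \<longrightarrow> s \<le> 0 \<longrightarrow>
      norm (x s - y s :: real ^ 'm) \<le> e / 3) \<longrightarrow> dist_X x y < e"
    using dist_X_small[OF e] ..
    have "0 < e / 3 / real CARD('m)" using e by simp
    from c'lim[OF this] obtain T where T: "\<And>t i. T \<le> t \<Longrightarrow> \<bar>z0 t $ i - c' \<omega>\<^sub>0 t $ i\<bar> \<le> e / 3 / real CARD('m)" by blast
    have X: "segment z0 t \<in> X_space" "segment (c' \<omega>\<^sub>0) t \<in> X_space" for t
      using u0BU cBU[OF hull_of_translate[OF omega0], of t] BU_subset_X_space by (auto simp: cshift[OF omega0])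
    have "dist_X (segment z0 t) (segment (c' \<omega>\<^sub>0) t) < e" if t: "T + real N \<le> t" for t
    proof (rule N[rule_format, OF X])
      fix s assume s: "- real N \<le> s" "s \<le> 0"
      have "norm (z0 (t + s) - c' \<omega>\<^sub>0 (t + s)) \<le> real CARD('m) * (e / 3 / real CARD('m))"
        by (rule norm_vec_le_card) (use T[of "t + s"] t s in simp)
      then show "norm (segment z0 t s - segment (c' \<omega>\<^sub>0) t s) \<le> e / 3" using s by (simp add: segment_def)
    qed
    then show "\<forall>\<^sub>F t in at_top. dist (dist_X (u_flow \<gamma> \<alpha> \<rho> t \<omega>\<^sub>0 x\<^sub>0) (c (translate \<omega>\<^sub>0 t))) 0 < e"
      using dist_X_nonneg[OF X]
      by (intro eventually_at_top_linorderI[of "T + real N"]) (simp add: u0 cshift[OF omega0] dist_real_def)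
  qed
  have "omega_limit \<gamma> \<alpha> \<rho> (hull_of g) \<omega>\<^sub>0 x\<^sub>0 = {(\<omega>, c \<omega>) | \<omega>. \<omega> \<in> hull_of g}"
  proof (intro set_eqI iffI)
    fix p assume "p \<in> omega_limit \<gamma> \<alpha> \<rho> (hull_of g) \<omega>\<^sub>0 x\<^sub>0"
    then obtain \<omega> x \<tau> where p: "p = (\<omega>, x)" "\<omega> \<in> hull_of g" "x \<in> BU" and \<tau>: "filterlim \<tau> at_top sequentially"
      "ucc_lim (\<lambda>n. translate \<omega>\<^sub>0 (\<tau> n)) \<omega>" "(\<lambda>n. dist_X (u_flow \<gamma> \<alpha> \<rho> (\<tau> n) \<omega>\<^sub>0 x\<^sub>0) x) \<longlonglongrightarrow> 0"
      unfolding omega_limit_def by blast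
    have 1: "(\<lambda>n. dist_X (u_flow \<gamma> \<alpha> \<rho> (\<tau> n) \<omega>\<^sub>0 x\<^sub>0) (c (translate \<omega>\<^sub>0 (\<tau> n)))) \<longlonglongrightarrow> 0"
      by (rule filterlim_compose[OF lim \<tau>(1)])
    have 2: "(\<lambda>n. dist_X (c (translate \<omega>\<^sub>0 (\<tau> n))) (c \<omega>)) \<longlonglongrightarrow> 0"
      by (rule cdist[OF hull_of_translate[OF omega0] \<tau>(2)])
    \<comment> \<open>The given solution mediates: along \<tau> it tends to \<open>x\<close>, and it
      is asymptotic to the equilibrium, which tends to \<open>c \<omega>\<close> by
      continuity.\<close>
    have "dist_X x (c \<omega>) \<le> dist_X (u_flow \<gamma> \<alpha> \<rho> (\<tau> n) \<omega>\<^sub>0 x\<^sub>0) x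
      + (dist_X (u_flow \<gamma> \<alpha> \<rho> (\<tau> n) \<omega>\<^sub>0 x\<^sub>0) (c (translate \<omega>\<^sub>0 (\<tau> n))) + dist_X (c (translate \<omega>\<^sub>0 (\<tau> n))) (c \<omega>))" for n
      using BU.triangle[of x "segment z0 (\<tau> n)" "c \<omega>"] BU.commute[of x "segment z0 (\<tau> n)"]
        BU.triangle[of "segment z0 (\<tau> n)" "c (translate \<omega>\<^sub>0 (\<tau> n))" "c \<omega>"]
        p(3) u0BU cBU[OF p(2)] cBU[OF hull_of_translate[OF omega0]] by (simp add: u0)
    moreover have "(\<lambda>n. dist_X (u_flow \<gamma> \<alpha> \<rho> (\<tau> n) \<omega>\<^sub>0 x\<^sub>0) x
      + (dist_X (u_flow \<gamma> \<alpha> \<rho> (\<tau> n) \<omega>\<^sub>0 x\<^sub>0) (c (translate \<omega>\<^sub>0 (\<tau> n))) + dist_X (c (translate \<omega>\<^sub>0 (\<tau> n))) (c \<omega>))) \<longlonglongrightarrow> 0 + (0 + 0)"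
      by (intro tendsto_add \<tau>(3) 1 2)
    ultimately have "dist_X x (c \<omega>) \<le> 0 + (0 + 0)" by (intro LIMSEQ_le_const) auto
    then have "x = c \<omega>" using BU.mdist_pos_less[OF _ p(3) cBU[OF p(2)]] by fastforce
    then show "p \<in> {(\<omega>, c \<omega>) | \<omega>. \<omega> \<in> hull_of g}" using p by blast
  next
    fix p assume "p \<in> {(\<omega>, c \<omega>) | \<omega>. \<omega> \<in> hull_of g}"
    then obtain \<omega> where p: "p = (\<omega>, c \<omega>)" "\<omega> \<in> hull_of g" by blast
    obtain \<tau> where \<tau>: "incseq \<tau>" "\<And>n. real n \<le> \<tau> n" "ucc_lim (\<lambda>n. translate \<omega>\<^sub>0 (\<tau> n)) \<omega>" using rec[OF p(2)] by blast
    have top: "filterlim \<tau> at_top sequentially"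
      by (rule filterlim_at_top_mono[OF filterlim_real_sequentially]) (use \<tau>(2) in auto)
    have 1: "(\<lambda>n. dist_X (u_flow \<gamma> \<alpha> \<rho> (\<tau> n) \<omega>\<^sub>0 x\<^sub>0) (c (translate \<omega>\<^sub>0 (\<tau> n)))) \<longlonglongrightarrow> 0"
      by (rule filterlim_compose[OF lim top])
    have 2: "(\<lambda>n. dist_X (c (translate \<omega>\<^sub>0 (\<tau> n))) (c \<omega>)) \<longlonglongrightarrow> 0"
      by (rule cdist[OF hull_of_translate[OF omega0] \<tau>(3)])
    have "(\<lambda>n. dist_X (u_flow \<gamma> \<alpha> \<rho> (\<tau> n) \<omega>\<^sub>0 x\<^sub>0) (c \<omega>)) \<longlonglongrightarrow> 0"
    proof (rule tendsto_sandwich[OF _ _ tendsto_const tendsto_add_zero[OF 1 2]])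
      show "\<forall>\<^sub>F n in sequentially. 0 \<le> dist_X (u_flow \<gamma> \<alpha> \<rho> (\<tau> n) \<omega>\<^sub>0 x\<^sub>0) (c \<omega>)" by simp
      show "\<forall>\<^sub>F n in sequentially. dist_X (u_flow \<gamma> \<alpha> \<rho> (\<tau> n) \<omega>\<^sub>0 x\<^sub>0) (c \<omega>)
          \<le> dist_X (u_flow \<gamma> \<alpha> \<rho> (\<tau> n) \<omega>\<^sub>0 x\<^sub>0) (c (translate \<omega>\<^sub>0 (\<tau> n))) + dist_X (c (translate \<omega>\<^sub>0 (\<tau> n))) (c \<omega>)"
        using BU.triangle u0BU cBU[OF p(2)] cBU[OF hull_of_translate[OF omega0]] by (simp add: u0)
    qed
    moreover have "0 \<le> \<tau> n" for n using \<tau>(2)[of n] of_nat_0_le_iff[of n] by linarith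
    ultimately show "p \<in> omega_limit \<gamma> \<alpha> \<rho> (hull_of g) \<omega>\<^sub>0 x\<^sub>0"
      using p cBU[OF p(2)] \<tau>(1,3) top unfolding omega_limit_def by blast
  qed
  then show ?thesis using sol0 bounded eq cmap lim by blast
qed

end
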